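(* Let $p=p(n)\in(0,1)$ and let $K_{n,p}$ denote the number of edges of the random symmetric edge polytope $P_{n,p}$. Then, as $n\to\infty$, $$\mathbb{V}(K_{n,p})\simeq n^6p^3(1-p)\bigl(1-\sqrt2\,p\bigr)^2+n^5p^3(1-p)+n^4p^2(1-p)$$ $$\simeq\begin{cases} n^6p^3(1-p)\bigl(1-\sqrt2\,p\bigr)^2+n^5p^3(1-p), & \text{if } p\gg n^{-2},\\ n^4p^2, & \text{if } p\lesssim n^{-2}.\end{cases}$$ In particular, $\mathbb{V}(K_{n,p})\to\infty$ if and only if $p\gg n^{-2}$ and $1-p\gg n^{-6}$.
   Context: For a finite simple graph $G=(V,E)$ (elements of $V$ are nodes, elements of $E\subseteq\binom V2$ are arcs), with $(\mathbf{e}_i)_{i\in V}$ the standard basis of $\mathbb{R}^V$, the symmetric edge polytope is $P_G:=\operatorname{conv}\{\pm(\mathbf{e}_i-\mathbf{e}_j):\{i,j\}\in E\}\subset\mathbb{R}^V$ (empty if $E=\emptyset$). A face of a polytope is its intersection with a supporting hyperplane; the polytope itself is not regarded as a face. Edges of a polytope are its $1$-dimensional faces (so if $G$ has exactly one arc, $P_G$ has no edges). $G_{n,p}$ is the Erdős–Rényi random graph on node set $[n]$, each arc of the complete graph being retained independently with probability $p=p(n)\in(0,1)$; $P_{n,p}:=P_{G_{n,p}}$. $\mathbb{V}$ denotes variance. Asymptotic notation for sequences: $a_n\simeq b_n$ means $0<\liminf|a_n/b_n|\le\limsup|a_n/b_n|<\infty$; $a_n\gg b_n$ means $\liminf|a_n/b_n|=\infty$;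 $a_n\lesssim b_n$ means $\limsup|a_n/b_n|<\infty$. A case distinction means: if the sequence $p=p(n)$ satisfies the asymptotic condition, then the corresponding relation holds. *)

theory Defs
  imports "HOL-Analysis.Finite_Function_Topology" "HOL-Probability.Probability"
begin

section \<open>Symmetric edge polytopes\<close>

text \<open>
  A finite simple graph is given by its node set \<open>V\<close> and its set \<open>E\<close> of arcs, which are
  two-element subsets of \<open>V\<close>. The space \<open>\<real>\<^sup>V\<close> is the set of finitely supported functions with
  support in \<open>V\<close>, so that graphs on \<open>n\<close> nodes for all \<open>n\<close> share one ambient type.
\<close>

type_synonym 'v vect = "'v \<Rightarrow>\<^sub>0 real"

definition vect_space :: "'v set \<Rightarrow> 'v vect set" where
  "vect_space V = {x. Poly_Mapping.keys x \<subseteq> V}"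

definition vect_inner :: "'v set \<Rightarrow> 'v vect \<Rightarrow> 'v vect \<Rightarrow> real" where
  "vect_inner V a x = (\<Sum>i\<in>V. Poly_Mapping.lookup a i * Poly_Mapping.lookup x i)"

abbreviation unit_vect :: "'v \<Rightarrow> 'v vect" where
  "unit_vect i \<equiv> Poly_Mapping.single i 1"

definition all_arcs :: "'v set \<Rightarrow> 'v set set" where
  "all_arcs V = {e. e \<subseteq> V \<and> card e = 2}"

definition symmetric_edge_polytope :: "'v set set \<Rightarrow> 'v vect set" where
  "symmetric_edge_polytope E =
     convex hull (\<Union>(i, j)\<in>{(i, j). {i, j} \<in> E}.
       {unit_vect i - unit_vect j, - (unit_vect i - unit_vect j)})"

definition supporting_hyperplane :: "'v set \<Rightarrow> 'v vect set \<Rightarrow> 'v vect set \<Rightarrow> bool" where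
  "supporting_hyperplane V H P \<longleftrightarrow>
     (\<exists>a b. a \<in> vect_space V \<and> a \<noteq> 0 \<and>
        H = {x \<in> vect_space V. vect_inner V a x = b} \<and>
        (\<forall>x\<in>P. vect_inner V a x \<le> b) \<and> P \<inter> H \<noteq> {})"

text \<open>
  The polytope itself is not a face. As \<open>P\<close> need not be full-dimensional, it may lie in a
  supporting hyperplane, so \<open>F \<noteq> P\<close> has to be required.
\<close>

definition polytope_face :: "'v set \<Rightarrow> 'v vect set \<Rightarrow> 'v vect set \<Rightarrow> bool" where
  "polytope_face V F P \<longleftrightarrow> (\<exists>H. supporting_hyperplane V H P \<and> F = P \<inter> H) \<and> F \<noteq> P"

text \<open>
  The dimension of a face is the dimension of its affine hull, i.e. of the linear space of
  directions of the hull, which is spanned by the differences of points of the face.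
  (\<^const>\<open>aff_dim\<close> is available for Euclidean spaces only.)
\<close>

definition polytope_edges :: "'v set \<Rightarrow> 'v vect set \<Rightarrow> 'v vect set set" where
  "polytope_edges V P = {F. polytope_face V F P \<and> dim {x - y | x y. x \<in> F \<and> y \<in> F} = 1}"


section \<open>The random symmetric edge polytope\<close>

definition erdos_renyi :: "nat \<Rightarrow> real \<Rightarrow> nat set set pmf" where
  "erdos_renyi n p =
     map_pmf (\<lambda>f. {e \<in> all_arcs {1..n}. f e})
       (Pi_pmf (all_arcs {1..n}) False (\<lambda>_. bernoulli_pmf p))"

definition num_edges :: "nat \<Rightarrow> nat set set \<Rightarrow> real" where
  "num_edges n E = real (card (polytope_edges {1..n} (symmetric_edge_polytope E)))"

definition variance_num_edges :: "nat \<Rightarrow> real \<Rightarrow> real" where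
  "variance_num_edges n p = measure_pmf.variance (erdos_renyi n p) (num_edges n)"


section \<open>Asymptotic comparison of sequences\<close>

definition asymp_order :: "(nat \<Rightarrow> real) \<Rightarrow> (nat \<Rightarrow> real) \<Rightarrow> bool" (infix \<open>\<simeq>\<close> 50) where
  "a \<simeq> b \<longleftrightarrow>
     0 < liminf (\<lambda>n. ereal \<bar>a n / b n\<bar>) \<and>
     liminf (\<lambda>n. ereal \<bar>a n / b n\<bar>) \<le> limsup (\<lambda>n. ereal \<bar>a n / b n\<bar>) \<and>
     limsup (\<lambda>n. ereal \<bar>a n / b n\<bar>) < \<infinity>"

definition asymp_dominates :: "(nat \<Rightarrow> real) \<Rightarrow> (nat \<Rightarrow> real) \<Rightarrow> bool" (infix \<open>\<ggreater>\<close> 50) where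
  "a \<ggreater> b \<longleftrightarrow> liminf (\<lambda>n. ereal \<bar>a n / b n\<bar>) = \<infinity>"

definition asymp_bounded :: "(nat \<Rightarrow> real) \<Rightarrow> (nat \<Rightarrow> real) \<Rightarrow> bool" (infix \<open>\<lesssim>\<close> 50) where
  "a \<lesssim> b \<longleftrightarrow> limsup (\<lambda>n. ereal \<bar>a n / b n\<bar>) < \<infinity>"

end

theory Submission
  imports Defs
begin

text \<open>
  Two directed arcs \<open>i \<rightarrow> j\<close>, \<open>k \<rightarrow> l\<close> span an edge of the polytope iff some height function on the
  nodes drops by \<open>1\<close> along both and by less than \<open>1\<close> along every other directed arc. Counting the
  pairs that fail this gives \<open>2 K = M\<^sup>2 - 2 M - Q - 2 Z\<close>, where \<open>M\<close> is the number of directed arcs,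
  \<open>Q\<close> the number of labelled 4-cycles, and \<open>Z\<close> the number of directed 2-paths whose end points are
  adjacent or have a second common neighbour. Adding or deleting an arc changes \<open>Z\<close> only by a
  multiple of the number of adjacent arcs, so by the Efron-Stein inequality its variance is smaller
  than the claimed order by a factor of \<open>1 / n\<close>.

  For the polynomial \<open>M\<^sup>2 - 2 M - Q\<close> the variance is enclosed by its first and second discrete
  derivatives. The expected first derivative is \<open>4 (n - 2) p ((n + 1) - 2 (n - 3) p\<^sup>2)\<close>, which
  produces the term with the factor \<open>(1 - \<surd>2 p)\<^sup>2\<close>. The second derivatives along adjacent and
  disjoint pairs of arcs produce the terms of order \<open>n\<^sup>5\<close> and \<open>n\<^sup>4\<close>. All bounds are uniform in \<open>p\<close>,
  so no case distinction on the sequence is needed before the end.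
\<close>


section \<open>Functions on the discrete cube\<close>

text \<open>The lower bound is the delicate side. For any function of independent arcs the variance
  is the sum, over nonempty arc sets T, of \<open>(p (1 - p))^|T|\<close> times the squared mean
  derivative along T. Keeping only |T| = 1 fails twice: at p near 1 / sqrt 2 the mean first
  derivative falls from order n^2 to order n, and for p below n^-2 its contribution n^6 p^3 is
  smaller than n^4 p^2. In both places the pairs of arcs make up for the loss, so the sum is cut
  after |T| = 2. Having a second common neighbour is a disjunction over all nodes, so Z is no
  polynomial of bounded degree and its mean derivatives are awkward. It is therefore kept apart:
  only its variance is bounded, its covariance with the polynomial is absorbed into constants, and
  the factor 1 / n makes it harmless for large n. The probability space is replaced by finite sums
  over subsets, which makes induction on the arc set available.\<close>

definition cube_exp :: "real \<Rightarrow> 'a set \<Rightarrow> ('a set \<Rightarrow> real) \<Rightarrow> real" where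
  "cube_exp p A f = (\<Sum>S\<in>Pow A. p ^ card S * (1 - p) ^ card (A - S) * f S)"

definition cube_var :: "real \<Rightarrow> 'a set \<Rightarrow> ('a set \<Rightarrow> real) \<Rightarrow> real" where
  "cube_var p A f = cube_exp p A (\<lambda>S. (f S - cube_exp p A f)\<^sup>2)"

text \<open>Removing \<open>e\<close> in the second argument makes the value independent of whether
  \<open>e\<close> lies in \<open>S\<close>. The derivative is thus a function of the other
  coordinates, and repeating it along \<open>e\<close> gives 0.\<close>

definition discrete_deriv :: "'a \<Rightarrow> ('a set \<Rightarrow> real) \<Rightarrow> 'a set \<Rightarrow> real" where
  "discrete_deriv e f S = f (insert e S) - f (S - {e})"

lemma cube_exp_empty [simp]: "cube_exp p {} f = f {}"
  by (simp add: cube_exp_def)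

text \<open>Conditioning on the coordinate \<open>a\<close>: the inner function is the conditional
  mean given the other coordinates. The inductions over the cube run through this identity.\<close>

lemma cube_exp_insert:
  assumes "finite A" "a \<notin> A"
  shows "cube_exp p (insert a A) f = cube_exp p A (\<lambda>S. p * f (insert a S) + (1 - p) * f S)"
proof -
  have inj: "inj_on (insert a) (Pow A)"
    using assms by (auto simp: inj_on_def)
  have "cube_exp p (insert a A) f
      = (\<Sum>S\<in>Pow A. p ^ card S * (1 - p) ^ card (insert a A - S) * f S)
      + (\<Sum>S\<in>Pow A. p ^ card (insert a S) * (1 - p) ^ card (insert a A - insert a S) * f (insert a S))"
    unfolding cube_exp_def Pow_insert
    by (subst sum.union_disjoint) (use assms inj in \<open>auto simp: sum.reindex\<close>)
  also have "\<dots> = (\<Sum>S\<in>Pow A. p ^ card S * (1 - p) ^ card (A - S) * (p * f (insert a S) + (1 - p) * f S))"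
    unfolding sum.distrib[symmetric]
  proof (rule sum.cong[OF refl])
    fix S assume S: "S \<in> Pow A"
    then have "finite S" "a \<notin> S" using assms finite_subset by auto
    moreover have "insert a A - S = insert a (A - S)" using \<open>a \<notin> S\<close> by auto
    moreover have "insert a A - insert a S = A - S" using assms S by auto
    ultimately show "p ^ card S * (1 - p) ^ card (insert a A - S) * f S
      + p ^ card (insert a S) * (1 - p) ^ card (insert a A - insert a S) * f (insert a S)
      = p ^ card S * (1 - p) ^ card (A - S) * (p * f (insert a S) + (1 - p) * f S)"
      using assms by (simp add: algebra_simps)
  qed
  finally show ?thesis by (simp add: cube_exp_def)
qed

lemma cube_exp_cong:
  "(\<And>S. S \<subseteq> A \<Longrightarrow> f S = g S) \<Longrightarrow> cube_exp p A f = cube_exp p A g"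
  by (auto simp: cube_exp_def intro!: sum.cong)

lemma cube_exp_add: "cube_exp p A (\<lambda>S. f S + g S) = cube_exp p A f + cube_exp p A g"
  by (simp add: cube_exp_def sum.distrib distrib_left)

lemma cube_exp_diff: "cube_exp p A (\<lambda>S. f S - g S) = cube_exp p A f - cube_exp p A g"
  by (simp add: cube_exp_def sum_subtractf right_diff_distrib)

lemma cube_exp_cmult: "cube_exp p A (\<lambda>S. c * f S) = c * cube_exp p A f"
  by (simp add: cube_exp_def sum_distrib_left mult_ac)

lemma cube_exp_sum: "cube_exp p A (\<lambda>S. \<Sum>i\<in>I. f i S) = (\<Sum>i\<in>I. cube_exp p A (f i))"
  unfolding cube_exp_def sum_distrib_left by (rule sum.swap)

lemma cube_exp_const: "finite A \<Longrightarrow> cube_exp p A (\<lambda>_. c) = c"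
  by (induction A rule: finite_induct) (auto simp: cube_exp_insert algebra_simps)

lemma cube_exp_mono:
  assumes "0 \<le> p" "p \<le> 1" "\<And>S. S \<subseteq> A \<Longrightarrow> f S \<le> g S"
  shows "cube_exp p A f \<le> cube_exp p A g"
  unfolding cube_exp_def using assms by (intro sum_mono mult_left_mono) auto

lemma cube_exp_nonneg:
  assumes "0 \<le> p" "p \<le> 1" "\<And>S. S \<subseteq> A \<Longrightarrow> 0 \<le> f S"
  shows "0 \<le> cube_exp p A f"
  unfolding cube_exp_def using assms by (intro sum_nonneg) auto

lemma cube_var_alt:
  assumes "finite A"
  shows "cube_var p A f = cube_exp p A (\<lambda>S. (f S)\<^sup>2) - (cube_exp p A f)\<^sup>2"
proof -
  let ?m = "cube_exp p A f"
  have "cube_var p A f = cube_exp p A (\<lambda>S. ((f S)\<^sup>2 - (2 * ?m) * f S) + ?m\<^sup>2)"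
    by (simp add: cube_var_def power2_diff algebra_simps)
  then show ?thesis
    using assms by (simp only: cube_exp_add cube_exp_diff cube_exp_cmult cube_exp_const)
      (simp add: power2_eq_square)
qed

lemma cube_exp_square:
  "finite A \<Longrightarrow> cube_exp p A (\<lambda>S. (f S)\<^sup>2) = (cube_exp p A f)\<^sup>2 + cube_var p A f"
  by (simp add: cube_var_alt)

lemma cube_var_cong:
  assumes "\<And>S. S \<subseteq> A \<Longrightarrow> f S = g S"
  shows "cube_var p A f = cube_var p A g"
proof -
  have "cube_exp p A f = cube_exp p A g" by (rule cube_exp_cong) (rule assms)
  then show ?thesis unfolding cube_var_def by (intro cube_exp_cong) (simp add: assms)
qed

lemma cube_var_nonneg: "0 \<le> p \<Longrightarrow> p \<le> 1 \<Longrightarrow> 0 \<le> cube_var p A f"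
  unfolding cube_var_def by (rule cube_exp_nonneg) auto

lemma cube_var_cmult: "cube_var p A (\<lambda>S. c * f S) = c\<^sup>2 * cube_var p A f"
  unfolding cube_var_def cube_exp_cmult right_diff_distrib[symmetric] power_mult_distrib ..

text \<open>Serves to split off the shortcut count without controlling its covariance with the
  polynomial part.\<close>

lemma cube_var_add_le:
  assumes "0 \<le> p" "p \<le> 1"
  shows "cube_var p A (\<lambda>S. f S + g S) \<le> 2 * cube_var p A f + 2 * cube_var p A g"
proof -
  have *: "(x + y)\<^sup>2 \<le> 2 * x\<^sup>2 + 2 * y\<^sup>2" for x y :: real
    using zero_le_power2[of "x - y"] by (simp add: power2_sum power2_diff)
  let ?x = "\<lambda>S. f S - cube_exp p A f" and ?y = "\<lambda>S. g S - cube_exp p A g"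
  have "cube_var p A (\<lambda>S. f S + g S) = cube_exp p A (\<lambda>S. (?x S + ?y S)\<^sup>2)"
    unfolding cube_var_def cube_exp_add by (simp add: algebra_simps)
  also have "\<dots> \<le> cube_exp p A (\<lambda>S. 2 * (?x S)\<^sup>2 + 2 * (?y S)\<^sup>2)"
    by (rule cube_exp_mono) (use assms * in auto)
  finally show ?thesis by (simp only: cube_exp_add cube_exp_cmult cube_var_def)
qed

section \<open>Variance inequalities in terms of discrete derivatives\<close>

lemma cube_exp_discrete_deriv_insert:
  assumes "finite A" "a \<notin> A"
  shows "cube_exp p (insert a A) (\<lambda>S. h (discrete_deriv a f S)) = cube_exp p A (\<lambda>S. h (discrete_deriv a f S))"
  unfolding cube_exp_insert[OF assms]
  by (rule cube_exp_cong) (use assms in \<open>auto simp: discrete_deriv_def algebra_simps\<close>)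

text \<open>Averaging over \<open>a\<close> and differencing along \<open>e\<close> are linear
  operations on different coordinates, hence commute. This lets an inductive hypothesis be applied
  to the conditional mean.\<close>

lemma discrete_deriv_average:
  assumes "e \<noteq> a"
  shows "discrete_deriv e (\<lambda>S. p * f (insert a S) + (1 - p) * f S)
    = (\<lambda>S. p * discrete_deriv e f (insert a S) + (1 - p) * discrete_deriv e f S)"
proof
  fix S
  have "insert e (insert a S) = insert a (insert e S)" "insert a S - {e} = insert a (S - {e})"
    using assms by auto
  then show "discrete_deriv e (\<lambda>S. p * f (insert a S) + (1 - p) * f S) S
    = p * discrete_deriv e f (insert a S) + (1 - p) * discrete_deriv e f S"
    by (simp add: discrete_deriv_def algebra_simps)
qed

lemma discrete_deriv_commute:
  "discrete_deriv a (discrete_deriv b f) = discrete_deriv b (discrete_deriv a f)"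
proof
  fix S
  have *: "insert b S - {a} = insert b (S - {a})" "insert a S - {b} = insert a (S - {b})" if "a \<noteq> b"
    using that by auto
  have "S - {a} - {b} = S - {b} - {a}" by auto
  with * show "discrete_deriv a (discrete_deriv b f) S = discrete_deriv b (discrete_deriv a f) S"
    by (cases "a = b") (simp_all add: discrete_deriv_def insert_commute[of a b S])
qed

text \<open>Law of total variance. Given the other coordinates, \<open>f\<close> takes two values
  with probabilities \<open>p\<close> and \<open>1 - p\<close>, and such a variable has variance
  \<open>p * (1 - p)\<close> times the squared difference.\<close>

lemma cube_var_insert:
  assumes "finite A" "a \<notin> A"
  shows "cube_var p (insert a A) f
    = p * (1 - p) * cube_exp p A (\<lambda>S. (discrete_deriv a f S)\<^sup>2)
      + cube_var p A (\<lambda>S. p * f (insert a S) + (1 - p) * f S)"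
proof -
  have "cube_exp p A (\<lambda>S. p * (f (insert a S))\<^sup>2 + (1 - p) * (f S)\<^sup>2)
      = cube_exp p A (\<lambda>S. (p * (1 - p)) * (discrete_deriv a f S)\<^sup>2 + (p * f (insert a S) + (1 - p) * f S)\<^sup>2)"
  proof (rule cube_exp_cong)
    fix S assume "S \<subseteq> A"
    then have "S - {a} = S" using assms by auto
    then show "p * (f (insert a S))\<^sup>2 + (1 - p) * (f S)\<^sup>2
        = (p * (1 - p)) * (discrete_deriv a f S)\<^sup>2 + (p * f (insert a S) + (1 - p) * f S)\<^sup>2"
      by (simp add: discrete_deriv_def power2_eq_square algebra_simps)
  qed
  then show ?thesis
    using assms by (simp add: cube_var_alt cube_exp_insert cube_exp_add cube_exp_cmult)
qed

text \<open>The total variance splits off one derivative exactly. The inductive hypothesis treats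
  the conditional mean, and Jensen's inequality leads from its derivatives back to those of
  \<open>f\<close>.\<close>

theorem efron_stein:
  assumes "0 \<le> p" "p \<le> 1" "finite A"
  shows "cube_var p A f \<le> p * (1 - p) * (\<Sum>e\<in>A. cube_exp p A (\<lambda>S. (discrete_deriv e f S)\<^sup>2))"
  using assms(3)
proof (induction A arbitrary: f rule: finite_induct)
  case empty
  then show ?case by (simp add: cube_var_def)
next
  case (insert a A)
  let ?g = "\<lambda>S. p * f (insert a S) + (1 - p) * f S"
  have convex: "(p * x + (1 - p) * y)\<^sup>2 \<le> p * x\<^sup>2 + (1 - p) * y\<^sup>2" for x y :: real
  proof -
    have "p * x\<^sup>2 + (1 - p) * y\<^sup>2 - (p * x + (1 - p) * y)\<^sup>2 = p * (1 - p) * (x - y)\<^sup>2"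
      by algebra
    moreover have "0 \<le> p * (1 - p) * (x - y)\<^sup>2" using assms by simp
    ultimately show ?thesis by linarith
  qed
  have "cube_exp p A (\<lambda>S. (discrete_deriv e ?g S)\<^sup>2)
      \<le> cube_exp p (insert a A) (\<lambda>S. (discrete_deriv e f S)\<^sup>2)" if "e \<in> A" for e
  proof -
    have "e \<noteq> a" using that insert.hyps by auto
    then show ?thesis
      unfolding discrete_deriv_average[OF \<open>e \<noteq> a\<close>] cube_exp_insert[OF insert.hyps]
      by (intro cube_exp_mono assms convex)
  qed
  then have "(\<Sum>e\<in>A. cube_exp p A (\<lambda>S. (discrete_deriv e ?g S)\<^sup>2))
      \<le> (\<Sum>e\<in>A. cube_exp p (insert a A) (\<lambda>S. (discrete_deriv e f S)\<^sup>2))"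
    by (rule sum_mono)
  then have "p * (1 - p) * (\<Sum>e\<in>A. cube_exp p A (\<lambda>S. (discrete_deriv e ?g S)\<^sup>2))
      \<le> p * (1 - p) * (\<Sum>e\<in>A. cube_exp p (insert a A) (\<lambda>S. (discrete_deriv e f S)\<^sup>2))"
    by (rule mult_left_mono) (use assms in auto)
  with insert.IH[of ?g] show ?case
    unfolding cube_var_insert[OF insert.hyps] sum.insert[OF insert.hyps]
      cube_exp_discrete_deriv_insert[OF insert.hyps, where h = "\<lambda>x. x\<^sup>2"]
    by (simp add: distrib_left)
qed

text \<open>Bessel's inequality for the degree-one part of the orthogonal expansion. Mean
  derivatives pass to the conditional mean without loss; what is given away is the variance of
  \<open>discrete_deriv a f\<close>.\<close>

lemma cube_var_ge_first_order:
  assumes "0 \<le> p" "p \<le> 1" "finite A"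
  shows "p * (1 - p) * (\<Sum>e\<in>A. (cube_exp p A (discrete_deriv e f))\<^sup>2) \<le> cube_var p A f"
  using assms(3)
proof (induction A arbitrary: f rule: finite_induct)
  case empty
  then show ?case by (simp add: cube_var_def)
next
  case (insert a A)
  let ?g = "\<lambda>S. p * f (insert a S) + (1 - p) * f S"
  have "cube_exp p A (discrete_deriv e ?g) = cube_exp p (insert a A) (discrete_deriv e f)"
    if "e \<in> A" for e
  proof -
    have "e \<noteq> a" using that insert.hyps by auto
    then show ?thesis
      unfolding cube_exp_insert[OF insert.hyps] using discrete_deriv_average[of e a p f] by simp
  qed
  then have 1: "p * (1 - p) * (\<Sum>e\<in>A. (cube_exp p (insert a A) (discrete_deriv e f))\<^sup>2) \<le> cube_var p A ?g"
    using insert.IH[of ?g] by simp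
  have "p * (1 - p) * (cube_exp p (insert a A) (discrete_deriv a f))\<^sup>2
      \<le> p * (1 - p) * cube_exp p A (\<lambda>S. (discrete_deriv a f S)\<^sup>2)"
    using cube_exp_discrete_deriv_insert[OF insert.hyps, where h = "\<lambda>x. x" and f = f and p = p]
      cube_var_nonneg[OF assms(1,2), of A "discrete_deriv a f"] assms insert.hyps
    by (intro mult_left_mono) (auto simp: cube_exp_square)
  with 1 show ?case
    unfolding cube_var_insert[OF insert.hyps] sum.insert[OF insert.hyps]
    by (simp add: distrib_left)
qed

text \<open>Bessel's inequality cut after degree two; the factor 1/2 compensates for summing over
  ordered pairs. In the induction the new pairs, those containing \<open>a\<close>, come from the
  first-order bound applied to \<open>discrete_deriv a f\<close>.\<close>

theorem cube_var_ge_second_order: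
  assumes "0 \<le> p" "p \<le> 1" "finite A"
  shows "p * (1 - p) * (\<Sum>e\<in>A. (cube_exp p A (discrete_deriv e f))\<^sup>2)
    + (p * (1 - p))\<^sup>2 / 2 * (\<Sum>e\<in>A. \<Sum>g\<in>A - {e}. (cube_exp p A (discrete_deriv g (discrete_deriv e f)))\<^sup>2)
    \<le> cube_var p A f"
  using assms(3)
proof (induction A arbitrary: f rule: finite_induct)
  case empty
  then show ?case by (simp add: cube_var_def)
next
  case (insert a A)
  let ?B = "insert a A"
  let ?avg = "\<lambda>S. p * f (insert a S) + (1 - p) * f S"
  define h where "h e g = (cube_exp p ?B (discrete_deriv g (discrete_deriv e f)))\<^sup>2" for e g
  have h_sym: "h e g = h g e" for e g
    unfolding h_def using discrete_deriv_commute[of e g f] by presburger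
  have avg1: "cube_exp p A (discrete_deriv e ?avg) = cube_exp p ?B (discrete_deriv e f)"
    if "e \<in> A" for e
  proof -
    have "e \<noteq> a" using that insert.hyps by auto
    then show ?thesis
      unfolding cube_exp_insert[OF insert.hyps] using discrete_deriv_average[of e a p f] by simp
  qed
  have avg2: "(cube_exp p A (discrete_deriv g (discrete_deriv e ?avg)))\<^sup>2 = h e g"
    if "e \<in> A" "g \<in> A" for e g
  proof -
    have "e \<noteq> a" "g \<noteq> a" using that insert.hyps by auto
    then show ?thesis
      unfolding h_def cube_exp_insert[OF insert.hyps]
      using discrete_deriv_average[of e a p f] discrete_deriv_average[of g a p "discrete_deriv e f"]
      by simp
  qed
  have IH: "p * (1 - p) * (\<Sum>e\<in>A. (cube_exp p ?B (discrete_deriv e f))\<^sup>2)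
      + (p * (1 - p))\<^sup>2 / 2 * (\<Sum>e\<in>A. \<Sum>g\<in>A - {e}. h e g) \<le> cube_var p A ?avg"
    using insert.IH[of ?avg] by (simp add: avg1 avg2)
  have "h a g = (cube_exp p A (discrete_deriv g (discrete_deriv a f)))\<^sup>2" if "g \<in> A" for g
    using discrete_deriv_commute[of g a f]
      cube_exp_discrete_deriv_insert[OF insert.hyps, of p "\<lambda>x. x" "discrete_deriv g f"]
    by (simp add: h_def)
  then have first: "p * (1 - p) * (\<Sum>g\<in>A. h a g) \<le> cube_var p A (discrete_deriv a f)"
    using cube_var_ge_first_order[OF assms(1,2) insert.hyps(1), of "discrete_deriv a f"] by simp
  \<comment> \<open>The second moment is the squared mean plus the variance; the variance, dropped
    in the first-order bound, supplies the pairs with \<open>a\<close>.\<close>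
  have "p * (1 - p) * ((cube_exp p ?B (discrete_deriv a f))\<^sup>2 + p * (1 - p) * (\<Sum>g\<in>A. h a g))
      \<le> p * (1 - p) * cube_exp p A (\<lambda>S. (discrete_deriv a f S)\<^sup>2)"
    using first assms insert.hyps
      cube_exp_discrete_deriv_insert[OF insert.hyps, where h = "\<lambda>x. x" and f = f and p = p]
    by (intro mult_left_mono) (auto simp: cube_exp_square)
  moreover have "(\<Sum>e\<in>?B. \<Sum>g\<in>?B - {e}. h e g) = 2 * (\<Sum>g\<in>A. h a g) + (\<Sum>e\<in>A. \<Sum>g\<in>A - {e}. h e g)"
  proof -
    have "(\<Sum>g\<in>?B - {e}. h e g) = h a e + (\<Sum>g\<in>A - {e}. h e g)" if "e \<in> A" for e
    proof -
      have "?B - {e} = insert a (A - {e})" using that insert.hyps by auto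
      then show ?thesis using insert.hyps h_sym by simp
    qed
    moreover have "?B - {a} = A" using insert.hyps by auto
    ultimately show ?thesis using insert.hyps by (simp add: sum.distrib)
  qed
  \<comment> \<open>The remaining arithmetic, freed from the large terms:
    \<open>r\<^sup>2 / 2 * (2 * s)\<close> is exactly \<open>r * (r * s)\<close>.\<close>
  moreover have "r * (x + u) + r\<^sup>2 / 2 * d \<le> r * y + v"
    if "r * (x + r * s) \<le> r * y" "d = 2 * s + t" "r * u + r\<^sup>2 / 2 * t \<le> v"
    for r x s y d t u v :: real
  proof -
    have "r * (x + u) + r\<^sup>2 / 2 * d = r * (x + r * s) + (r * u + r\<^sup>2 / 2 * t)"
      unfolding that(2) by (simp add: field_simps power2_eq_square)
    then show ?thesis using that by linarith
  qed
  ultimately show ?case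
    using IH unfolding h_def[symmetric] cube_var_insert[OF insert.hyps] sum.insert[OF insert.hyps]
    by blast
qed

text \<open>Efron-Stein twice: the second moment of a first derivative is its squared mean plus its
  variance, and that variance is again estimated by derivatives.\<close>

lemma cube_var_le_second_order:
  assumes "0 \<le> p" "p \<le> 1" "finite A"
  shows "cube_var p A f \<le> p * (1 - p) * (\<Sum>e\<in>A. (cube_exp p A (discrete_deriv e f))\<^sup>2
    + p * (1 - p) * (\<Sum>g\<in>A. cube_exp p A (\<lambda>S. (discrete_deriv g (discrete_deriv e f) S)\<^sup>2)))"
proof -
  have "cube_exp p A (\<lambda>S. (discrete_deriv e f S)\<^sup>2) \<le> (cube_exp p A (discrete_deriv e f))\<^sup>2
    + p * (1 - p) * (\<Sum>g\<in>A. cube_exp p A (\<lambda>S. (discrete_deriv g (discrete_deriv e f) S)\<^sup>2))" for e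
    using efron_stein[OF assms, of "discrete_deriv e f"] assms by (simp add: cube_exp_square)
  then have "p * (1 - p) * (\<Sum>e\<in>A. cube_exp p A (\<lambda>S. (discrete_deriv e f S)\<^sup>2)) \<le>
    p * (1 - p) * (\<Sum>e\<in>A. (cube_exp p A (discrete_deriv e f))\<^sup>2
    + p * (1 - p) * (\<Sum>g\<in>A. cube_exp p A (\<lambda>S. (discrete_deriv g (discrete_deriv e f) S)\<^sup>2)))"
    using assms by (intro mult_left_mono sum_mono) auto
  with efron_stein[OF assms, of f] show ?thesis by linarith
qed

section \<open>Monomials in the coordinates, and the link to the random graph\<close>

lemma cube_exp_monomial:
  assumes "finite A" "B \<subseteq> A"
  shows "cube_exp p A (\<lambda>S. of_bool (B \<subseteq> S)) = p ^ card B"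
  using assms
proof (induction A arbitrary: B rule: finite_induct)
  case (insert a A)
  have sub: "B - {a} \<subseteq> A" using insert.prems by auto
  have "finite B" using insert.prems insert.hyps finite_subset by blast
  show ?case
  proof (cases "a \<in> B")
    case True
    have "cube_exp p (insert a A) (\<lambda>S. of_bool (B \<subseteq> S)) = cube_exp p A (\<lambda>S. p * of_bool (B - {a} \<subseteq> S))"
      unfolding cube_exp_insert[OF insert.hyps]
      by (rule cube_exp_cong) (use True insert.hyps in auto)
    also have "\<dots> = p * p ^ card (B - {a})"
      using insert.IH[OF sub] by (simp add: cube_exp_cmult)
    also have "\<dots> = p ^ card B"
      using True \<open>finite B\<close> by (metis card_Suc_Diff1 power_Suc)
    finally show ?thesis .
  next
    case False
    then have "cube_exp p (insert a A) (\<lambda>S. of_bool (B \<subseteq> S)) = cube_exp p A (\<lambda>S. of_bool (B \<subseteq> S))"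
      unfolding cube_exp_insert[OF insert.hyps]
      by (intro cube_exp_cong) (auto simp: subset_insert)
    with insert.IH[of B] False sub show ?thesis by simp
  qed
qed simp

lemma discrete_deriv_monomial:
  "discrete_deriv e (\<lambda>S. of_bool (B \<subseteq> S)) S = of_bool (e \<in> B \<and> B - {e} \<subseteq> S)"
  by (auto simp: discrete_deriv_def)

lemma discrete_deriv_sum:
  "discrete_deriv e (\<lambda>S. \<Sum>i\<in>I. f i S) S = (\<Sum>i\<in>I. discrete_deriv e (f i) S)"
  by (simp add: discrete_deriv_def sum_subtractf)

text \<open>The second moment of a binomial variable by counting pairs: \<open>b = c\<close> has
  probability \<open>p\<close>, any other pair \<open>p\<^sup>2\<close>. Charging the diagonal with
  both gives the simple form.\<close>

lemma cube_exp_card_Int_square_le: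
  assumes "0 \<le> p" "p \<le> 1" "finite A" "B \<subseteq> A"
  shows "cube_exp p A (\<lambda>S. (real (card (B \<inter> S)))\<^sup>2) \<le> real (card B) * p + (real (card B) * p)\<^sup>2"
proof -
  have fin: "finite B" using assms finite_subset by blast
  have "(real (card (B \<inter> S)))\<^sup>2 = (\<Sum>b\<in>B. \<Sum>c\<in>B. of_bool ({b, c} \<subseteq> S))" for S
  proof -
    have "real (card (B \<inter> S)) = (\<Sum>b\<in>B. of_bool (b \<in> S))"
      using fin by (simp add: sum_of_bool_eq)
    then show ?thesis
      by (simp add: power2_eq_square sum_product of_bool_conj)
  qed
  then have "cube_exp p A (\<lambda>S. (real (card (B \<inter> S)))\<^sup>2) = (\<Sum>b\<in>B. \<Sum>c\<in>B. p ^ card {b, c})"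
    using assms unfolding cube_exp_sum by (simp only: cube_exp_sum)
      (intro sum.cong refl cube_exp_monomial, auto)
  also have "\<dots> \<le> (\<Sum>b\<in>B. \<Sum>c\<in>B. (if b = c then p else 0) + p\<^sup>2)"
    using assms by (intro sum_mono) (auto simp: card_insert_if power2_eq_square)
  also have "\<dots> = real (card B) * p + (real (card B) * p)\<^sup>2"
    using fin by (simp add: sum.distrib power2_eq_square algebra_simps)
  finally show ?thesis .
qed

lemma expectation_random_subset:
  assumes "finite A" "0 \<le> p" "p \<le> 1"
  shows "measure_pmf.expectation (map_pmf (\<lambda>f. {e \<in> A. f e}) (Pi_pmf A False (\<lambda>_. bernoulli_pmf p))) g
    = cube_exp p A g"
proof -
  let ?M = "Pi_pmf A False (\<lambda>_. bernoulli_pmf p)"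
  let ?ind = "\<lambda>S e. e \<in> S"
  \<comment> \<open>The default value \<open>False\<close> off \<open>A\<close> makes a subset of
    \<open>A\<close> and its indicator function determine each other.\<close>
  have "bij_betw ?ind (Pow A) (PiE_dflt A False (\<lambda>_. UNIV))"
    by (rule bij_betw_byWitness[where f' = "\<lambda>f. {e \<in> A. f e}"]) (auto simp: PiE_dflt_def)
  moreover have "set_pmf ?M \<subseteq> PiE_dflt A False (\<lambda>_. UNIV)"
    using set_Pi_pmf_subset[OF assms(1), of False "\<lambda>_. bernoulli_pmf p"] by (auto simp: PiE_dflt_def)
  moreover have "finite (PiE_dflt A False (\<lambda>_. UNIV :: bool set))"
    using assms by (intro finite_PiE_dflt) auto
  ultimately have "measure_pmf.expectation (map_pmf (\<lambda>f. {e \<in> A. f e}) ?M) g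
      = (\<Sum>S\<in>Pow A. g {e \<in> A. ?ind S e} * pmf ?M (?ind S))"
    by (subst integral_map_pmf, subst integral_measure_pmf_real[of "PiE_dflt A False (\<lambda>_. UNIV)"])
      (auto simp: sum.reindex_bij_betw[symmetric] intro!: sum.cong)
  also have "\<dots> = cube_exp p A g"
    unfolding cube_exp_def
  proof (rule sum.cong[OF refl])
    fix S assume S: "S \<in> Pow A"
    then have *: "A = S \<union> (A - S)" by auto
    have fin: "finite S" using S assms finite_subset by auto
    have "pmf ?M (?ind S) = (\<Prod>e\<in>A. pmf (bernoulli_pmf p) (e \<in> S))"
      using S assms by (intro pmf_Pi') auto
    also have "\<dots> = (\<Prod>e\<in>S. pmf (bernoulli_pmf p) (e \<in> S)) * (\<Prod>e\<in>A - S. pmf (bernoulli_pmf p) (e \<in> S))"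
      using * fin assms by (metis (no_types, lifting) S Pow_iff mult.commute prod.subset_diff)
    also have "\<dots> = p ^ card S * (1 - p) ^ card (A - S)"
      using assms by simp
    finally have "pmf ?M (?ind S) = p ^ card S * (1 - p) ^ card (A - S)" .
    moreover have "{e \<in> A. e \<in> S} = S" using S by auto
    ultimately show "g {e \<in> A. e \<in> S} * pmf ?M (?ind S) = p ^ card S * (1 - p) ^ card (A - S) * g S"
      by simp
  qed
  finally show ?thesis .
qed


section \<open>Edges of symmetric edge polytopes\<close>

lemma lookup_scaleR: "Poly_Mapping.lookup (c *\<^sub>R x) i = c * Poly_Mapping.lookup (x :: 'v vect) i"
proof -
  have "{i. c *\<^sub>R Poly_Mapping.lookup x i \<noteq> 0} \<subseteq> Poly_Mapping.keys x"
    by (auto simp: in_keys_iff)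
  then have "finite {i. c *\<^sub>R Poly_Mapping.lookup x i \<noteq> 0}"
    by (rule finite_subset) simp
  then show ?thesis
    by (simp add: scaleR_poly_mapping_def Abs_poly_mapping_inverse)
qed

lemma vect_inner_commute: "vect_inner V a x = vect_inner V x a"
  by (simp add: vect_inner_def mult.commute)

lemma vect_inner_add: "vect_inner V a (x + y) = vect_inner V a x + vect_inner V a y"
  by (simp add: vect_inner_def lookup_add distrib_left sum.distrib)

lemma vect_inner_diff: "vect_inner V a (x - y) = vect_inner V a x - vect_inner V a y"
  by (simp add: vect_inner_def lookup_minus right_diff_distrib sum_subtractf)

lemma vect_inner_uminus: "vect_inner V a (- x) = - vect_inner V a x"
  by (simp add: vect_inner_def sum_negf)

lemma vect_inner_scaleR: "vect_inner V a (c *\<^sub>R x) = c * vect_inner V a x"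
  by (simp add: vect_inner_def lookup_scaleR sum_distrib_left mult_ac)

lemma vect_inner_scaleR_left: "vect_inner V (c *\<^sub>R a) x = c * vect_inner V a x"
  by (metis vect_inner_commute vect_inner_scaleR)

lemma vect_inner_sum: "vect_inner V a (\<Sum>x\<in>X. f x) = (\<Sum>x\<in>X. vect_inner V a (f x))"
  by (induction X rule: infinite_finite_induct) (simp_all add: vect_inner_add, simp_all add: vect_inner_def)

lemma vect_inner_unit: "finite V \<Longrightarrow> i \<in> V \<Longrightarrow> vect_inner V a (unit_vect i) = Poly_Mapping.lookup a i"
  by (simp add: vect_inner_def lookup_single when_def if_distrib[of "\<lambda>x. _ * x"] sum.delta' cong: if_cong)

lemma vect_inner_self_pos:
  assumes "finite V" "x \<in> vect_space V" "x \<noteq> 0"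
  shows "0 < vect_inner V x x"
proof -
  obtain i where "i \<in> Poly_Mapping.keys x"
    using assms(3) by (metis all_not_in_conv keys_eq_empty)
  then have "i \<in> V" "0 < Poly_Mapping.lookup x i * Poly_Mapping.lookup x i"
    using assms(2) by (auto simp: vect_space_def in_keys_iff zero_less_mult_iff)
  then show ?thesis
    unfolding vect_inner_def using assms(1) by (intro sum_pos2[of V i]) auto
qed

lemma vect_space_iff: "x \<in> vect_space V \<longleftrightarrow> (\<forall>i. i \<notin> V \<longrightarrow> Poly_Mapping.lookup x i = 0)"
  by (auto simp: vect_space_def in_keys_iff)

lemma subspace_vect_space: "subspace (vect_space V)"
  by (simp add: subspace_def vect_space_iff lookup_add lookup_scaleR)

lemma convex_halfspace_vect_inner: "convex {x. vect_inner V a x \<le> b}"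
  by (rule convexI) (auto simp: vect_inner_add vect_inner_scaleR intro!: convex_bound_le)

lemma convex_hyperplane_vect_inner: "convex {x \<in> vect_space V. vect_inner V a x = b}"
proof -
  have "convex {x. vect_inner V a x = b}"
    by (rule convexI) (auto simp: vect_inner_add vect_inner_scaleR algebra_simps simp flip: distrib_right)
  then have "convex (vect_space V \<inter> {x. vect_inner V a x = b})"
    by (rule convex_Int[OF subspace_imp_convex[OF subspace_vect_space]])
  then show ?thesis by (simp add: Int_def)
qed

text \<open>A convex combination of values at most \<open>b\<close> equals \<open>b\<close> only if
  every point with a smaller value has weight 0.\<close>

lemma hull_Int_supporting_hyperplane:
  assumes "finite W" "W \<subseteq> vect_space V" "\<And>w. w \<in> W \<Longrightarrow> vect_inner V a w \<le> b"
  shows "convex hull W \<inter> {x \<in> vect_space V. vect_inner V a x = b} = convex hull {w \<in> W. vect_inner V a w = b}"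
    (is "_ \<inter> ?H = convex hull ?F")
proof
  show "convex hull ?F \<subseteq> convex hull W \<inter> ?H"
    using assms(2) by (intro Int_greatest hull_mono hull_minimal convex_hyperplane_vect_inner) auto
  show "convex hull W \<inter> ?H \<subseteq> convex hull ?F"
  proof
    fix x assume x: "x \<in> convex hull W \<inter> ?H"
    then obtain u where u: "\<And>w. w \<in> W \<Longrightarrow> 0 \<le> u w" "sum u W = 1" "(\<Sum>w\<in>W. u w *\<^sub>R w) = x"
      using convex_hull_finite[OF assms(1)] by auto
    have "(\<Sum>w\<in>W. u w * vect_inner V a w) = b"
      using x unfolding u(3)[symmetric] by (auto simp: vect_inner_sum vect_inner_scaleR)
    then have "(\<Sum>w\<in>W. u w * (b - vect_inner V a w)) = 0"
      using u(2) by (simp add: right_diff_distrib sum_subtractf flip: sum_distrib_right)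
    then have 0: "u w * (b - vect_inner V a w) = 0" if "w \<in> W" for w
      using sum_nonneg_eq_0_iff[OF assms(1), of "\<lambda>w. u w * (b - vect_inner V a w)"] u(1) assms(3) that
      by auto
    then have zero: "u w = 0" if "w \<in> W - ?F" for w
      using that by fastforce
    have "sum u ?F = 1"
      using u(2) sum.mono_neutral_left[OF assms(1), of ?F u] zero by auto
    moreover have "(\<Sum>w\<in>?F. u w *\<^sub>R w) = x"
      using u(3) sum.mono_neutral_left[OF assms(1), of ?F "\<lambda>w. u w *\<^sub>R w"] zero by auto
    ultimately show "x \<in> convex hull ?F"
      using u(1) assms(1) by (subst convex_hull_finite) auto
  qed
qed

section \<open>Edges of the hull of a symmetric set on a sphere\<close>

definition exposed_pairs :: "'v set \<Rightarrow> 'v vect set \<Rightarrow> 'v vect set set" where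
  "exposed_pairs V W = {e. e \<subseteq> W \<and> card e = 2 \<and>
     (\<exists>a\<in>vect_space V. (\<forall>u\<in>e. vect_inner V a u = 1) \<and> (\<forall>u\<in>W - e. vect_inner V a u < 1))}"

text \<open>Two properties of the arc vectors carry the description of edges. Symmetry puts every
  nonempty proper face at a positive level, which can be normalised to 1; a common length excludes
  three collinear generators, so that an edge contains exactly two.\<close>

locale symmetric_spherical =
  fixes V :: "'v set" and W :: "'v vect set" and r :: real
  assumes fin_V: "finite V" and fin_W: "finite W" and W_space: "W \<subseteq> vect_space V"
    and sym: "w \<in> W \<Longrightarrow> - w \<in> W" and sphere: "w \<in> W \<Longrightarrow> vect_inner V w w = r"
begin

text \<open>A line meets a sphere in at most two points.\<close>

lemma collinear_sphere:
  assumes "v \<in> W" "w \<in> W" "u \<in> W" "v \<noteq> w" "u - v = t *\<^sub>R (w - v)"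
  shows "u = v \<or> u = w"
proof -
  let ?i = "vect_inner V"
  have expand: "?i (x + y) (x + y) = ?i x x + 2 * ?i x y + ?i y y" for x y
    by (metis (no_types, opaque_lifting) vect_inner_add vect_inner_commute add.assoc mult_2)
  have w: "w = v + (w - v)" by simp
  have u: "u = v + t *\<^sub>R (w - v)" using assms(5) by (metis add_diff_cancel_left' diff_add_cancel add.commute)
  have "r = r + 2 * ?i v (w - v) + ?i (w - v) (w - v)"
    using expand[of v "w - v"] sphere assms by simp
  moreover have "r = r + 2 * t * ?i v (w - v) + t * t * ?i (w - v) (w - v)"
    using expand[of v "t *\<^sub>R (w - v)"] sphere assms u
    by (simp add: vect_inner_scaleR vect_inner_scaleR_left)
  \<comment> \<open>The second equation minus \<open>t\<close> times the first.\<close>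
  ultimately have "t * (t - 1) * ?i (w - v) (w - v) = 0"
    by algebra
  moreover have "0 < ?i (w - v) (w - v)"
    using assms W_space subspace_diff[OF subspace_vect_space, of w V v]
    by (intro vect_inner_self_pos fin_V) auto
  ultimately have "t = 0 \<or> t = 1" by auto
  then show ?thesis using u by auto
qed

text \<open>The pair can be read off its segment, so distinct exposed pairs span distinct
  edges.\<close>

lemma Int_hull_pair:
  assumes "e \<subseteq> W" "card e = 2"
  shows "W \<inter> convex hull e = e"
proof
  obtain v w where e: "e = {v, w}" "v \<noteq> w" using assms(2) by (auto simp: card_2_iff)
  show "W \<inter> convex hull e \<subseteq> e"
  proof
    fix u assume "u \<in> W \<inter> convex hull e"
    then obtain t where "u \<in> W" "u = v + t *\<^sub>R (w - v)"
      by (auto simp: e convex_hull_2_alt)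
    then show "u \<in> e"
      using collinear_sphere[of v w u t] assms e by auto
  qed
  show "e \<subseteq> W \<inter> convex hull e" using assms(1) hull_subset[of e convex] by auto
qed

lemma polytope_edges_eq: "polytope_edges V (convex hull W) = (hull) convex ` exposed_pairs V W"
proof (intro equalityI subsetI)
  fix F assume "F \<in> polytope_edges V (convex hull W)"
  then obtain a b where a: "a \<in> vect_space V"
    and F: "F = convex hull W \<inter> {x \<in> vect_space V. vect_inner V a x = b}"
    and le: "\<And>x. x \<in> convex hull W \<Longrightarrow> vect_inner V a x \<le> b"
    and ne: "F \<noteq> convex hull W" and dim: "dim {x - y | x y. x \<in> F \<and> y \<in> F} = 1"
    unfolding polytope_edges_def polytope_face_def supporting_hyperplane_def by blast
  define e where "e = {w \<in> W. vect_inner V a w = b}"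
  have le': "vect_inner V a w \<le> b" if "w \<in> W" for w
    using le that hull_inc by metis
  have F_eq: "F = convex hull e"
    unfolding F e_def by (rule hull_Int_supporting_hyperplane) (use fin_W W_space le' in auto)
  \<comment> \<open>Dimension 1 means that all differences of points of \<open>F\<close> are
    multiples of one nonzero vector \<open>c\<close>, which is itself such a difference.\<close>
  obtain B where B: "B \<subseteq> {x - y | x y. x \<in> F \<and> y \<in> F}" "independent B"
    "{x - y | x y. x \<in> F \<and> y \<in> F} \<subseteq> span B" "card B = 1"
    using basis_exists[of "{x - y | x y. x \<in> F \<and> y \<in> F}"] unfolding dim by blast
  then obtain c where c: "B = {c}" by (auto simp: card_1_singleton_iff)
  then have "c \<noteq> 0" using B(2) by (auto simp: dependent_zero)
  \<comment> \<open>With fewer than two generators in the face there would be no nonzero difference,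
    but \<open>c\<close> is one.\<close>
  have "\<exists>v w. v \<in> e \<and> w \<in> e \<and> v \<noteq> w"
  proof (rule ccontr)
    assume "\<not> ?thesis"
    then have "e = {} \<or> (\<exists>v. e = {v})" by blast
    then have "F = {} \<or> (\<exists>v. F = {v})" unfolding F_eq by auto
    then show False using B(1) c \<open>c \<noteq> 0\<close> by auto
  qed
  then obtain v w where vw: "v \<in> e" "w \<in> e" "v \<noteq> w" by blast
  have span: "\<exists>t. x - v = t *\<^sub>R c" if "x \<in> e" for x
  proof -
    have "x - v \<in> span {c}"
      using B(3) c that vw(1) hull_subset[of e convex] unfolding F_eq by auto
    then show ?thesis by (auto simp: span_singleton)
  qed
  obtain s where s: "w - v = s *\<^sub>R c" using span vw by blast
  then have "s \<noteq> 0" using vw by auto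
  have "u \<in> {v, w}" if u: "u \<in> e" for u
  proof -
    obtain t where "u - v = t *\<^sub>R c" using span[OF u] by blast
    then have "u - v = (t / s) *\<^sub>R (w - v)" using s \<open>s \<noteq> 0\<close> by simp
    then show ?thesis using collinear_sphere[of v w u] vw u by (auto simp: e_def)
  qed
  then have e: "e = {v, w}" using vw by blast
  obtain w0 where w0: "w0 \<in> W" "vect_inner V a w0 < b"
  proof -
    have "e \<noteq> W" using ne F_eq by auto
    then obtain w0 where "w0 \<in> W" "vect_inner V a w0 \<noteq> b" unfolding e_def by auto
    then show thesis using that le'[of w0] by force
  qed
  \<comment> \<open>\<open>v\<close> and \<open>- v\<close> have the values \<open>b\<close> and
    \<open>- b\<close>, so \<open>b\<close> is not negative. If \<open>b = 0\<close>, the mirror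
    image of \<open>w0\<close> would lie beyond the hyperplane.\<close>
  have "0 < b"
  proof -
    have "- b \<le> b" using le'[of "- v"] sym vw(1) by (auto simp: e_def vect_inner_uminus)
    moreover have "b \<noteq> 0" using w0 le'[of "- w0"] sym by (auto simp: vect_inner_uminus)
    ultimately show ?thesis by simp
  qed
  have "e \<in> exposed_pairs V W"
    unfolding exposed_pairs_def
  proof (intro CollectI conjI bexI[of _ "(1 / b) *\<^sub>R a"])
    show "(1 / b) *\<^sub>R a \<in> vect_space V" using a by (rule subspace_mul[OF subspace_vect_space])
    show "card e = 2" using e vw by simp
    show "\<forall>u\<in>W - e. vect_inner V ((1 / b) *\<^sub>R a) u < 1"
      using le' \<open>0 < b\<close> by (force simp: e_def vect_inner_scaleR_left)
  qed (use \<open>0 < b\<close> in \<open>auto simp: e_def vect_inner_scaleR_left\<close>)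
  then show "F \<in> (hull) convex ` exposed_pairs V W" using F_eq by blast
next
  fix F assume "F \<in> (hull) convex ` exposed_pairs V W"
  then obtain e a where F: "F = convex hull e" and e: "e \<subseteq> W" "card e = 2" and a: "a \<in> vect_space V"
    and one: "\<And>u. u \<in> e \<Longrightarrow> vect_inner V a u = 1" and less: "\<And>u. u \<in> W - e \<Longrightarrow> vect_inner V a u < 1"
    unfolding exposed_pairs_def by blast
  obtain v w where vw: "e = {v, w}" "v \<noteq> w" using e(2) by (auto simp: card_2_iff)
  let ?H = "{x \<in> vect_space V. vect_inner V a x = 1}"
  have le: "vect_inner V a u \<le> 1" if "u \<in> W" for u
    using one less that by (cases "u \<in> e") (auto intro: less_imp_le)
  have "e = {w \<in> W. vect_inner V a w = 1}" using e one less by fastforce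
  then have F_eq: "F = convex hull W \<inter> ?H"
    unfolding F using hull_Int_supporting_hyperplane[OF fin_W W_space le] by simp
  have "v \<in> F" "w \<in> F" unfolding F vw by (auto intro: hull_inc)
  have "supporting_hyperplane V ?H (convex hull W)"
    unfolding supporting_hyperplane_def
  proof (intro exI[of _ a] exI[of _ 1] conjI ballI)
    show "a \<noteq> 0" using one[of v] vw by (auto simp: vect_inner_def)
    show "vect_inner V a x \<le> 1" if "x \<in> convex hull W" for x
      using hull_minimal[of W "{x. vect_inner V a x \<le> 1}" convex] le convex_halfspace_vect_inner that
      by blast
    show "convex hull W \<inter> ?H \<noteq> {}" using \<open>v \<in> F\<close> F_eq by blast
  qed (use a in auto)
  moreover have "F \<noteq> convex hull W"
  proof -
    \<comment> \<open>The face has level 1 and \<open>- v\<close> has value -1, so the face is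
      proper.\<close>
    have "- v \<in> convex hull W" using sym e vw by (auto intro: hull_inc)
    moreover have "- v \<notin> F" using one[of v] vw by (auto simp: F_eq vect_inner_uminus)
    ultimately show ?thesis by blast
  qed
  moreover have "dim {x - y | x y. x \<in> F \<and> y \<in> F} = 1"
  proof (rule dim_unique[of "{w - v}"])
    show "{w - v} \<subseteq> {x - y | x y. x \<in> F \<and> y \<in> F}" using \<open>v \<in> F\<close> \<open>w \<in> F\<close> by blast
    show "{x - y | x y. x \<in> F \<and> y \<in> F} \<subseteq> span {w - v}"
    proof safe
      fix x y assume "x \<in> F" "y \<in> F"
      then obtain s t where "x = v + s *\<^sub>R (w - v)" "y = v + t *\<^sub>R (w - v)"
        unfolding F vw convex_hull_2_alt by auto
      then have "x - y = (s - t) *\<^sub>R (w - v)" by (simp add: scaleR_diff_left)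
      then show "x - y \<in> span {w - v}" by (auto simp: span_singleton)
    qed
    show "independent {w - v}" using vw by (simp add: dependent_single)
  qed simp
  ultimately show "F \<in> polytope_edges V (convex hull W)"
    unfolding polytope_edges_def polytope_face_def F_eq by blast
qed

lemma card_polytope_edges: "card (polytope_edges V (convex hull W)) = card (exposed_pairs V W)"
proof -
  have "inj_on ((hull) convex) (exposed_pairs V W)"
    by (rule inj_on_inverseI[where g = "\<lambda>F. W \<inter> F"]) (auto simp: exposed_pairs_def Int_hull_pair)
  then show ?thesis unfolding polytope_edges_eq by (rule card_image)
qed

end

section \<open>The symmetric edge polytope: edges as pairs of directed arcs\<close>

definition darcs :: "'v set set \<Rightarrow> ('v \<times> 'v) set" where
  "darcs S = {(i, j). {i, j} \<in> S}"

definition arc_vect :: "'v \<times> 'v \<Rightarrow> 'v vect" where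
  "arc_vect x = unit_vect (fst x) - unit_vect (snd x)"

lemma darcs_iff [simp]: "(i, j) \<in> darcs S \<longleftrightarrow> {i, j} \<in> S"
  by (simp add: darcs_def)

lemma arcD:
  assumes "S \<subseteq> all_arcs V" "{i, j} \<in> S"
  shows "i \<in> V" "j \<in> V" "i \<noteq> j"
  using assms by (auto simp: all_arcs_def)

lemma finite_darcs:
  assumes "finite V" "S \<subseteq> all_arcs V"
  shows "finite (darcs S)"
proof (rule finite_subset)
  show "darcs S \<subseteq> V \<times> V" using arcD[OF assms(2)] by auto
qed (use assms in auto)

lemma lookup_arc_vect:
  "Poly_Mapping.lookup (arc_vect (i, j)) k = (if k = i then 1 else 0) - (if k = j then 1 else 0)"
  by (simp add: arc_vect_def lookup_minus lookup_single when_def)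

lemma inj_on_arc_vect:
  assumes "S \<subseteq> all_arcs V"
  shows "inj_on arc_vect (darcs S)"
proof (rule inj_onI, clarify)
  fix i j k l assume *: "(i, j) \<in> darcs S" "(k, l) \<in> darcs S" "arc_vect (i, j) = arc_vect (k, l)"
  have ne: "i \<noteq> j" "k \<noteq> l" using *(1,2) arcD(3)[OF assms, of i j] arcD(3)[OF assms, of k l] by auto
  have eq: "Poly_Mapping.lookup (arc_vect (i, j)) m = Poly_Mapping.lookup (arc_vect (k, l)) m" for m
    using *(3) by simp
  show "i = k \<and> j = l"
    using ne eq[of i] eq[of j] unfolding lookup_arc_vect by (simp split: if_splits)
qed

lemma symmetric_edge_polytope_eq: "symmetric_edge_polytope S = convex hull (arc_vect ` darcs S)"
proof -
  have "(\<Union>(i, j)\<in>{(i, j). {i, j} \<in> S}. {unit_vect i - unit_vect j, - (unit_vect i - unit_vect j)})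
    = arc_vect ` darcs S"
    by (force simp: darcs_def arc_vect_def image_iff insert_commute)
  then show ?thesis unfolding symmetric_edge_polytope_def by simp
qed

lemma vect_inner_arc_vect:
  assumes "finite V" "S \<subseteq> all_arcs V" "(i, j) \<in> darcs S"
  shows "vect_inner V a (arc_vect (i, j)) = Poly_Mapping.lookup a i - Poly_Mapping.lookup a j"
  using arcD[OF assms(2), of i j] assms by (simp add: arc_vect_def vect_inner_diff vect_inner_unit)

lemma symmetric_spherical_arc_vect:
  assumes "finite V" "S \<subseteq> all_arcs V"
  shows "symmetric_spherical V (arc_vect ` darcs S) 2"
proof
  show "finite (arc_vect ` darcs S)" using finite_darcs[OF assms] by simp
  show "arc_vect ` darcs S \<subseteq> vect_space V"
    using arcD[OF assms(2)] by (auto simp: vect_space_iff lookup_arc_vect)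
  fix w :: "'a vect" assume "w \<in> arc_vect ` darcs S"
  then obtain i j where ij: "w = arc_vect (i, j)" "(i, j) \<in> darcs S" by auto
  then have "- w = arc_vect (j, i)" "(j, i) \<in> darcs S"
    by (auto simp: arc_vect_def insert_commute)
  then show "- w \<in> arc_vect ` darcs S" by blast
  show "vect_inner V w w = 2"
    using ij arcD[OF assms(2), of i j]
    by (simp add: vect_inner_arc_vect[OF assms] lookup_arc_vect)
qed fact

text \<open>The height function \<open>h\<close> is the linear functional of a hyperplane \<open>h = 1\<close> supporting the polytope
  exactly in the segment between the two vertices.\<close>

definition sep_edge :: "'v set set \<Rightarrow> 'v \<times> 'v \<Rightarrow> 'v \<times> 'v \<Rightarrow> bool" where
  "sep_edge S x y \<longleftrightarrow> x \<noteq> y \<and> (\<exists>h :: 'v \<Rightarrow> real. h (fst x) - h (snd x) = 1 \<and> h (fst y) - h (snd y) = 1 \<and>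
     (\<forall>z\<in>darcs S - {x, y}. h (fst z) - h (snd z) < 1))"

lemma exposed_pairs_arc_vect:
  assumes "finite V" "S \<subseteq> all_arcs V"
  shows "exposed_pairs V (arc_vect ` darcs S)
    = {{arc_vect x, arc_vect y} | x y. x \<in> darcs S \<and> y \<in> darcs S \<and> sep_edge S x y}"
proof (intro equalityI subsetI)
  fix e assume "e \<in> exposed_pairs V (arc_vect ` darcs S)"
  then obtain a where e: "e \<subseteq> arc_vect ` darcs S" "card e = 2"
    and one: "\<And>u. u \<in> e \<Longrightarrow> vect_inner V a u = 1"
    and less: "\<And>u. u \<in> arc_vect ` darcs S - e \<Longrightarrow> vect_inner V a u < 1"
    unfolding exposed_pairs_def by blast
  obtain v w where "e = {v, w}" "v \<noteq> w" using e(2) by (auto simp: card_2_iff)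
  then obtain x y where xy: "x \<in> darcs S" "y \<in> darcs S" "e = {arc_vect x, arc_vect y}" "x \<noteq> y"
    using e(1) by auto
  have h: "vect_inner V a (arc_vect z) = Poly_Mapping.lookup a (fst z) - Poly_Mapping.lookup a (snd z)"
    if "z \<in> darcs S" for z
    using vect_inner_arc_vect[OF assms, of "fst z" "snd z" a] that by simp
  have "sep_edge S x y"
    unfolding sep_edge_def
  proof (intro conjI exI[of _ "Poly_Mapping.lookup a"] ballI)
    fix z assume z: "z \<in> darcs S - {x, y}"
    then have "arc_vect z \<notin> e"
      using inj_on_arc_vect[OF assms(2)] xy by (auto dest: inj_onD)
    then show "Poly_Mapping.lookup a (fst z) - Poly_Mapping.lookup a (snd z) < 1"
      using less[of "arc_vect z"] h[of z] z by auto
  qed (use xy one h in \<open>auto simp flip: h\<close>)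
  then show "e \<in> {{arc_vect x, arc_vect y} | x y. x \<in> darcs S \<and> y \<in> darcs S \<and> sep_edge S x y}"
    using xy by blast
next
  fix e assume "e \<in> {{arc_vect x, arc_vect y} | x y. x \<in> darcs S \<and> y \<in> darcs S \<and> sep_edge S x y}"
  then obtain x y h where e: "e = {arc_vect x, arc_vect y}" and xy: "x \<in> darcs S" "y \<in> darcs S" "x \<noteq> y"
    and h: "h (fst x) - h (snd x) = 1" "h (fst y) - h (snd y) = (1 :: real)"
    "\<And>z. z \<in> darcs S - {x, y} \<Longrightarrow> h (fst z) - h (snd z) < 1"
    unfolding sep_edge_def by blast
  \<comment> \<open>A vector has finite support, so the heights are cut off outside
    \<open>V\<close>. Both ends of every arc lie in \<open>V\<close>, hence no drop along an arc
    changes.\<close>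
  define a :: "'a vect" where "a = (\<Sum>i\<in>V. Poly_Mapping.single i (h i))"
  have lookup_a: "Poly_Mapping.lookup a i = (if i \<in> V then h i else 0)" for i
    unfolding a_def using assms(1) by (simp add: lookup_sum lookup_single when_def)
  have inner: "vect_inner V a (arc_vect z) = h (fst z) - h (snd z)" if "z \<in> darcs S" for z
    using vect_inner_arc_vect[OF assms, of "fst z" "snd z" a] that arcD[OF assms(2), of "fst z" "snd z"]
    by (auto simp: lookup_a darcs_def)
  show "e \<in> exposed_pairs V (arc_vect ` darcs S)"
    unfolding exposed_pairs_def
  proof (intro CollectI conjI bexI[of _ a])
    have "arc_vect x \<noteq> arc_vect y" using xy inj_on_arc_vect[OF assms(2)] by (auto dest: inj_onD)
    then show "card e = 2" unfolding e by simp
    show "a \<in> vect_space V" by (simp add: vect_space_iff lookup_a)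
    show "\<forall>u\<in>arc_vect ` darcs S - e. vect_inner V a u < 1"
    proof
      fix u assume u: "u \<in> arc_vect ` darcs S - e"
      then obtain z where "u = arc_vect z" "z \<in> darcs S" by blast
      moreover from this have "z \<notin> {x, y}" using u e by auto
      ultimately show "vect_inner V a u < 1" using h(3)[of z] inner[of z] by simp
    qed
  qed (use e xy h inner in auto)
qed

lemma card_symmetric_pairs:
  assumes "finite A" "R \<subseteq> A \<times> A" "sym R" "irrefl R"
  shows "card R = 2 * card {{x, y} | x y. (x, y) \<in> R}"
proof -
  let ?E = "{{x, y} | x y. (x, y) \<in> R}"
  have "finite R" using assms finite_subset by blast
  have E: "?E = (\<lambda>(x, y). {x, y}) ` R" by auto
  then have "finite ?E" using \<open>finite R\<close> by simp
  have "card R = (\<Sum>e\<in>?E. card {z \<in> R. (\<lambda>(x, y). {x, y}) z = e})"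
    unfolding E card_eq_sum using \<open>finite R\<close> by (rule sum.image_gen)
  also have "\<dots> = (\<Sum>e\<in>?E. 2)"
  proof (rule sum.cong[OF refl])
    fix e assume "e \<in> ?E"
    then obtain x y where xy: "e = {x, y}" "(x, y) \<in> R" by auto
    then have "(y, x) \<in> R" "x \<noteq> y" using assms(3,4) by (auto simp: sym_def irrefl_def)
    then have "{z \<in> R. (\<lambda>(x, y). {x, y}) z = e} = {(x, y), (y, x)}"
      using xy by (auto simp: doubleton_eq_iff)
    then show "card {z \<in> R. (\<lambda>(x, y). {x, y}) z = e} = 2" using \<open>x \<noteq> y\<close> by simp
  qed
  finally show ?thesis by simp
qed

lemma Collect_pair_eq_image: "{f x y | x y. Q x y} = (\<lambda>z. f (fst z) (snd z)) ` {(x, y). Q x y}"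
  by force

lemma sep_edge_commute: "sep_edge S x y = sep_edge S y x"
  unfolding sep_edge_def by (auto simp: insert_commute[of x y])

lemma card_polytope_edges_eq_sep:
  assumes "finite V" "S \<subseteq> all_arcs V"
  shows "2 * card (polytope_edges V (symmetric_edge_polytope S))
    = card {(x, y). x \<in> darcs S \<and> y \<in> darcs S \<and> sep_edge S x y}"
proof -
  interpret symmetric_spherical V "arc_vect ` darcs S" 2
    by (rule symmetric_spherical_arc_vect[OF assms])
  let ?R = "{(x, y). x \<in> darcs S \<and> y \<in> darcs S \<and> sep_edge S x y}"
  let ?E = "{{x, y} | x y. (x, y) \<in> ?R}"
  have "card ?R = 2 * card ?E"
  proof (rule card_symmetric_pairs)
    show "finite (darcs S)" by (rule finite_darcs[OF assms])
    show "sym ?R" unfolding sym_def by (auto intro: iffD1[OF sep_edge_commute])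
    show "irrefl ?R" by (auto simp: irrefl_def sep_edge_def)
  qed auto
  moreover have "exposed_pairs V (arc_vect ` darcs S) = (`) arc_vect ` ?E"
  proof -
    have "exposed_pairs V (arc_vect ` darcs S) = (\<lambda>z. {arc_vect (fst z), arc_vect (snd z)}) ` ?R"
      unfolding exposed_pairs_arc_vect[OF assms] by (rule Collect_pair_eq_image)
    moreover have "?E = (\<lambda>z. {fst z, snd z}) ` ?R"
      using Collect_pair_eq_image[of "\<lambda>x y. {x, y}" "\<lambda>x y. (x, y) \<in> ?R"] by simp
    ultimately show ?thesis by (simp add: image_image)
  qed
  moreover have "inj_on ((`) arc_vect) ?E"
    by (rule inj_on_subset[OF inj_on_image_Pow[OF inj_on_arc_vect[OF assms(2)]]]) auto
  ultimately show ?thesis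
    unfolding symmetric_edge_polytope_eq card_polytope_edges by (simp add: card_image)
qed

section \<open>Which pairs of directed arcs span an edge\<close>

definition shortcut :: "'v set set \<Rightarrow> 'v \<Rightarrow> 'v \<Rightarrow> 'v \<Rightarrow> bool" where
  "shortcut S i j l \<longleftrightarrow> {i, l} \<in> S \<or> (\<exists>m. m \<noteq> j \<and> {i, m} \<in> S \<and> {m, l} \<in> S)"

definition shortcut_paths :: "'v set set \<Rightarrow> ('v \<times> 'v \<times> 'v) set" where
  "shortcut_paths S = {(i, j, l). i \<noteq> l \<and> {i, j} \<in> S \<and> {j, l} \<in> S \<and> shortcut S i j l}"

text \<open>Labelled cycles correspond one to one to the obstructed ordered pairs
  \<open>(i, j)\<close>, \<open>(k, l)\<close> of disjoint directed arcs; an unlabelled cycle is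
  counted 8 times.\<close>

definition four_cycles :: "'v set set \<Rightarrow> ('v \<times> 'v \<times> 'v \<times> 'v) set" where
  "four_cycles S = {(i, j, k, l). distinct [i, j, k, l] \<and>
     {i, j} \<in> S \<and> {j, k} \<in> S \<and> {k, l} \<in> S \<and> {l, i} \<in> S}"

lemma sep_edgeI:
  fixes h :: "'v \<Rightarrow> real"
  assumes "(i, j) \<noteq> (k, l)" "h i - h j = 1" "h k - h l = 1"
    "\<And>u v. {u, v} \<in> S \<Longrightarrow> (u, v) \<noteq> (i, j) \<Longrightarrow> (u, v) \<noteq> (k, l) \<Longrightarrow> h u - h v < 1"
  shows "sep_edge S (i, j) (k, l)"
  unfolding sep_edge_def
proof (intro conjI exI[of _ h] ballI)
  fix z assume "z \<in> darcs S - {(i, j), (k, l)}"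
  then show "h (fst z) - h (snd z) < 1" using assms(4)[of "fst z" "snd z"] by (auto simp: darcs_def)
qed (use assms in auto)

lemma sep_edgeD:
  assumes "sep_edge S (i, j) (k, l)"
  shows "\<exists>h :: 'v \<Rightarrow> real. (i, j) \<noteq> (k, l) \<and> h i - h j = 1 \<and> h k - h l = 1 \<and>
    (\<forall>u v. {u, v} \<in> S \<longrightarrow> (u, v) \<noteq> (i, j) \<longrightarrow> (u, v) \<noteq> (k, l) \<longrightarrow> h u - h v < 1)"
proof -
  obtain h :: "'v \<Rightarrow> real" where h: "(i, j) \<noteq> (k, l)" "h i - h j = 1" "h k - h l = 1"
    "\<And>z. z \<in> darcs S - {(i, j), (k, l)} \<Longrightarrow> h (fst z) - h (snd z) < 1"
    using assms unfolding sep_edge_def by auto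
  have "h u - h v < 1" if "{u, v} \<in> S" "(u, v) \<noteq> (i, j)" "(u, v) \<noteq> (k, l)" for u v
    using h(4)[of "(u, v)"] that by simp
  with h(1-3) show ?thesis by blast
qed

text \<open>With all heights between -1/2 and 1/2, a drop of 1 leads from height 1/2, taken at
  \<open>i\<close> alone, to height -1/2, taken at \<open>j\<close> and \<open>l\<close>.\<close>

lemma sep_edge_common_source:
  assumes "i \<noteq> j" "i \<noteq> l" "j \<noteq> l"
  shows "sep_edge S (i, j) (i, l)"
  by (rule sep_edgeI[where h = "\<lambda>v. if v = i then 1 / 2 else if v = j \<or> v = l then - 1 / 2 else 0"])
    (use assms in \<open>auto split: if_splits\<close>)

lemma sep_edge_common_sink:
  assumes "i \<noteq> j" "k \<noteq> j" "i \<noteq> k"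
  shows "sep_edge S (i, j) (k, j)"
  by (rule sep_edgeI[where h = "\<lambda>v. if v = j then - 1 / 2 else if v = i \<or> v = k then 1 / 2 else 0"])
    (use assms in \<open>auto split: if_splits\<close>)

text \<open>The drops from \<open>i\<close> to \<open>j\<close> and from \<open>k\<close> to
  \<open>l\<close> have the same sum, 2, as those from \<open>k\<close> to \<open>j\<close> and from
  \<open>i\<close> to \<open>l\<close>. The latter two cannot both be below 1; but if one of these
  connections is missing, its drop may be large and relieve the other.\<close>

lemma sep_edge_disjoint:
  assumes "distinct [i, j, k, l]"
  shows "sep_edge S (i, j) (k, l) \<longleftrightarrow> \<not> ({j, k} \<in> S \<and> {l, i} \<in> S)"
proof
  assume "sep_edge S (i, j) (k, l)"
  then obtain h :: "_ \<Rightarrow> real" where h: "h i - h j = 1" "h k - h l = 1"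
    "\<And>u v. {u, v} \<in> S \<Longrightarrow> (u, v) \<noteq> (i, j) \<Longrightarrow> (u, v) \<noteq> (k, l) \<Longrightarrow> h u - h v < 1"
    by (blast dest: sep_edgeD)
  show "\<not> ({j, k} \<in> S \<and> {l, i} \<in> S)"
    using h(1,2) h(3)[of k j] h(3)[of i l] assms by (auto simp: insert_commute)
next
  \<comment> \<open>From the heights 1/2, -1/2, 1/2, -1/2 the nodes \<open>i\<close>,
    \<open>j\<close> are raised and \<open>k\<close>, \<open>l\<close> lowered by 1/8. The drop from
    \<open>k\<close> to \<open>j\<close> becomes 3/4, and that from \<open>i\<close> to
    \<open>l\<close> becomes 5/4 on a non-arc.\<close>
  have sep: "sep_edge S (i, j) (k, l)" if "distinct [i, j, k, l]" "{l, i} \<notin> S" for i j k l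
  proof (rule sep_edgeI[where h = "\<lambda>v. if v = i then 5 / 8 else if v = j then - 3 / 8
      else if v = k then 3 / 8 else if v = l then - 5 / 8 else 0"])
    fix u v assume uv: "{u, v} \<in> S" "(u, v) \<noteq> (i, j)" "(u, v) \<noteq> (k, l)"
    then have "(u, v) \<noteq> (i, l)" using that by (auto simp: insert_commute)
    with uv show "(if u = i then 5 / 8 else if u = j then - 3 / 8
      else if u = k then 3 / 8 else if u = l then - 5 / 8 else 0) - (if v = i then 5 / 8 else if v = j then - 3 / 8
      else if v = k then 3 / 8 else if v = l then - 5 / 8 else 0) < (1 :: real)"
      using that(1) by (auto split: if_splits)
  qed (use that in auto)
  assume "\<not> ({j, k} \<in> S \<and> {l, i} \<in> S)"
  then show "sep_edge S (i, j) (k, l)"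
  proof (cases "{l, i} \<in> S")
    case True
    then have "{j, k} \<notin> S" using \<open>\<not> _\<close> by blast
    then have "sep_edge S (k, l) (i, j)" using assms by (intro sep) auto
    then show ?thesis by (simp add: sep_edge_commute)
  qed (use sep assms in auto)
qed

text \<open>The heights of \<open>i\<close> and \<open>l\<close> differ by 2, so a route of at most
  two arcs that avoids \<open>j\<close> has an arc with drop at least 1. Conversely, suitable
  heights exist if there is no such route.\<close>

lemma sep_edge_path:
  assumes "i \<noteq> j" "j \<noteq> l" "i \<noteq> l"
  shows "sep_edge S (i, j) (j, l) \<longleftrightarrow> \<not> shortcut S i j l"
proof
  assume "sep_edge S (i, j) (j, l)"
  then obtain h :: "_ \<Rightarrow> real" where h: "h i - h j = 1" "h j - h l = 1"
    "\<And>u v. {u, v} \<in> S \<Longrightarrow> (u, v) \<noteq> (i, j) \<Longrightarrow> (u, v) \<noteq> (j, l) \<Longrightarrow> h u - h v < 1"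
    by (blast dest: sep_edgeD)
  have "{i, l} \<notin> S" using h(1,2) h(3)[of i l] assms by auto
  moreover have "\<not> ({i, m} \<in> S \<and> {m, l} \<in> S)" if "m \<noteq> j" for m
    using h(1,2) h(3)[of i m] h(3)[of m l] assms that by auto
  ultimately show "\<not> shortcut S i j l" unfolding shortcut_def by blast
next
  assume no: "\<not> shortcut S i j l"
  \<comment> \<open>Neighbours of \<open>i\<close> need positive and neighbours of \<open>l\<close>
    negative height; without a shortcut no node except \<open>j\<close> is both. The value 1/3 keeps
    the drop along every other directed arc at most 2/3.\<close>
  define h :: "_ \<Rightarrow> real" where "h v = (if v = i then 1 else if v = j then 0 else if v = l then - 1
    else if {i, v} \<in> S then 1 / 3 else if {v, l} \<in> S then - 1 / 3 else 0)" for v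
  have vals: "h i = 1" "h j = 0" "h l = - 1" using assms by (auto simp: h_def)
  have range: "\<bar>h v\<bar> \<le> 1 / 3" if "v \<noteq> i" "v \<noteq> l" for v
    using that by (auto simp: h_def)
  have near_i: "h v = 1 / 3" if "{i, v} \<in> S" "v \<noteq> i" "v \<noteq> j" "v \<noteq> l" for v
    using that by (auto simp: h_def)
  have near_l: "h v = - 1 / 3" if "{v, l} \<in> S" "v \<noteq> i" "v \<noteq> j" "v \<noteq> l" for v
    using that no by (auto simp: h_def shortcut_def)
  show "sep_edge S (i, j) (j, l)"
  proof (rule sep_edgeI[where h = h])
    fix u v assume uv: "{u, v} \<in> S" "(u, v) \<noteq> (i, j)" "(u, v) \<noteq> (j, l)"
    have il: "{i, l} \<notin> S" using no by (auto simp: shortcut_def)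
    consider "u = i" | "v = l" "u \<noteq> i" | "u = l" "v \<noteq> l" | "v = i" "u \<noteq> i" "u \<noteq> l"
      | "u \<notin> {i, l}" "v \<notin> {i, l}" by blast
    then show "h u - h v < 1"
    proof cases
      case 1
      then show ?thesis using uv il near_i[of v] vals by (cases "v = i"; cases "v = l") auto
    next
      case 2
      then show ?thesis using uv near_l[of u] vals by (cases "u = l") auto
    next
      case 3
      then show ?thesis using vals range[of v] by (cases "v = i") auto
    next
      case 4
      then show ?thesis using vals range[of u] by auto
    next
      case 5
      then show ?thesis using range[of u] range[of v] by auto
    qed
  qed (use assms vals in auto)
qed

section \<open>Counting the edges\<close>

lemma card_sep_edge:
  assumes V: "finite V" and S: "S \<subseteq> all_arcs V"
  shows "real (card {(x, y). x \<in> darcs S \<and> y \<in> darcs S \<and> sep_edge S x y})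
    = (real (card (darcs S)))\<^sup>2 - 2 * real (card (darcs S)) - real (card (four_cycles S))
      - 2 * real (card (shortcut_paths S))"
proof -
  let ?D = "darcs S" and ?Q = "four_cycles S" and ?Z = "shortcut_paths S"
  let ?E = "{(x, y). x \<in> ?D \<and> y \<in> ?D \<and> sep_edge S x y}"
  let ?N1 = "(\<lambda>(i, j). ((i, j), (i, j))) ` ?D"
  let ?N2 = "(\<lambda>(i, j). ((i, j), (j, i))) ` ?D"
  let ?N3 = "(\<lambda>(i, j, k, l). ((i, j), (k, l))) ` ?Q"
  let ?N4 = "(\<lambda>(i, j, l). ((i, j), (j, l))) ` ?Z"
  let ?N5 = "(\<lambda>(i, j, l). ((j, l), (i, j))) ` ?Z"
  have finD: "finite ?D" by (rule finite_darcs[OF V S])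
  have finQ: "finite ?Q"
    by (rule finite_subset[of _ "V \<times> V \<times> V \<times> V"]) (use arcD[OF S] V in \<open>auto simp: four_cycles_def\<close>)
  have finZ: "finite ?Z"
    by (rule finite_subset[of _ "V \<times> V \<times> V"]) (use arcD[OF S] V in \<open>auto simp: shortcut_paths_def\<close>)
  have ne: "i \<noteq> j" if "{i, j} \<in> S" for i j using arcD(3)[OF S that] .
  have irr: "\<not> sep_edge S x x" for x by (simp add: sep_edge_def)
  have opp: "\<not> sep_edge S (i, j) (j, i)" for i j
    by (auto dest!: sep_edgeD)
  \<comment> \<open>The second arc can equal the first, be its opposite, share its source or sink,
    continue it, precede it, or be disjoint from it. A common source or sink alone always yields an
    edge, which leaves five families of excluded pairs.\<close>
  have split: "?D \<times> ?D = ?E \<union> (?N1 \<union> ?N2 \<union> ?N3 \<union> ?N4 \<union> ?N5)"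
  proof (intro equalityI subsetI)
    fix z assume "z \<in> ?D \<times> ?D"
    then obtain i j k l where z: "z = ((i, j), (k, l))" "{i, j} \<in> S" "{k, l} \<in> S" by auto
    then have "i \<noteq> j" "k \<noteq> l" using ne by auto
    show "z \<in> ?E \<union> (?N1 \<union> ?N2 \<union> ?N3 \<union> ?N4 \<union> ?N5)"
    proof (cases "sep_edge S (i, j) (k, l)")
      case False
      consider "(k, l) = (i, j)" | "(k, l) = (j, i)" | "k = i" "l \<noteq> j" | "l = j" "k \<noteq> i"
        | "k = j" "l \<noteq> i" | "l = i" "k \<noteq> j" | "distinct [i, j, k, l]"
        using \<open>i \<noteq> j\<close> \<open>k \<noteq> l\<close> by fastforce
      then show ?thesis
      proof cases
        case 1
        then show ?thesis using z by auto
      next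
        case 2
        then show ?thesis using z by auto
      next
        case 3
        then show ?thesis using False sep_edge_common_source[of i j l S] \<open>i \<noteq> j\<close> \<open>k \<noteq> l\<close> by auto
      next
        case 4
        then show ?thesis using False sep_edge_common_sink[of i j k S] \<open>i \<noteq> j\<close> \<open>k \<noteq> l\<close> by auto
      next
        case 5
        then have "(i, j, l) \<in> ?Z"
          using False sep_edge_path[of i j l S] z \<open>i \<noteq> j\<close> \<open>k \<noteq> l\<close> by (auto simp: shortcut_paths_def)
        then have "z \<in> ?N4" using 5 z by (auto simp: image_iff intro!: bexI[of _ "(i, j, l)"])
        then show ?thesis by blast
      next
        case 6
        then have "(k, l, j) \<in> ?Z"
          using False sep_edge_path[of k l j S] z \<open>i \<noteq> j\<close> \<open>k \<noteq> l\<close>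
          by (auto simp: shortcut_paths_def sep_edge_commute)
        then have "z \<in> ?N5" using 6 z by (auto simp: image_iff intro!: bexI[of _ "(k, l, j)"])
        then show ?thesis by blast
      next
        case 7
        then have "(i, j, k, l) \<in> ?Q"
          using False sep_edge_disjoint[of i j k l S] z by (auto simp: four_cycles_def)
        then have "z \<in> ?N3" using z by (auto simp: image_iff intro!: bexI[of _ "(i, j, k, l)"])
        then show ?thesis by blast
      qed
    qed (use z in auto)
  next
    fix z assume "z \<in> ?E \<union> (?N1 \<union> ?N2 \<union> ?N3 \<union> ?N4 \<union> ?N5)"
    then show "z \<in> ?D \<times> ?D"
      by (auto simp: four_cycles_def shortcut_paths_def insert_commute)
  qed
  have disj_E: "?E \<inter> (?N1 \<union> ?N2 \<union> ?N3 \<union> ?N4 \<union> ?N5) = {}"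
  proof -
    have Q: "\<not> sep_edge S (i, j) (k, l)" if "(i, j, k, l) \<in> ?Q" for i j k l
      using that sep_edge_disjoint[of i j k l S] by (simp add: four_cycles_def)
    have Z: "\<not> sep_edge S (i, j) (j, l)" "\<not> sep_edge S (j, l) (i, j)" if "(i, j, l) \<in> ?Z" for i j l
    proof -
      show "\<not> sep_edge S (i, j) (j, l)"
        using that sep_edge_path[of i j l S] ne[of i j] ne[of j l] by (simp add: shortcut_paths_def)
      then show "\<not> sep_edge S (j, l) (i, j)" by (simp add: sep_edge_commute)
    qed
    have "?E \<inter> ?N1 = {}" "?E \<inter> ?N2 = {}" using irr opp by auto
    moreover have "?E \<inter> ?N3 = {}" using Q by auto
    moreover have "?E \<inter> ?N4 = {}" using Z(1) by auto
    moreover have "?E \<inter> ?N5 = {}" using Z(2) by auto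
    ultimately show ?thesis by (simp only: Int_Un_distrib Un_empty simp_thms)
  qed
  have sing: "{i} \<notin> S" for i using ne[of i i] by auto
  have disj: "?N1 \<inter> ?N2 = {}" "(?N1 \<union> ?N2) \<inter> ?N3 = {}" "(?N1 \<union> ?N2 \<union> ?N3) \<inter> ?N4 = {}"
    "(?N1 \<union> ?N2 \<union> ?N3 \<union> ?N4) \<inter> ?N5 = {}"
    using sing by (auto simp: four_cycles_def shortcut_paths_def)
  have "card (?N1 \<union> ?N2 \<union> ?N3 \<union> ?N4 \<union> ?N5) = card ?N1 + card ?N2 + card ?N3 + card ?N4 + card ?N5"
    using finD finQ finZ disj by (simp add: card_Un_disjoint)
  also have "card ?N1 = card ?D" by (rule card_image) (auto simp: inj_on_def)
  also have "card ?N2 = card ?D" by (rule card_image) (auto simp: inj_on_def)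
  also have "card ?N3 = card ?Q" by (rule card_image) (auto simp: inj_on_def)
  also have "card ?N4 = card ?Z" by (rule card_image) (auto simp: inj_on_def)
  also have "card ?N5 = card ?Z" by (rule card_image) (auto simp: inj_on_def)
  finally have N: "card (?N1 \<union> ?N2 \<union> ?N3 \<union> ?N4 \<union> ?N5) = 2 * card ?D + card ?Q + 2 * card ?Z" by simp
  have "finite ?E" by (rule finite_subset[of _ "?D \<times> ?D"]) (use finD in auto)
  moreover have "finite (?N1 \<union> ?N2 \<union> ?N3 \<union> ?N4 \<union> ?N5)" using finD finQ finZ by simp
  ultimately have "card (?D \<times> ?D) = card ?E + (2 * card ?D + card ?Q + 2 * card ?Z)"
    unfolding split using disj_E N by (subst card_Un_disjoint) auto
  then have "real (card ?D * card ?D) = real (card ?E + (2 * card ?D + card ?Q + 2 * card ?Z))"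
    by (simp only: card_cartesian_product)
  then show ?thesis by (simp add: power2_eq_square)
qed

lemma card_darcs:
  assumes "finite V" "S \<subseteq> all_arcs V"
  shows "card (darcs S) = 2 * card S"
proof -
  have "card (darcs S) = 2 * card {{x, y} | x y. (x, y) \<in> darcs S}"
  proof (rule card_symmetric_pairs[OF assms(1)])
    show "darcs S \<subseteq> V \<times> V" using arcD[OF assms(2)] by auto
    show "sym (darcs S)" by (auto simp: sym_def insert_commute)
    show "irrefl (darcs S)" using arcD(3)[OF assms(2), of i i for i] by (auto simp: irrefl_def)
  qed
  also have "{{x, y} | x y. (x, y) \<in> darcs S} = S"
    using assms(2) by (auto simp: all_arcs_def card_2_iff) blast
  finally show ?thesis .
qed

text \<open>Written as a combination with scalar factors, the form to which
  \<open>cube_var_cmult\<close> and \<open>cube_var_add_le\<close> apply.\<close>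

lemma num_edges_eq:
  assumes "S \<subseteq> all_arcs {1..n}"
  shows "num_edges n S = 1 / 2 * (4 * (real (card S))\<^sup>2 - 4 * real (card S) - real (card (four_cycles S)))
    + (- 1) * real (card (shortcut_paths S))"
proof -
  have "2 * num_edges n S = real (2 * card (polytope_edges {1..n} (symmetric_edge_polytope S)))"
    by (simp add: num_edges_def)
  also have "\<dots> = 4 * (real (card S))\<^sup>2 - 4 * real (card S) - real (card (four_cycles S))
      - 2 * real (card (shortcut_paths S))"
    unfolding card_polytope_edges_eq_sep[OF finite_atLeastAtMost assms]
      card_sep_edge[OF finite_atLeastAtMost assms] card_darcs[OF finite_atLeastAtMost assms]
    by (simp add: power_mult_distrib)
  finally show ?thesis by (simp add: field_simps)
qed


section \<open>Derivatives of the edge count\<close>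

fun cycle_arcs :: "'v \<times> 'v \<times> 'v \<times> 'v \<Rightarrow> 'v set set" where
  "cycle_arcs (i, j, k, l) = {{i, j}, {j, k}, {k, l}, {l, i}}"

lemma cycle_arcs_rotate: "cycle_arcs (j, k, l, i) = cycle_arcs (i, j, k, l)"
  unfolding cycle_arcs.simps by blast

lemma finite_all_arcs: "finite V \<Longrightarrow> finite (all_arcs V)"
  by (rule finite_subset[of _ "Pow V"]) (auto simp: all_arcs_def)

lemma card_all_arcs:
  assumes "finite V"
  shows "real (card (all_arcs V)) = real (card V) * (real (card V) - 1) / 2"
proof -
  have "card (all_arcs V) = card V * (card V - 1) div 2"
    unfolding all_arcs_def using n_subsets[OF assms, of 2] choose_two[of "card V"] by simp
  moreover have "even (card V * (card V - 1))" by (cases "even (card V)") auto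
  ultimately have "2 * card (all_arcs V) = card V * (card V - 1)" by simp
  then have "2 * real (card (all_arcs V)) = real (card V) * real (card V - 1)"
    by (metis of_nat_mult of_nat_numeral)
  then show ?thesis by (cases "card V") auto
qed

lemma pair_in_all_arcs: "{i, j} \<in> all_arcs V \<longleftrightarrow> i \<in> V \<and> j \<in> V \<and> i \<noteq> j"
  by (auto simp: all_arcs_def card_2_iff')

lemma four_cycles_all_arcs:
  "four_cycles (all_arcs V) = {(i, j, k, l). distinct [i, j, k, l] \<and> {i, j, k, l} \<subseteq> V}"
  by (auto simp: four_cycles_def pair_in_all_arcs)

lemma finite_four_cycles:
  assumes "finite V"
  shows "finite (four_cycles (all_arcs V))"
  by (rule finite_subset[of _ "V \<times> V \<times> V \<times> V"]) (use assms in \<open>auto simp: four_cycles_all_arcs\<close>)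

lemma cycle_arcs_subset: "t \<in> four_cycles (all_arcs V) \<Longrightarrow> cycle_arcs t \<subseteq> all_arcs V"
  by (auto simp: four_cycles_def)

lemma card_cycle_arcs: "t \<in> four_cycles (all_arcs V) \<Longrightarrow> card (cycle_arcs t) = 4"
  by (cases t) (auto simp: four_cycles_all_arcs card_insert_if doubleton_eq_iff)

lemma card_four_cycles_eq_sum:
  assumes "finite V" "S \<subseteq> all_arcs V"
  shows "real (card (four_cycles S)) = (\<Sum>t\<in>four_cycles (all_arcs V). of_bool (cycle_arcs t \<subseteq> S))"
proof -
  have "four_cycles S = four_cycles (all_arcs V) \<inter> {t. cycle_arcs t \<subseteq> S}"
    using assms(2) by (auto simp: four_cycles_def)
  then show ?thesis using finite_four_cycles[OF assms(1)] by (simp add: sum_of_bool_eq)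
qed

lemma of_bool_mem_four:
  assumes "distinct [A, B, C, D]"
  shows "(of_bool (E \<in> {A, B, C, D} \<and> Q) :: nat)
    = of_bool (A = E \<and> Q) + of_bool (B = E \<and> Q) + of_bool (C = E \<and> Q) + of_bool (D = E \<and> Q)"
  using assms by auto

text \<open>A cycle has the arc \<open>{a, b}\<close> at exactly one of its four positions, and
  rotation, which preserves \<open>\<Phi>\<close>, moves it to the first. Hence 4 times the number
  of cycles that start with \<open>a, b\<close> or \<open>b, a\<close>.\<close>

lemma card_cycles_through:
  fixes \<Phi> :: "'v \<times> 'v \<times> 'v \<times> 'v \<Rightarrow> bool"
  assumes V: "finite V" and ab: "a \<in> V" "b \<in> V" "a \<noteq> b"
    and inv: "\<And>i j k l. \<Phi> (j, k, l, i) = \<Phi> (i, j, k, l)"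
  defines "P \<equiv> {(k, l). k \<noteq> l \<and> k \<in> V - {a, b} \<and> l \<in> V - {a, b}}"
  shows "card {t \<in> four_cycles (all_arcs V). {a, b} \<in> cycle_arcs t \<and> \<Phi> t}
    = 4 * (card {(k, l) \<in> P. \<Phi> (a, b, k, l)} + card {(k, l) \<in> P. \<Phi> (b, a, k, l)})"
proof -
  let ?T = "four_cycles (all_arcs V)"
  define rot :: "'v \<times> 'v \<times> 'v \<times> 'v \<Rightarrow> _" where "rot = (\<lambda>(i, j, k, l). (j, k, l, i))"
  define first :: "'v \<times> 'v \<times> 'v \<times> 'v \<Rightarrow> nat" where
    "first t = of_bool ({fst t, fst (snd t)} = {a, b} \<and> \<Phi> t)" for t
  have finT: "finite ?T" by (rule finite_four_cycles[OF V])
  have bij: "bij_betw rot ?T ?T"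
    by (rule bij_betw_byWitness[where f' = "rot \<circ> rot \<circ> rot"])
      (auto simp: rot_def four_cycles_all_arcs)
  have shift: "(\<Sum>t\<in>?T. f (rot t)) = (\<Sum>t\<in>?T. f t)" for f :: "_ \<Rightarrow> nat"
    by (rule sum.reindex_bij_betw[OF bij])
  have "card {t \<in> ?T. {a, b} \<in> cycle_arcs t \<and> \<Phi> t} = (\<Sum>t\<in>?T. of_bool ({a, b} \<in> cycle_arcs t \<and> \<Phi> t))"
    using finT by (simp add: sum_of_bool_eq Int_def)
  also have "\<dots> = (\<Sum>t\<in>?T. first t + first (rot t) + first (rot (rot t)) + first (rot (rot (rot t))))"
  proof (rule sum.cong[OF refl])
    fix t assume "t \<in> ?T"
    then obtain i j k l where t: "t = (i, j, k, l)" "distinct [i, j, k, l]"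
      by (auto simp: four_cycles_all_arcs)
    have "\<Phi> (j, k, l, i) = \<Phi> t" "\<Phi> (k, l, i, j) = \<Phi> t" "\<Phi> (l, i, j, k) = \<Phi> t"
      unfolding t(1) by (metis inv)+
    moreover have "distinct [{i, j}, {j, k}, {k, l}, {l, i}]"
      using t(2) by (simp add: doubleton_eq_iff) blast
    ultimately show "of_bool ({a, b} \<in> cycle_arcs t \<and> \<Phi> t)
      = first t + first (rot t) + first (rot (rot t)) + first (rot (rot (rot t)))"
      unfolding t(1) first_def rot_def cycle_arcs.simps split_conv fst_conv snd_conv
      by (simp only: of_bool_mem_four)
  qed
  also have "\<dots> = 4 * (\<Sum>t\<in>?T. first t)"
    using shift[of first] shift[of "\<lambda>t. first (rot t)"] shift[of "\<lambda>t. first (rot (rot t))"]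
    by (simp add: sum.distrib)
  also have "(\<Sum>t\<in>?T. first t) = card {t \<in> ?T. {fst t, fst (snd t)} = {a, b} \<and> \<Phi> t}"
    unfolding first_def using finT by (simp add: sum_of_bool_eq Int_def)
  also have "{t \<in> ?T. {fst t, fst (snd t)} = {a, b} \<and> \<Phi> t}
      = (\<lambda>(k, l). (a, b, k, l)) ` {(k, l) \<in> P. \<Phi> (a, b, k, l)}
        \<union> (\<lambda>(k, l). (b, a, k, l)) ` {(k, l) \<in> P. \<Phi> (b, a, k, l)}"
    using ab by (auto simp: four_cycles_all_arcs P_def doubleton_eq_iff)
  also have "card \<dots> = card {(k, l) \<in> P. \<Phi> (a, b, k, l)} + card {(k, l) \<in> P. \<Phi> (b, a, k, l)}"
  proof -
    have "P \<subseteq> V \<times> V" unfolding P_def by blast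
    then have "finite P" using V by (simp add: finite_subset)
    have "finite {(k, l) \<in> P. \<Phi> (a, b, k, l)}" "finite {(k, l) \<in> P. \<Phi> (b, a, k, l)}"
      by (rule finite_subset[OF _ \<open>finite P\<close>], blast)+
    then show ?thesis
      using ab by (subst card_Un_disjoint) (auto simp: card_image inj_on_def)
  qed
  finally show ?thesis .
qed

lemma card_ordered_pairs:
  assumes "finite B"
  shows "card {(k, l). k \<noteq> l \<and> k \<in> B \<and> l \<in> B} = card B * (card B - 1)"
proof -
  have "{(k, l). k \<noteq> l \<and> k \<in> B \<and> l \<in> B} = Sigma B (\<lambda>k. B - {k})" by auto
  then show ?thesis using assms by simp
qed

lemma card_cycles_through_arc:
  assumes "finite V" "a \<in> V" "b \<in> V" "a \<noteq> b"
  shows "card {t \<in> four_cycles (all_arcs V). {a, b} \<in> cycle_arcs t} = 8 * ((card V - 2) * (card V - 3))"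
proof -
  have "card (V - {a, b}) = card V - 2"
    using assms by (simp add: card_Diff_subset)
  then show ?thesis
    using card_cycles_through[OF assms, of "\<lambda>_. True"] card_ordered_pairs[of "V - {a, b}"] assms(1)
    by (simp add: case_prod_unfold diff_diff_add)
qed

text \<open>If the cycle starts with \<open>a, b\<close>, then \<open>c\<close> is its third node;
  if it starts with \<open>b, a\<close>, its fourth. Either way one node remains free.\<close>

lemma card_cycles_through_adjacent:
  assumes "finite V" "a \<in> V" "b \<in> V" "c \<in> V" "a \<noteq> b" "c \<noteq> a" "c \<noteq> b"
  shows "card {t \<in> four_cycles (all_arcs V). {a, b} \<in> cycle_arcs t \<and> {b, c} \<in> cycle_arcs t}
    = 8 * (card V - 3)"
proof -
  let ?P = "{(k, l). k \<noteq> l \<and> k \<in> V - {a, b} \<and> l \<in> V - {a, b}}"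
  have inv: "({b, c} \<in> cycle_arcs (j, k, l, i)) = ({b, c} \<in> cycle_arcs (i, j, k, l))" for i j k l
    by (simp only: cycle_arcs_rotate)
  have "{b, c} \<in> cycle_arcs (a, b, k, l) \<longleftrightarrow> k = c" "{b, c} \<in> cycle_arcs (b, a, k, l) \<longleftrightarrow> l = c"
    if "(k, l) \<in> ?P" for k l
    using that assms(4-7) by (simp_all add: doubleton_eq_iff) blast+
  then have "{(k, l) \<in> ?P. {b, c} \<in> cycle_arcs (a, b, k, l)} = {(k, l) \<in> ?P. k = c}"
    "{(k, l) \<in> ?P. {b, c} \<in> cycle_arcs (b, a, k, l)} = {(k, l) \<in> ?P. l = c}"
    by blast+
  moreover have "{(k, l) \<in> ?P. k = c} = Pair c ` (V - {a, b, c})"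
    "{(k, l) \<in> ?P. l = c} = (\<lambda>k. (k, c)) ` (V - {a, b, c})"
    using assms(4-7) by auto
  ultimately have 1: "{(k, l) \<in> ?P. {b, c} \<in> cycle_arcs (a, b, k, l)} = Pair c ` (V - {a, b, c})"
    and 2: "{(k, l) \<in> ?P. {b, c} \<in> cycle_arcs (b, a, k, l)} = (\<lambda>k. (k, c)) ` (V - {a, b, c})"
    by simp_all
  have "card (V - {a, b, c}) = card V - 3"
    using assms by (subst card_Diff_subset) auto
  then show ?thesis
    unfolding card_cycles_through[OF assms(1,2,3,5), of "\<lambda>t. {b, c} \<in> cycle_arcs t", OF inv] 1 2
    by (simp add: card_image inj_on_def)
qed

text \<open>The remaining nodes must be \<open>c\<close> and \<open>d\<close> in either order, for
  both directions of \<open>{a, b}\<close>: 4 * (2 + 2).\<close>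

lemma card_cycles_through_disjoint:
  assumes "finite V" "a \<in> V" "b \<in> V" "c \<in> V" "d \<in> V" "distinct [a, b, c, d]"
  shows "card {t \<in> four_cycles (all_arcs V). {a, b} \<in> cycle_arcs t \<and> {c, d} \<in> cycle_arcs t} = 16"
proof -
  let ?P = "{(k, l). k \<noteq> l \<and> k \<in> V - {a, b} \<and> l \<in> V - {a, b}}"
  have inv: "({c, d} \<in> cycle_arcs (j, k, l, i)) = ({c, d} \<in> cycle_arcs (i, j, k, l))" for i j k l
    by (simp only: cycle_arcs_rotate)
  have "{c, d} \<in> cycle_arcs (a, b, k, l) \<longleftrightarrow> (k, l) = (c, d) \<or> (k, l) = (d, c)"
    "{c, d} \<in> cycle_arcs (b, a, k, l) \<longleftrightarrow> (k, l) = (c, d) \<or> (k, l) = (d, c)"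
    if "(k, l) \<in> ?P" for k l
    using that assms(6) by (simp_all add: doubleton_eq_iff) blast+
  moreover have "(c, d) \<in> ?P" "(d, c) \<in> ?P" using assms by auto
  ultimately have 1: "{(k, l) \<in> ?P. {c, d} \<in> cycle_arcs (a, b, k, l)} = {(c, d), (d, c)}"
    and 2: "{(k, l) \<in> ?P. {c, d} \<in> cycle_arcs (b, a, k, l)} = {(c, d), (d, c)}"
    by blast+
  have "a \<noteq> b" using assms by simp
  show ?thesis
    unfolding card_cycles_through[OF assms(1,2,3) \<open>a \<noteq> b\<close>, of "\<lambda>t. {c, d} \<in> cycle_arcs t", OF inv] 1 2
    using assms(6) by simp
qed

lemma card_disjoint_arcs:
  assumes "finite V" "e \<in> all_arcs V"
  shows "real (card {g \<in> all_arcs V - {e}. g \<inter> e = {}}) = (real (card V) - 2) * (real (card V) - 3) / 2"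
proof -
  have e: "e \<subseteq> V" "card e = 2" "e \<noteq> {}" using assms(2) by (auto simp: all_arcs_def)
  then have "2 \<le> card V" using card_mono[OF assms(1), of e] by simp
  moreover have "card (V - e) = card V - 2" using e assms(1) by (simp add: card_Diff_subset finite_subset)
  moreover have "{g \<in> all_arcs V - {e}. g \<inter> e = {}} = all_arcs (V - e)"
    using e by (auto simp: all_arcs_def)
  ultimately show ?thesis using card_all_arcs[of "V - e"] assms(1) by (simp add: of_nat_diff)
qed

lemma card_adjacent_arcs:
  assumes "finite V" "e \<in> all_arcs V"
  shows "real (card {g \<in> all_arcs V - {e}. g \<inter> e \<noteq> {}}) = 2 * (real (card V) - 2)"
proof -
  have fin: "finite (all_arcs V)" by (rule finite_all_arcs[OF assms(1)])
  have "{g \<in> all_arcs V - {e}. g \<inter> e \<noteq> {}} \<union> {g \<in> all_arcs V - {e}. g \<inter> e = {}} = all_arcs V - {e}"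
    by auto
  moreover have "{g \<in> all_arcs V - {e}. g \<inter> e \<noteq> {}} \<inter> {g \<in> all_arcs V - {e}. g \<inter> e = {}} = {}"
    by auto
  ultimately have "card {g \<in> all_arcs V - {e}. g \<inter> e \<noteq> {}} + card {g \<in> all_arcs V - {e}. g \<inter> e = {}}
      = card (all_arcs V - {e})"
    using fin by (metis (no_types, lifting) card_Un_disjoint finite_Diff finite_Un)
  also have "\<dots> = card (all_arcs V) - 1" using assms by simp
  finally have "real (card {g \<in> all_arcs V - {e}. g \<inter> e \<noteq> {}})
      + real (card {g \<in> all_arcs V - {e}. g \<inter> e = {}}) = real (card (all_arcs V)) - 1"
    using fin assms(2) card_gt_0_iff[of "all_arcs V"] by (auto simp flip: of_nat_add simp: of_nat_diff)
  then show ?thesis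
    unfolding card_disjoint_arcs[OF assms] card_all_arcs[OF assms(1)] by (simp add: field_simps)
qed

text \<open>This is \<open>M\<^sup>2 - 2 M - Q\<close> with \<open>M = 2 |S|\<close>, written as a polynomial in the arc indicators.\<close>

definition arc_cycle_poly :: "'v set \<Rightarrow> 'v set set \<Rightarrow> real" where
  "arc_cycle_poly V S = 4 * ((\<Sum>e\<in>all_arcs V. of_bool (e \<in> S))\<^sup>2 - (\<Sum>e\<in>all_arcs V. of_bool (e \<in> S)))
     - (\<Sum>t\<in>four_cycles (all_arcs V). of_bool (cycle_arcs t \<subseteq> S))"

lemma arc_cycle_poly_eq:
  assumes "finite V" "S \<subseteq> all_arcs V"
  shows "arc_cycle_poly V S = 4 * (real (card S))\<^sup>2 - 4 * real (card S) - real (card (four_cycles S))"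
proof -
  have "(\<Sum>e\<in>all_arcs V. of_bool (e \<in> S)) = real (card S)"
    using finite_all_arcs[OF assms(1)] assms(2) by (simp add: sum_of_bool_eq Int_absorb1)
  then show ?thesis
    unfolding arc_cycle_poly_def card_four_cycles_eq_sum[OF assms] by simp
qed

section \<open>First and second derivatives of the polynomial part\<close>

lemma discrete_deriv_diff:
  "discrete_deriv e (\<lambda>S. f S - g S) S = discrete_deriv e f S - discrete_deriv e g S"
  by (simp add: discrete_deriv_def)

lemma discrete_deriv_cmult: "discrete_deriv e (\<lambda>S. c * f S) S = c * discrete_deriv e f S"
  by (simp add: discrete_deriv_def right_diff_distrib)

lemma discrete_deriv_sum_mem:
  assumes "finite B"
  shows "discrete_deriv e (\<lambda>S. \<Sum>f\<in>B. of_bool (f \<in> S)) S = of_bool (e \<in> B)"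
proof -
  have "discrete_deriv e (\<lambda>S. \<Sum>f\<in>B. of_bool (f \<in> S)) S = (\<Sum>f\<in>B. of_bool (f = e))"
    unfolding discrete_deriv_sum by (rule sum.cong) (auto simp: discrete_deriv_def)
  also have "\<dots> = of_bool (e \<in> B)" using assms by (simp add: of_bool_def)
  finally show ?thesis .
qed

lemma discrete_deriv_sum_monomial:
  assumes "finite T"
  shows "discrete_deriv e (\<lambda>S. \<Sum>t\<in>T. of_bool (B t \<subseteq> S)) S
    = (\<Sum>t | t \<in> T \<and> e \<in> B t. of_bool (B t - {e} \<subseteq> S))"
  unfolding discrete_deriv_sum discrete_deriv_monomial sum.inter_filter[OF assms]
  by (rule sum.cong) auto

lemma discrete_deriv_arc_cycle_poly:
  assumes "finite V" "e \<in> all_arcs V"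
  shows "discrete_deriv e (arc_cycle_poly V) = (\<lambda>S. 8 * (\<Sum>f\<in>all_arcs V - {e}. of_bool (f \<in> S))
    - (\<Sum>t | t \<in> four_cycles (all_arcs V) \<and> e \<in> cycle_arcs t. of_bool (cycle_arcs t - {e} \<subseteq> S)))"
proof
  fix S
  let ?m = "\<lambda>S. \<Sum>f\<in>all_arcs V. of_bool (f \<in> S) :: real"
  let ?r = "\<Sum>f\<in>all_arcs V - {e}. of_bool (f \<in> S) :: real"
  note fin = finite_all_arcs[OF assms(1)]
  have "?m (insert e S) = 1 + ?r" "?m (S - {e}) = ?r"
    using sum.remove[OF fin assms(2), of "\<lambda>f. of_bool (f \<in> insert e S) :: real"]
      sum.remove[OF fin assms(2), of "\<lambda>f. of_bool (f \<in> S - {e}) :: real"]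
    by (auto intro!: sum.cong)
  \<comment> \<open>With \<open>r\<close> arcs apart from \<open>e\<close>, the step from
    \<open>r\<close> to \<open>r + 1\<close> raises \<open>m\<^sup>2 - m\<close> by
    \<open>2 * r\<close>.\<close>
  then have "discrete_deriv e (\<lambda>S. 4 * ((?m S)\<^sup>2 - ?m S)) S = 8 * ?r"
    by (simp add: discrete_deriv_def power2_eq_square algebra_simps)
  then show "discrete_deriv e (arc_cycle_poly V) S = 8 * ?r
    - (\<Sum>t | t \<in> four_cycles (all_arcs V) \<and> e \<in> cycle_arcs t. of_bool (cycle_arcs t - {e} \<subseteq> S))"
    unfolding arc_cycle_poly_def[abs_def] discrete_deriv_diff
      discrete_deriv_sum_monomial[OF finite_four_cycles[OF assms(1)]]
    by simp
qed

lemma discrete_deriv_arc_cycle_poly_second: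
  assumes "finite V" "e \<in> all_arcs V" "g \<in> all_arcs V" "g \<noteq> e"
  shows "discrete_deriv g (discrete_deriv e (arc_cycle_poly V)) = (\<lambda>S. 8
    - (\<Sum>t | t \<in> four_cycles (all_arcs V) \<and> e \<in> cycle_arcs t \<and> g \<in> cycle_arcs t.
        of_bool (cycle_arcs t - {e, g} \<subseteq> S)))"
proof
  fix S
  let ?T = "{t \<in> four_cycles (all_arcs V). e \<in> cycle_arcs t}"
  have "finite ?T" using finite_four_cycles[OF assms(1)] by simp
  have arcs: "discrete_deriv g (\<lambda>S. \<Sum>f\<in>all_arcs V - {e}. of_bool (f \<in> S)) S = 1"
    unfolding discrete_deriv_sum_mem[OF finite_Diff[OF finite_all_arcs[OF assms(1)]]] using assms(3,4) by simp
  have diff: "X - {e} - {g} = X - {e, g}" for X :: "'a set set" by blast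
  have "{t \<in> ?T. g \<in> cycle_arcs t - {e}}
      = {t. t \<in> four_cycles (all_arcs V) \<and> e \<in> cycle_arcs t \<and> g \<in> cycle_arcs t}"
    using assms(4) by blast
  then show "discrete_deriv g (discrete_deriv e (arc_cycle_poly V)) S = 8
    - (\<Sum>t | t \<in> four_cycles (all_arcs V) \<and> e \<in> cycle_arcs t \<and> g \<in> cycle_arcs t.
        of_bool (cycle_arcs t - {e, g} \<subseteq> S))"
    unfolding discrete_deriv_arc_cycle_poly[OF assms(1,2)] discrete_deriv_diff discrete_deriv_cmult arcs
      discrete_deriv_sum_monomial[OF \<open>finite ?T\<close>, of g "\<lambda>t. cycle_arcs t - {e}"]
    by (simp add: diff)
qed

lemma cube_exp_sum_mem:
  assumes "finite A" "B \<subseteq> A"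
  shows "cube_exp p A (\<lambda>S. \<Sum>f\<in>B. of_bool (f \<in> S)) = real (card B) * p"
proof -
  have "cube_exp p A (\<lambda>S. of_bool (f \<in> S)) = p" if "f \<in> B" for f
    using cube_exp_monomial[OF assms(1), of "{f}"] assms(2) that by auto
  then show ?thesis unfolding cube_exp_sum by simp
qed

lemma cube_exp_sum_monomial:
  assumes "finite A" "\<And>t. t \<in> T \<Longrightarrow> B t \<subseteq> A" "\<And>t. t \<in> T \<Longrightarrow> card (B t) = k"
  shows "cube_exp p A (\<lambda>S. \<Sum>t\<in>T. of_bool (B t \<subseteq> S)) = real (card T) * p ^ k"
  unfolding cube_exp_sum using assms by (simp add: cube_exp_monomial)

lemma cube_exp_deriv_arc_cycle_poly:
  assumes "finite V" "e \<in> all_arcs V" "card V \<ge> 3"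
  defines "n \<equiv> real (card V)"
  shows "cube_exp p (all_arcs V) (discrete_deriv e (arc_cycle_poly V))
    = 4 * (n - 2) * p * ((n + 1) - 2 * (n - 3) * p\<^sup>2)"
proof -
  let ?A = "all_arcs V"
  let ?T = "{t \<in> four_cycles ?A. e \<in> cycle_arcs t}"
  note fin = finite_all_arcs[OF assms(1)]
  obtain a b where ab: "e = {a, b}" "a \<in> V" "b \<in> V" "a \<noteq> b"
    using assms(2) by (auto simp: all_arcs_def card_2_iff)
  have T: "real (card ?T) = 8 * ((n - 2) * (n - 3))"
    unfolding ab(1) card_cycles_through_arc[OF assms(1) ab(2-4)] n_def using assms(3)
    by (simp add: of_nat_diff)
  have cycles: "cube_exp p ?A (\<lambda>S. \<Sum>t\<in>?T. of_bool (cycle_arcs t - {e} \<subseteq> S)) = real (card ?T) * p ^ 3"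
  proof (rule cube_exp_sum_monomial[OF fin])
    fix t assume t: "t \<in> ?T"
    show "cycle_arcs t - {e} \<subseteq> ?A" using cycle_arcs_subset[of t V] t by blast
    show "card (cycle_arcs t - {e}) = 3" using card_cycle_arcs[of t V] t by simp
  qed
  have A: "real (card (?A - {e})) = n * (n - 1) / 2 - 1"
  proof -
    have "card ?A \<noteq> 0" using fin assms(2) by auto
    then show ?thesis using card_all_arcs[OF assms(1)] assms(2) by (simp add: n_def of_nat_diff)
  qed
  have arcs: "cube_exp p ?A (\<lambda>S. \<Sum>f\<in>?A - {e}. of_bool (f \<in> S)) = real (card (?A - {e})) * p"
    by (rule cube_exp_sum_mem[OF fin]) blast
  have "cube_exp p ?A (discrete_deriv e (arc_cycle_poly V))
      = 8 * ((n * (n - 1) / 2 - 1) * p) - 8 * ((n - 2) * (n - 3)) * p ^ 3"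
    unfolding discrete_deriv_arc_cycle_poly[OF assms(1,2)] cube_exp_diff cube_exp_cmult arcs cycles A T ..
  \<comment> \<open>\<open>n * (n - 1) / 2 - 1\<close> is \<open>(n - 2) * (n + 1) / 2\<close>, so
    that \<open>n - 2\<close> comes out of both terms.\<close>
  also have "\<dots> = 4 * (n - 2) * p * ((n + 1) - 2 * (n - 3) * p\<^sup>2)"
    by algebra
  finally show ?thesis .
qed

lemma card_cycles_through_two_arcs:
  assumes "finite V" "e \<in> all_arcs V" "g \<in> all_arcs V" "g \<noteq> e" "card V \<ge> 3"
  shows "real (card {t \<in> four_cycles (all_arcs V). e \<in> cycle_arcs t \<and> g \<in> cycle_arcs t})
    = (if g \<inter> e = {} then 16 else 8 * (real (card V) - 3))"
proof (cases "g \<inter> e = {}")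
  case True
  obtain a b where ab: "e = {a, b}" "a \<in> V" "b \<in> V" "a \<noteq> b"
    using assms(2) by (auto simp: all_arcs_def card_2_iff)
  obtain c d where cd: "g = {c, d}" "c \<in> V" "d \<in> V" "c \<noteq> d"
    using assms(3) by (auto simp: all_arcs_def card_2_iff)
  have "distinct [a, b, c, d]" using True ab cd by auto
  then show ?thesis
    using True card_cycles_through_disjoint[OF assms(1) ab(2,3) cd(2,3)] ab cd by simp
next
  case False
  then obtain b where b: "b \<in> g" "b \<in> e" by blast
  obtain a where a: "e = {a, b}" "a \<in> V" "b \<in> V" "a \<noteq> b"
    using assms(2) b(2) by (auto simp: all_arcs_def card_2_iff insert_commute)
  obtain c where c: "g = {b, c}" "c \<in> V" "c \<noteq> b"
    using assms(3) b(1) by (auto simp: all_arcs_def card_2_iff insert_commute)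
  have "c \<noteq> a" using assms(4) a c by (auto simp: insert_commute)
  then show ?thesis
    using False card_cycles_through_adjacent[OF assms(1) a(2,3) c(2)] a c assms(5) by (simp add: of_nat_diff)
qed

lemma card_cycle_arcs_Diff_two:
  assumes "t \<in> four_cycles (all_arcs V)" "e \<in> cycle_arcs t" "g \<in> cycle_arcs t" "g \<noteq> e"
  shows "card (cycle_arcs t - {e, g}) = 2"
proof -
  have "card (cycle_arcs t - {e, g}) = 4 - card {e, g}"
    using card_cycle_arcs[OF assms(1)] assms(2,3) by (subst card_Diff_subset) auto
  then show ?thesis using assms(4) by simp
qed

lemma cube_exp_second_deriv_arc_cycle_poly:
  assumes "finite V" "e \<in> all_arcs V" "g \<in> all_arcs V" "g \<noteq> e" "card V \<ge> 3"
  shows "cube_exp p (all_arcs V) (discrete_deriv g (discrete_deriv e (arc_cycle_poly V)))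
    = 8 - (if g \<inter> e = {} then 16 else 8 * (real (card V) - 3)) * p\<^sup>2"
proof -
  let ?A = "all_arcs V"
  let ?T = "{t. t \<in> four_cycles ?A \<and> e \<in> cycle_arcs t \<and> g \<in> cycle_arcs t}"
  note fin = finite_all_arcs[OF assms(1)]
  have "cube_exp p ?A (\<lambda>S. \<Sum>t\<in>?T. of_bool (cycle_arcs t - {e, g} \<subseteq> S)) = real (card ?T) * p\<^sup>2"
  proof (rule cube_exp_sum_monomial[OF fin])
    fix t assume t: "t \<in> ?T"
    show "cycle_arcs t - {e, g} \<subseteq> ?A" using cycle_arcs_subset[of t V] t by blast
    show "card (cycle_arcs t - {e, g}) = 2" using card_cycle_arcs_Diff_two[OF _ _ _ assms(4), of t V] t by simp
  qed
  then show ?thesis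
    unfolding discrete_deriv_arc_cycle_poly_second[OF assms(1-4)] cube_exp_diff cube_exp_const[OF fin]
      card_cycles_through_two_arcs[OF assms] by simp
qed

text \<open>The cycle sum lies between 0 and its number of terms, so its square is at most that
  number times the sum itself. The bound becomes linear and asks only for a mean.\<close>

lemma cube_exp_second_deriv_arc_cycle_poly_square_le:
  assumes p: "0 \<le> p" "p \<le> 1"
    and V: "finite V" "e \<in> all_arcs V" "g \<in> all_arcs V" "g \<noteq> e" "card V \<ge> 3"
  shows "cube_exp p (all_arcs V) (\<lambda>S. (discrete_deriv g (discrete_deriv e (arc_cycle_poly V)) S)\<^sup>2)
    \<le> 128 + 2 * (if g \<inter> e = {} then 16 else 8 * (real (card V) - 3))\<^sup>2 * p\<^sup>2"
proof -
  let ?A = "all_arcs V"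
  let ?T = "{t. t \<in> four_cycles ?A \<and> e \<in> cycle_arcs t \<and> g \<in> cycle_arcs t}"
  let ?Y = "\<lambda>S. \<Sum>t\<in>?T. of_bool (cycle_arcs t - {e, g} \<subseteq> S) :: real"
  note fin = finite_all_arcs[OF V(1)]
  have Y: "cube_exp p ?A ?Y = real (card ?T) * p\<^sup>2"
  proof (rule cube_exp_sum_monomial[OF fin])
    fix t assume t: "t \<in> ?T"
    show "cycle_arcs t - {e, g} \<subseteq> ?A" using cycle_arcs_subset[of t V] t by blast
    show "card (cycle_arcs t - {e, g}) = 2" using card_cycle_arcs_Diff_two[OF _ _ _ V(4), of t V] t by simp
  qed
  have "(8 - ?Y S)\<^sup>2 \<le> 128 + (2 * real (card ?T)) * ?Y S" for S
  proof -
    have "?Y S \<le> real (card ?T)"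
      using sum_bounded_above[of ?T "\<lambda>t. of_bool (cycle_arcs t - {e, g} \<subseteq> S) :: real" 1] by simp
    moreover have "0 \<le> ?Y S" by (rule sum_nonneg) simp
    ultimately have "(?Y S)\<^sup>2 \<le> real (card ?T) * ?Y S"
      unfolding power2_eq_square by (rule mult_right_mono)
    moreover have "(8 - ?Y S)\<^sup>2 + (8 + ?Y S)\<^sup>2 = 128 + 2 * (?Y S)\<^sup>2"
      by (simp add: power2_diff power2_sum)
    ultimately show ?thesis using zero_le_power2[of "8 + ?Y S"] by linarith
  qed
  then have "cube_exp p ?A (\<lambda>S. (8 - ?Y S)\<^sup>2) \<le> cube_exp p ?A (\<lambda>S. 128 + (2 * real (card ?T)) * ?Y S)"
    by (intro cube_exp_mono p)
  also have "\<dots> = 128 + 2 * (real (card ?T))\<^sup>2 * p\<^sup>2"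
    unfolding cube_exp_add cube_exp_cmult cube_exp_const[OF fin] Y by (simp add: power2_eq_square)
  finally show ?thesis
    unfolding discrete_deriv_arc_cycle_poly_second[OF V(1-4)] card_cycles_through_two_arcs[OF V] .
qed

section \<open>Variance of the number of shortcut paths\<close>

lemma shortcut_paths_mono: "S \<subseteq> S' \<Longrightarrow> shortcut_paths S \<subseteq> shortcut_paths S'"
  unfolding shortcut_paths_def shortcut_def by blast

lemma finite_shortcut_paths:
  assumes "finite V" "S \<subseteq> all_arcs V"
  shows "finite (shortcut_paths S)"
  by (rule finite_subset[of _ "V \<times> V \<times> V"])
    (use arcD[OF assms(2)] assms(1) in \<open>auto simp: shortcut_paths_def\<close>)

text \<open>A path that acquires a shortcut only because its end points get a second common neighbour had a
  unique possible middle node before; \<open>u\<close> recovers it, so the path is determined by one neighbour of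
  the new arc.\<close>

lemma new_shortcut_paths:
  assumes S: "S \<subseteq> all_arcs V" and e: "{a, b} \<notin> S"
  defines "Na \<equiv> {l. {a, l} \<in> S}" and "Nb \<equiv> {l. {b, l} \<in> S}"
    and "u \<equiv> \<lambda>i l. THE j. {i, j} \<in> S \<and> {j, l} \<in> S"
  shows "shortcut_paths (insert {a, b} S) - shortcut_paths S \<subseteq>
    (\<lambda>l. (a, b, l)) ` Nb \<union> (\<lambda>l. (b, a, l)) ` Na \<union> (\<lambda>i. (i, a, b)) ` Na \<union> (\<lambda>i. (i, b, a)) ` Nb
    \<union> (\<lambda>j. (a, j, b)) ` Na \<union> (\<lambda>j. (b, j, a)) ` Na
    \<union> (\<lambda>l. (a, u a l, l)) ` Nb \<union> (\<lambda>l. (b, u b l, l)) ` Na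
    \<union> (\<lambda>i. (i, u i a, a)) ` Nb \<union> (\<lambda>i. (i, u i b, b)) ` Na" (is "_ \<subseteq> ?U")
proof
  fix t assume "t \<in> shortcut_paths (insert {a, b} S) - shortcut_paths S"
  then obtain i j l where t: "t = (i, j, l)" "i \<noteq> l"
    and ij: "{i, j} = {a, b} \<or> {i, j} \<in> S" and jl: "{j, l} = {a, b} \<or> {j, l} \<in> S"
    and new: "shortcut (insert {a, b} S) i j l" and old: "(i, j, l) \<notin> shortcut_paths S"
    by (auto simp: shortcut_paths_def)
  have mem: "x \<in> Na \<longleftrightarrow> {a, x} \<in> S" "x \<in> Na \<longleftrightarrow> {x, a} \<in> S" "x \<in> Nb \<longleftrightarrow> {b, x} \<in> S" "x \<in> Nb \<longleftrightarrow> {x, b} \<in> S" for x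
    by (simp_all add: Na_def Nb_def insert_commute)
  have in_S: "{x, y} \<in> S" if "{x, y} = {a, b} \<or> {x, y} \<in> S" "{x, y} \<noteq> {a, b}" for x y using that by blast
  \<comment> \<open>The new arc lies on the path (four families), joins its end points (two), or
    belongs to a detour through another middle node (four).\<close>
  consider "{i, j} = {a, b}" | "{j, l} = {a, b}" | "{i, j} \<in> S" "{j, l} \<in> S" using ij jl by blast
  then show "t \<in> ?U"
  proof cases
    case 1
    have "{j, l} \<in> S" using in_S[OF jl] 1 t(2) by (auto simp: doubleton_eq_iff)
    moreover have "i = a \<and> j = b \<or> i = b \<and> j = a" using 1 by (simp add: doubleton_eq_iff)
    ultimately have "t \<in> (\<lambda>l. (a, b, l)) ` Nb \<or> t \<in> (\<lambda>l. (b, a, l)) ` Na" using t(1) mem by blast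
    then show ?thesis by blast
  next
    case 2
    have "{i, j} \<in> S" using in_S[OF ij] 2 t(2) by (auto simp: doubleton_eq_iff)
    moreover have "j = a \<and> l = b \<or> j = b \<and> l = a" using 2 by (simp add: doubleton_eq_iff)
    ultimately have "t \<in> (\<lambda>i. (i, a, b)) ` Na \<or> t \<in> (\<lambda>i. (i, b, a)) ` Nb" using t(1) mem by blast
    then show ?thesis by blast
  next
    case 3
    then have not: "\<not> shortcut S i j l" using old t(2) by (simp add: shortcut_paths_def)
    have u: "u i l = j"
      unfolding u_def by (rule the_equality) (use 3 not in \<open>auto simp: shortcut_def\<close>)
    from new not consider "{i, l} = {a, b}"
      | m where "{i, m} = {a, b}" "{m, l} = {a, b} \<or> {m, l} \<in> S"
      | m where "{m, l} = {a, b}" "{i, m} = {a, b} \<or> {i, m} \<in> S"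
      unfolding shortcut_def by blast
    then show ?thesis
    proof cases
      case 1
      then have "i = a \<and> l = b \<or> i = b \<and> l = a" by (simp add: doubleton_eq_iff)
      then have "t \<in> (\<lambda>j. (a, j, b)) ` Na \<or> t \<in> (\<lambda>j. (b, j, a)) ` Na" using 3 t(1) mem by blast
      then show ?thesis by blast
    next
      case (2 m)
      have "{m, l} \<in> S" using in_S[OF 2(2)] 2(1) t(2) by (auto simp: doubleton_eq_iff)
      moreover have "i = a \<and> m = b \<or> i = b \<and> m = a" using 2(1) by (simp add: doubleton_eq_iff)
      ultimately have "t \<in> (\<lambda>l. (a, u a l, l)) ` Nb \<or> t \<in> (\<lambda>l. (b, u b l, l)) ` Na"
        using u t(1) mem by blast
      then show ?thesis by blast
    next
      case (3 m)
      have "{i, m} \<in> S" using in_S[OF 3(2)] 3(1) t(2) by (auto simp: doubleton_eq_iff)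
      moreover have "m = a \<and> l = b \<or> m = b \<and> l = a" using 3(1) by (simp add: doubleton_eq_iff)
      ultimately have "t \<in> (\<lambda>i. (i, u i a, a)) ` Nb \<or> t \<in> (\<lambda>i. (i, u i b, b)) ` Na"
        using u t(1) mem by blast
      then show ?thesis by blast
    qed
  qed
qed

lemma card_Un_le_add: "card X \<le> x \<Longrightarrow> card Y \<le> y \<Longrightarrow> card (X \<union> Y) \<le> x + y"
  using card_Un_le[of X Y] by linarith

text \<open>The constant 10 is the number of families in \<open>new_shortcut_paths\<close>. Each is
  an image of the neighbours of one end of \<open>e\<close>, and these neighbours inject into the
  arcs of \<open>S\<close> that meet \<open>e\<close>.\<close>

lemma abs_discrete_deriv_shortcut_paths_le:
  assumes V: "finite V" and e: "e \<in> all_arcs V" and S: "S \<subseteq> all_arcs V"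
  shows "\<bar>discrete_deriv e (\<lambda>S. real (card (shortcut_paths S))) S\<bar>
    \<le> 10 * real (card ({g \<in> all_arcs V - {e}. g \<inter> e \<noteq> {}} \<inter> S))"
proof -
  obtain a b where ab: "e = {a, b}" "a \<noteq> b"
    using e by (auto simp: all_arcs_def card_2_iff)
  let ?S = "S - {e}"
  let ?Na = "{l. {a, l} \<in> ?S}" and ?Nb = "{l. {b, l} \<in> ?S}"
  let ?G = "{g \<in> all_arcs V - {e}. g \<inter> e \<noteq> {}} \<inter> S"
  let ?d = "card ?G"
  have sub: "?S \<subseteq> all_arcs V" "insert {a, b} ?S \<subseteq> all_arcs V" using S e ab by auto
  have finG: "finite ?G" using finite_all_arcs[OF V] by simp
  have nbr: "finite {l. {c, l} \<in> ?S}" "card {l. {c, l} \<in> ?S} \<le> ?d" if "c \<in> e" for c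
  proof -
    have "inj_on (\<lambda>l. {c, l}) {l. {c, l} \<in> ?S}" by (auto simp: inj_on_def doubleton_eq_iff)
    moreover have "(\<lambda>l. {c, l}) ` {l. {c, l} \<in> ?S} \<subseteq> ?G" using that S by auto
    ultimately show "finite {l. {c, l} \<in> ?S}" "card {l. {c, l} \<in> ?S} \<le> ?d"
      using finG by (blast intro: inj_on_finite, blast intro: card_inj_on_le)
  qed
  have img: "card (f ` ?Na) \<le> ?d" "card (f ` ?Nb) \<le> ?d" for f :: "_ \<Rightarrow> 'a \<times> 'a \<times> 'a"
    using order_trans[OF card_image_le[OF nbr(1)] nbr(2)] ab(1) by blast+
  have fin_img: "finite (f ` ?Na)" "finite (f ` ?Nb)" for f :: "_ \<Rightarrow> 'a \<times> 'a \<times> 'a"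
    using finite_imageI[OF nbr(1)] ab(1) by blast+
  have "{a, b} \<notin> ?S" using ab by simp
  note new = new_shortcut_paths[OF sub(1) this]
  have "card (shortcut_paths (insert {a, b} ?S) - shortcut_paths ?S)
      \<le> ?d + ?d + ?d + ?d + ?d + ?d + ?d + ?d + ?d + ?d"
    by (rule order_trans[OF card_mono[OF _ new]], intro finite_UnI fin_img)
      (intro card_Un_le_add img)
  \<comment> \<open>By monotonicity the change in cardinality is the cardinality of the
    difference.\<close>
  moreover have "shortcut_paths ?S \<subseteq> shortcut_paths (insert {a, b} ?S)"
    by (rule shortcut_paths_mono) blast
  ultimately have "\<bar>real (card (shortcut_paths (insert {a, b} ?S))) - real (card (shortcut_paths ?S))\<bar> \<le> 10 * real ?d"
    using card_Diff_subset[of "shortcut_paths ?S" "shortcut_paths (insert {a, b} ?S)"]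
      card_mono[of "shortcut_paths (insert {a, b} ?S)" "shortcut_paths ?S"]
      finite_shortcut_paths[OF V sub(1)] finite_shortcut_paths[OF V sub(2)]
    by linarith
  moreover have "insert {a, b} ?S = insert e S" using ab(1) by auto
  ultimately show ?thesis unfolding discrete_deriv_def by simp
qed

text \<open>By Efron-Stein, at most \<open>n\<^sup>2 / 2\<close> arcs contribute, each at most 100
  times the second moment of a binomial count over at most \<open>2 * n\<close> adjacent
  arcs.\<close>

lemma cube_var_shortcut_paths_le:
  assumes p: "0 \<le> p" "p \<le> 1" and V: "finite V" "card V \<ge> 2"
  defines "n \<equiv> real (card V)"
  shows "cube_var p (all_arcs V) (\<lambda>S. real (card (shortcut_paths S)))
    \<le> p * (1 - p) * (n\<^sup>2 * (100 * (n * p + 2 * (n * p)\<^sup>2)))"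
proof -
  let ?A = "all_arcs V"
  let ?D = "\<lambda>e. discrete_deriv e (\<lambda>S. real (card (shortcut_paths S)))"
  note fin = finite_all_arcs[OF V(1)]
  have bound: "cube_exp p ?A (\<lambda>S. (?D e S)\<^sup>2) \<le> 200 * (n * p + 2 * (n * p)\<^sup>2)" if e: "e \<in> ?A" for e
  proof -
    let ?G = "{g \<in> ?A - {e}. g \<inter> e \<noteq> {}}"
    have G: "real (card ?G) \<le> 2 * n" "0 \<le> real (card ?G)"
      using card_adjacent_arcs[OF V(1) e] by (auto simp: n_def)
    have "cube_exp p ?A (\<lambda>S. (?D e S)\<^sup>2) \<le> cube_exp p ?A (\<lambda>S. 100 * (real (card (?G \<inter> S)))\<^sup>2)"
    proof (rule cube_exp_mono[OF p])
      fix S assume "S \<subseteq> ?A"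
      then have "\<bar>?D e S\<bar>\<^sup>2 \<le> (10 * real (card (?G \<inter> S)))\<^sup>2"
        using abs_discrete_deriv_shortcut_paths_le[OF V(1) e] by (intro power_mono) auto
      then show "(?D e S)\<^sup>2 \<le> 100 * (real (card (?G \<inter> S)))\<^sup>2" by (simp add: power_mult_distrib)
    qed
    also have "\<dots> \<le> 100 * (real (card ?G) * p + (real (card ?G) * p)\<^sup>2)"
      unfolding cube_exp_cmult using cube_exp_card_Int_square_le[OF p fin, of ?G] by auto
    also have "\<dots> \<le> 100 * ((2 * n) * p + ((2 * n) * p)\<^sup>2)"
      using G p by (intro mult_left_mono add_mono power_mono mult_right_mono) auto
    also have "\<dots> = 200 * (n * p + 2 * (n * p)\<^sup>2)" by (simp add: power_mult_distrib)
    finally show ?thesis .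
  qed
  have "cube_var p ?A (\<lambda>S. real (card (shortcut_paths S)))
      \<le> p * (1 - p) * (\<Sum>e\<in>?A. cube_exp p ?A (\<lambda>S. (?D e S)\<^sup>2))"
    by (rule efron_stein[OF p fin])
  also have "\<dots> \<le> p * (1 - p) * (real (card ?A) * (200 * (n * p + 2 * (n * p)\<^sup>2)))"
    using p bound by (intro mult_left_mono sum_bounded_above) auto
  also have "\<dots> \<le> p * (1 - p) * (n\<^sup>2 / 2 * (200 * (n * p + 2 * (n * p)\<^sup>2)))"
    using p by (intro mult_left_mono mult_right_mono)
      (auto simp: card_all_arcs[OF V(1)] n_def power2_eq_square mult_left_mono)
  also have "n\<^sup>2 / 2 * (200 * (n * p + 2 * (n * p)\<^sup>2)) = n\<^sup>2 * (100 * (n * p + 2 * (n * p)\<^sup>2))"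
    by simp
  finally show ?thesis .
qed


section \<open>Uniform variance bounds\<close>

lemma sum_over_other_arcs:
  assumes "finite V" "e \<in> all_arcs V"
  shows "(\<Sum>g\<in>all_arcs V - {e}. if g \<inter> e = {} then c else d)
    = (real (card V) - 2) * (real (card V) - 3) / 2 * c + 2 * (real (card V) - 2) * d"
proof -
  have "finite (all_arcs V - {e})" using finite_all_arcs[OF assms(1)] by simp
  moreover have "(all_arcs V - {e}) \<inter> {g. g \<inter> e = {}} = {g \<in> all_arcs V - {e}. g \<inter> e = {}}"
    "(all_arcs V - {e}) \<inter> - {g. g \<inter> e = {}} = {g \<in> all_arcs V - {e}. g \<inter> e \<noteq> {}}"
    by auto
  ultimately show ?thesis
    by (simp only: sum.If_cases sum_constant card_disjoint_arcs[OF assms] card_adjacent_arcs[OF assms])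
qed

lemma cube_var_arc_cycle_poly_le:
  assumes p: "0 \<le> p" "p \<le> 1" and V: "finite V" "card V \<ge> 3"
  defines "n \<equiv> real (card V)"
  shows "cube_var p (all_arcs V) (arc_cycle_poly V) \<le> p * (1 - p) * (n * (n - 1) / 2 *
    ((4 * (n - 2) * p * ((n + 1) - 2 * (n - 3) * p\<^sup>2))\<^sup>2
     + p * (1 - p) * ((n - 2) * (n - 3) / 2 * (128 + 512 * p\<^sup>2) + 2 * (n - 2) * (128 + 128 * (n - 3)\<^sup>2 * p\<^sup>2))))"
proof -
  let ?A = "all_arcs V"
  let ?D = "\<lambda>e. discrete_deriv e (arc_cycle_poly V)"
  note fin = finite_all_arcs[OF V(1)]
  have second: "(\<Sum>g\<in>?A. cube_exp p ?A (\<lambda>S. (discrete_deriv g (?D e) S)\<^sup>2))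
      \<le> (n - 2) * (n - 3) / 2 * (128 + 512 * p\<^sup>2) + 2 * (n - 2) * (128 + 128 * (n - 3)\<^sup>2 * p\<^sup>2)"
    if e: "e \<in> ?A" for e
  proof -
    \<comment> \<open>The double sum of \<open>cube_var_le_second_order\<close> includes
      \<open>g = e\<close>; this term vanishes.\<close>
    have "discrete_deriv e (?D e) S = 0" for S by (simp add: discrete_deriv_def)
    then have "cube_exp p ?A (\<lambda>S. (discrete_deriv e (?D e) S)\<^sup>2) = 0"
      using cube_exp_const[OF fin, of p 0] by simp
    then have "(\<Sum>g\<in>?A. cube_exp p ?A (\<lambda>S. (discrete_deriv g (?D e) S)\<^sup>2))
        = (\<Sum>g\<in>?A - {e}. cube_exp p ?A (\<lambda>S. (discrete_deriv g (?D e) S)\<^sup>2))"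
      using sum.remove[OF fin e, of "\<lambda>g. cube_exp p ?A (\<lambda>S. (discrete_deriv g (?D e) S)\<^sup>2)"] by simp
    also have "\<dots> \<le> (\<Sum>g\<in>?A - {e}. if g \<inter> e = {} then 128 + 512 * p\<^sup>2 else 128 + 128 * (n - 3)\<^sup>2 * p\<^sup>2)"
    proof (rule sum_mono)
      fix g assume "g \<in> ?A - {e}"
      then have "cube_exp p ?A (\<lambda>S. (discrete_deriv g (?D e) S)\<^sup>2)
          \<le> 128 + 2 * (if g \<inter> e = {} then 16 else 8 * (n - 3))\<^sup>2 * p\<^sup>2"
        unfolding n_def using e V by (intro cube_exp_second_deriv_arc_cycle_poly_square_le[OF p]) auto
      also have "\<dots> = (if g \<inter> e = {} then 128 + 512 * p\<^sup>2 else 128 + 128 * (n - 3)\<^sup>2 * p\<^sup>2)"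
        by (auto simp: power2_eq_square algebra_simps)
      finally show "cube_exp p ?A (\<lambda>S. (discrete_deriv g (?D e) S)\<^sup>2)
          \<le> (if g \<inter> e = {} then 128 + 512 * p\<^sup>2 else 128 + 128 * (n - 3)\<^sup>2 * p\<^sup>2)" .
    qed
    finally show ?thesis unfolding sum_over_other_arcs[OF V(1) e] n_def .
  qed
  have "cube_var p ?A (arc_cycle_poly V) \<le> p * (1 - p) * (\<Sum>e\<in>?A. (cube_exp p ?A (?D e))\<^sup>2
    + p * (1 - p) * (\<Sum>g\<in>?A. cube_exp p ?A (\<lambda>S. (discrete_deriv g (?D e) S)\<^sup>2)))"
    by (rule cube_var_le_second_order[OF p fin])
  also have "\<dots> \<le> p * (1 - p) * (real (card ?A) *
    ((4 * (n - 2) * p * ((n + 1) - 2 * (n - 3) * p\<^sup>2))\<^sup>2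
     + p * (1 - p) * ((n - 2) * (n - 3) / 2 * (128 + 512 * p\<^sup>2) + 2 * (n - 2) * (128 + 128 * (n - 3)\<^sup>2 * p\<^sup>2))))"
  proof (intro mult_left_mono sum_bounded_above)
    fix e assume e: "e \<in> ?A"
    show "(cube_exp p ?A (?D e))\<^sup>2 + p * (1 - p) * (\<Sum>g\<in>?A. cube_exp p ?A (\<lambda>S. (discrete_deriv g (?D e) S)\<^sup>2))
      \<le> (4 * (n - 2) * p * ((n + 1) - 2 * (n - 3) * p\<^sup>2))\<^sup>2
     + p * (1 - p) * ((n - 2) * (n - 3) / 2 * (128 + 512 * p\<^sup>2) + 2 * (n - 2) * (128 + 128 * (n - 3)\<^sup>2 * p\<^sup>2))"
      unfolding cube_exp_deriv_arc_cycle_poly[OF V(1) e V(2), folded n_def]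
      using second[OF e] p by (intro add_left_mono mult_left_mono) auto
  qed (use p in auto)
  finally show ?thesis unfolding card_all_arcs[OF V(1)] n_def .
qed

text \<open>Mean first derivatives are the same for all arcs, and mean second derivatives depend
  only on whether the two arcs meet; so the sums reduce to counting.\<close>

lemma cube_var_arc_cycle_poly_ge:
  assumes p: "0 \<le> p" "p \<le> 1" and V: "finite V" "card V \<ge> 3"
  defines "n \<equiv> real (card V)"
  shows "p * (1 - p) * (n * (n - 1) / 2 * (4 * (n - 2) * p * ((n + 1) - 2 * (n - 3) * p\<^sup>2))\<^sup>2)
    + (p * (1 - p))\<^sup>2 / 2 * (n * (n - 1) / 2 *
       ((n - 2) * (n - 3) / 2 * (8 - 16 * p\<^sup>2)\<^sup>2 + 2 * (n - 2) * (8 - 8 * (n - 3) * p\<^sup>2)\<^sup>2))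
    \<le> cube_var p (all_arcs V) (arc_cycle_poly V)"
proof -
  let ?A = "all_arcs V"
  let ?D = "\<lambda>e. discrete_deriv e (arc_cycle_poly V)"
  note fin = finite_all_arcs[OF V(1)]
  have "(\<Sum>g\<in>?A - {e}. (cube_exp p ?A (discrete_deriv g (?D e)))\<^sup>2)
      = (n - 2) * (n - 3) / 2 * (8 - 16 * p\<^sup>2)\<^sup>2 + 2 * (n - 2) * (8 - 8 * (n - 3) * p\<^sup>2)\<^sup>2"
    if e: "e \<in> ?A" for e
  proof -
    have "(\<Sum>g\<in>?A - {e}. (cube_exp p ?A (discrete_deriv g (?D e)))\<^sup>2)
      = (\<Sum>g\<in>?A - {e}. if g \<inter> e = {} then (8 - 16 * p\<^sup>2)\<^sup>2 else (8 - 8 * (n - 3) * p\<^sup>2)\<^sup>2)"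
      by (rule sum.cong[OF refl]) (use e V in \<open>simp add: cube_exp_second_deriv_arc_cycle_poly n_def\<close>)
    then show ?thesis unfolding sum_over_other_arcs[OF V(1) e] n_def .
  qed
  then have second: "(\<Sum>e\<in>?A. \<Sum>g\<in>?A - {e}. (cube_exp p ?A (discrete_deriv g (?D e)))\<^sup>2)
      = real (card ?A) * ((n - 2) * (n - 3) / 2 * (8 - 16 * p\<^sup>2)\<^sup>2 + 2 * (n - 2) * (8 - 8 * (n - 3) * p\<^sup>2)\<^sup>2)"
    by simp
  have first: "(\<Sum>e\<in>?A. (cube_exp p ?A (?D e))\<^sup>2)
      = real (card ?A) * (4 * (n - 2) * p * ((n + 1) - 2 * (n - 3) * p\<^sup>2))\<^sup>2"
    using V cube_exp_deriv_arc_cycle_poly[OF V(1) _ V(2), folded n_def] by simp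
  show ?thesis
    using cube_var_ge_second_order[OF p fin, of "arc_cycle_poly V"]
    unfolding first second card_all_arcs[OF V(1)] n_def .
qed

section \<open>Comparison of the bounds with the claimed order\<close>

definition var_order :: "real \<Rightarrow> real \<Rightarrow> real" where
  "var_order x p = x ^ 6 * p ^ 3 * (1 - p) * (1 - sqrt 2 * p)\<^sup>2 + x ^ 5 * p ^ 3 * (1 - p) + x ^ 4 * p\<^sup>2 * (1 - p)"

lemma sqrt_two_bounds: "1.414 \<le> sqrt 2" "sqrt 2 \<le> 1.415"
  by (rule real_le_rsqrt, simp add: power2_eq_square) (rule real_le_lsqrt, simp_all add: power2_eq_square)

lemma one_minus_double_square:
  fixes p :: real
  shows "1 - 2 * p\<^sup>2 = (1 - sqrt 2 * p) * (1 + sqrt 2 * p)"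
proof -
  have "(1 - sqrt 2 * p) * (1 + sqrt 2 * p) = 1 - (sqrt 2)\<^sup>2 * p\<^sup>2"
    by (simp add: algebra_simps power2_eq_square)
  then show ?thesis by simp
qed

text \<open>The other factor \<open>1 + sqrt 2 * p\<close> lies between 1 and 2.415, and the square
  of the latter is below 6.\<close>

lemma one_minus_double_square_bounds:
  fixes p :: real
  assumes "0 < p" "p < 1"
  shows "(1 - sqrt 2 * p)\<^sup>2 \<le> (1 - 2 * p\<^sup>2)\<^sup>2" "(1 - 2 * p\<^sup>2)\<^sup>2 \<le> 6 * (1 - sqrt 2 * p)\<^sup>2"
proof -
  have "0 < sqrt 2 * p" "sqrt 2 * p \<le> 1.415 * 1"
    using assms sqrt_two_bounds by (simp, intro mult_mono) auto
  then have r: "1\<^sup>2 \<le> (1 + sqrt 2 * p)\<^sup>2" "(1 + sqrt 2 * p)\<^sup>2 \<le> 2.415\<^sup>2"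
    by (intro power_mono; simp)+
  have r': "1 \<le> (1 + sqrt 2 * p)\<^sup>2" "(1 + sqrt 2 * p)\<^sup>2 \<le> 6"
    using r by (simp_all add: power2_eq_square)
  have eq: "(1 - 2 * p\<^sup>2)\<^sup>2 = (1 + sqrt 2 * p)\<^sup>2 * (1 - sqrt 2 * p)\<^sup>2"
    unfolding one_minus_double_square power_mult_distrib by simp
  show "(1 - sqrt 2 * p)\<^sup>2 \<le> (1 - 2 * p\<^sup>2)\<^sup>2"
    unfolding eq using mult_right_mono[OF r'(1), of "(1 - sqrt 2 * p)\<^sup>2"] by simp
  show "(1 - 2 * p\<^sup>2)\<^sup>2 \<le> 6 * (1 - sqrt 2 * p)\<^sup>2"
    unfolding eq by (rule mult_right_mono[OF r'(2)]) simp
qed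

lemma arc_cycle_poly_upper_estimate:
  fixes x p :: real
  assumes p: "0 < p" "p < 1" and x: "3 \<le> x"
  shows "p * (1 - p) * (x * (x - 1) / 2 *
    ((4 * (x - 2) * p * ((x + 1) - 2 * (x - 3) * p\<^sup>2))\<^sup>2
     + p * (1 - p) * ((x - 2) * (x - 3) / 2 * (128 + 512 * p\<^sup>2) + 2 * (x - 2) * (128 + 128 * (x - 3)\<^sup>2 * p\<^sup>2))))
    \<le> 1200 * var_order x p" (is "?L \<le> _")
proof -
  define q where "q = 1 - p"
  have q: "0 < q" "q < 1" using p by (auto simp: q_def)
  let ?s = "(1 - sqrt 2 * p)\<^sup>2"
  let ?X = "(x + 1) - 2 * (x - 3) * p\<^sup>2"
  have p2: "p\<^sup>2 \<le> 1" "0 \<le> p\<^sup>2" using p by (auto simp: power_le_one)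
  \<comment> \<open>\<open>?X\<close> is regrouped as
    \<open>(x + 1) * (1 - 2 * p\<^sup>2) + 8 * p\<^sup>2\<close>. The correction is at most 8 and
    leads only to a multiple of \<open>x ^ 4 * p ^ 3\<close>, which the term with
    \<open>x ^ 5\<close> absorbs.\<close>
  have X: "?X\<^sup>2 \<le> 48 * x\<^sup>2 * ?s + 128"
  proof -
    have "?X\<^sup>2 = ((x + 1) * (1 - 2 * p\<^sup>2) + 8 * p\<^sup>2)\<^sup>2" by (simp add: algebra_simps)
    also have "\<dots> \<le> 2 * ((x + 1) * (1 - 2 * p\<^sup>2))\<^sup>2 + 2 * (8 * p\<^sup>2)\<^sup>2"
      using zero_le_power2[of "(x + 1) * (1 - 2 * p\<^sup>2) - 8 * p\<^sup>2"] by (simp add: power2_sum power2_diff)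
    also have "((x + 1) * (1 - 2 * p\<^sup>2))\<^sup>2 \<le> (2 * x)\<^sup>2 * (6 * ?s)"
      unfolding power_mult_distrib[of "x + 1"]
      using one_minus_double_square_bounds(2)[OF p] x by (intro mult_mono power_mono) auto
    also have "(8 * p\<^sup>2)\<^sup>2 \<le> 8\<^sup>2"
      using p2 by (intro power_mono) auto
    finally show ?thesis by (simp add: power_mult_distrib)
  qed
  have "(4 * (x - 2) * p * ?X)\<^sup>2 = 16 * p\<^sup>2 * ((x - 2)\<^sup>2 * ?X\<^sup>2)"
    by algebra
  also have "\<dots> \<le> 16 * p\<^sup>2 * (x\<^sup>2 * (48 * x\<^sup>2 * ?s + 128))"
    using x X by (intro mult_left_mono mult_mono power_mono) auto
  finally have first: "(4 * (x - 2) * p * ?X)\<^sup>2 \<le> 16 * p\<^sup>2 * (x\<^sup>2 * (48 * x\<^sup>2 * ?s + 128))" .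
  have "(x - 2) * (x - 3) / 2 * (128 + 512 * p\<^sup>2) \<le> x * x / 2 * 640"
    using x p2 by (intro mult_mono divide_right_mono) auto
  moreover have "2 * (x - 2) * (128 + 128 * (x - 3)\<^sup>2 * p\<^sup>2) \<le> 2 * x * (128 + 128 * x\<^sup>2 * p\<^sup>2)"
    using x p2 by (intro mult_mono add_mono mult_right_mono power_mono mult_left_mono) auto
  ultimately have second: "(x - 2) * (x - 3) / 2 * (128 + 512 * p\<^sup>2) + 2 * (x - 2) * (128 + 128 * (x - 3)\<^sup>2 * p\<^sup>2)
      \<le> x * x / 2 * 640 + 2 * x * (128 + 128 * x\<^sup>2 * p\<^sup>2)" by linarith
  have "?L \<le> p * q * (x * x / 2 * (16 * p\<^sup>2 * (x\<^sup>2 * (48 * x\<^sup>2 * ?s + 128))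
      + p * q * (x * x / 2 * 640 + 2 * x * (128 + 128 * x\<^sup>2 * p\<^sup>2))))"
    unfolding q_def[symmetric] using p q x p2 first second
    by (intro mult_mono mult_nonneg_nonneg add_nonneg_nonneg add_mono divide_right_mono order_refl) auto
  also have "\<dots> = 384 * (x ^ 6 * p ^ 3 * q * ?s) + 1024 * (x ^ 4 * (p ^ 3 * q)) + 160 * (x ^ 4 * p\<^sup>2 * q) * q
      + 128 * (x ^ 3 * (p\<^sup>2 * q)) * q + 128 * (x ^ 5 * p ^ 3 * q) * (p * q)"
    by (simp add: algebra_simps eval_nat_numeral)
  also have "\<dots> \<le> 384 * (x ^ 6 * p ^ 3 * q * ?s) + 1024 * (x ^ 5 * (p ^ 3 * q)) + 160 * (x ^ 4 * p\<^sup>2 * q) * 1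
      + 128 * (x ^ 4 * (p\<^sup>2 * q)) * 1 + 128 * (x ^ 5 * p ^ 3 * q) * 1"
  proof -
    have "x ^ 4 \<le> x ^ 5" "x ^ 3 \<le> x ^ 4" using x by (auto intro: power_increasing)
    moreover have "p * q \<le> 1" using p q by (simp add: mult_le_one)
    ultimately show ?thesis
      using p q x by (intro add_mono mult_mono order_refl) auto
  qed
  \<comment> \<open>The collected coefficients are 384, 1152 and 288.\<close>
  also have "\<dots> \<le> 1200 * var_order x p"
  proof -
    have "384 * t1 + 1024 * t2 + 160 * t3 * 1 + 128 * t3 * 1 + 128 * t2 * 1 \<le> 1200 * (t1 + t2 + t3)"
      if "0 \<le> t1" "0 \<le> t2" "0 \<le> t3" for t1 t2 t3 :: real
      using that by simp
    moreover have "0 \<le> x ^ 6 * p ^ 3 * q * ?s" "0 \<le> x ^ 5 * p ^ 3 * q" "0 \<le> x ^ 4 * p\<^sup>2 * q"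
      using p q x by auto
    ultimately show ?thesis unfolding var_order_def q_def[symmetric] mult.assoc[of _ "p ^ 3" q, symmetric]
        mult.assoc[of _ "p\<^sup>2" q, symmetric] by blast
  qed
  finally show ?thesis .
qed

text \<open>Up to constants, the two terms are the summands of \<open>var_order\<close> with
  \<open>x ^ 4\<close> and \<open>x ^ 5\<close>, each divided by \<open>x\<close>.\<close>

lemma shortcut_estimate:
  fixes x p :: real
  assumes p: "0 < p" "p < 1" and x: "0 < x"
  shows "p * (1 - p) * (x\<^sup>2 * (100 * (x * p + 2 * (x * p)\<^sup>2))) \<le> 200 / x * var_order x p"
proof -
  define q where "q = 1 - p"
  have q: "0 < q" using p by (auto simp: q_def)
  have "p * q * (x\<^sup>2 * (100 * (x * p + 2 * (x * p)\<^sup>2))) = 100 / x * (x ^ 4 * p\<^sup>2 * q) + 200 / x * (x ^ 5 * p ^ 3 * q)"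
    using x by (simp add: field_simps eval_nat_numeral)
  also have "\<dots> \<le> 200 / x * (x ^ 6 * p ^ 3 * q * (1 - sqrt 2 * p)\<^sup>2) + 200 / x * (x ^ 4 * p\<^sup>2 * q) + 200 / x * (x ^ 5 * p ^ 3 * q)"
  proof -
    have "0 \<le> 200 / x * (x ^ 6 * p ^ 3 * q * (1 - sqrt 2 * p)\<^sup>2)" using p q x by auto
    moreover have "100 / x * (x ^ 4 * p\<^sup>2 * q) \<le> 200 / x * (x ^ 4 * p\<^sup>2 * q)"
      using p q x by (intro mult_right_mono divide_right_mono) auto
    ultimately show ?thesis by linarith
  qed
  also have "\<dots> = 200 / x * var_order x p"
    unfolding var_order_def q_def[symmetric] by (simp add: algebra_simps)
  finally show ?thesis unfolding q_def .
qed

text \<open>Away from \<open>p = 1 / sqrt 2\<close> the first derivatives pay for \<open>a\<close>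
  and \<open>b\<close>, and either they or the disjoint pairs pay for \<open>c\<close>. Near it the
  adjacent pairs pay for \<open>b\<close>, which dominates \<open>c\<close> and also covers the loss
  in the estimate of \<open>a\<close>.\<close>

lemma arc_cycle_poly_lower_estimate:
  fixes x p :: real
  assumes p: "0 < p" "p < 1" and x: "8000 \<le> x"
  shows "var_order x p \<le> 1000 * (p * (1 - p) * (x * (x - 1) / 2 * (4 * (x - 2) * p * ((x + 1) - 2 * (x - 3) * p\<^sup>2))\<^sup>2)
    + (p * (1 - p))\<^sup>2 / 2 * (x * (x - 1) / 2 *
       ((x - 2) * (x - 3) / 2 * (8 - 16 * p\<^sup>2)\<^sup>2 + 2 * (x - 2) * (8 - 8 * (x - 3) * p\<^sup>2)\<^sup>2)))"
    (is "_ \<le> 1000 * ?L")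
proof -
  define q where "q = 1 - p"
  have q: "0 < q" "q < 1" using p by (auto simp: q_def)
  let ?s = "1 - sqrt 2 * p"
  let ?X = "(x + 1) - 2 * (x - 3) * p\<^sup>2"
  define a where "a = x ^ 6 * p ^ 3 * q * ?s\<^sup>2"
  define b where "b = x ^ 5 * p ^ 3 * q"
  define c where "c = x ^ 4 * p\<^sup>2 * q"
  have pos: "0 \<le> a" "0 \<le> b" "0 \<le> c" using p q x by (auto simp: a_def b_def c_def)
  have goal: "var_order x p = a + b + c"
    unfolding var_order_def a_def b_def c_def q_def ..
  have p2: "p\<^sup>2 \<le> 1" "0 \<le> p\<^sup>2" using p by (auto simp: power_le_one)
  have s2: "?s\<^sup>2 \<le> (1 - 2 * p\<^sup>2)\<^sup>2" by (rule one_minus_double_square_bounds[OF p])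
  \<comment> \<open>The contributions of first derivatives, disjoint pairs and adjacent pairs, with
    the outer factors \<open>x - 1\<close>, \<open>x - 2\<close> and \<open>x - 3\<close> lowered to
    \<open>x / 2\<close>.\<close>
  define L1 where "L1 = x ^ 4 * p ^ 3 * q * ?X\<^sup>2"
  define L2 where "L2 = p\<^sup>2 * q\<^sup>2 * x ^ 4 * (1 - 2 * p\<^sup>2)\<^sup>2"
  define L3 where "L3 = 8 * p\<^sup>2 * q\<^sup>2 * x ^ 3 * (1 - (x - 3) * p\<^sup>2)\<^sup>2"
  have Lpos: "0 \<le> L1" "0 \<le> L2" "0 \<le> L3" using p q x by (auto simp: L1_def L2_def L3_def)
  have L: "L1 + L2 + L3 \<le> ?L"
  proof -
    have N: "x * (x / 2) / 2 \<le> x * (x - 1) / 2" using x by (intro divide_right_mono mult_left_mono) auto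
    have "L1 = p * q * (x * (x / 2) / 2 * (16 * p\<^sup>2 * ((x / 2)\<^sup>2 * ?X\<^sup>2)))"
      by (simp add: L1_def eval_nat_numeral)
    also have "\<dots> \<le> p * q * (x * (x - 1) / 2 * (16 * p\<^sup>2 * ((x - 2)\<^sup>2 * ?X\<^sup>2)))"
      using p q x N by (intro mult_mono mult_nonneg_nonneg power_mono order_refl) auto
    also have "16 * p\<^sup>2 * ((x - 2)\<^sup>2 * ?X\<^sup>2) = (4 * (x - 2) * p * ?X)\<^sup>2"
      by algebra
    finally have 1: "L1 \<le> p * q * (x * (x - 1) / 2 * (4 * (x - 2) * p * ?X)\<^sup>2)" .
    have "L2 + L3 = (p * q)\<^sup>2 / 2 * (x * (x / 2) / 2 * (x / 2 * (x / 2) / 2 * (64 * (1 - 2 * p\<^sup>2)\<^sup>2)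
        + 2 * (x / 2) * (64 * (1 - (x - 3) * p\<^sup>2)\<^sup>2)))"
      by (simp add: L2_def L3_def eval_nat_numeral field_simps)
    also have "\<dots> \<le> (p * q)\<^sup>2 / 2 * (x * (x - 1) / 2 * ((x - 2) * (x - 3) / 2 * (64 * (1 - 2 * p\<^sup>2)\<^sup>2)
        + 2 * (x - 2) * (64 * (1 - (x - 3) * p\<^sup>2)\<^sup>2)))"
      using p q x N
      by (intro mult_mono add_mono mult_nonneg_nonneg add_nonneg_nonneg divide_right_mono order_refl) auto
    also have "64 * (1 - 2 * p\<^sup>2)\<^sup>2 = (8 - 16 * p\<^sup>2)\<^sup>2" by (simp add: power2_eq_square algebra_simps)
    also have "64 * (1 - (x - 3) * p\<^sup>2)\<^sup>2 = (8 - 8 * (x - 3) * p\<^sup>2)\<^sup>2"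
      by (simp add: power2_eq_square algebra_simps)
    finally have 2: "L2 + L3 \<le> (p * q)\<^sup>2 / 2 * (x * (x - 1) / 2 * ((x - 2) * (x - 3) / 2 * (8 - 16 * p\<^sup>2)\<^sup>2
        + 2 * (x - 2) * (8 - 8 * (x - 3) * p\<^sup>2)\<^sup>2))" .
    show ?thesis using add_mono[OF 1 2] unfolding q_def add.assoc[of L1] .
  qed
  \<comment> \<open>Within distance 1/10 of the zero of \<open>?s\<close>, \<open>p\<close> lies
    between 0.6 and 0.8, so neither \<open>p\<close> nor \<open>q\<close> is small.\<close>
  have "a + b + c \<le> 1000 * (L1 + L2 + L3)"
  proof (cases "1 / 10 \<le> \<bar>?s\<bar>")
    case True
    then have "(1 / 10)\<^sup>2 \<le> \<bar>?s\<bar>\<^sup>2" by (intro power_mono) auto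
    then have s: "1 / 100 \<le> ?s\<^sup>2" by (simp add: power2_eq_square)
    have "x / 2 * \<bar>?s\<bar> \<le> \<bar>?X\<bar>"
    proof -
      have "\<bar>?s\<bar> \<le> \<bar>1 - 2 * p\<^sup>2\<bar>" using s2 by (simp add: abs_le_square_iff)
      then have "(x + 1) * \<bar>?s\<bar> \<le> \<bar>(x + 1) * (1 - 2 * p\<^sup>2)\<bar>"
        using x by (simp add: abs_mult mult_left_mono)
      moreover have "?X = (x + 1) * (1 - 2 * p\<^sup>2) + 8 * p\<^sup>2" by (simp add: algebra_simps)
      \<comment> \<open>The main part is at least 800, so the correction of at most 8 costs less
        than half of it.\<close>
      moreover have "8000 * (1 / 10) \<le> x * \<bar>?s\<bar>" using x True by (intro mult_mono) auto
      moreover have "(x + 1) * \<bar>?s\<bar> = x * \<bar>?s\<bar> + \<bar>?s\<bar>" by (simp add: algebra_simps)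
      ultimately show ?thesis using p2 by linarith
    qed
    then have "(x / 2 * \<bar>?s\<bar>)\<^sup>2 \<le> \<bar>?X\<bar>\<^sup>2" using x by (intro power_mono) auto
    then have "x\<^sup>2 * ?s\<^sup>2 / 4 \<le> ?X\<^sup>2" by (simp add: power_mult_distrib power_divide)
    then have "x ^ 4 * p ^ 3 * q * (x\<^sup>2 * ?s\<^sup>2 / 4) \<le> L1"
      unfolding L1_def using p q x by (intro mult_left_mono) auto
    then have aL: "a \<le> 4 * L1" by (simp add: a_def eval_nat_numeral mult_ac)
    have x6: "x ^ 6 * p ^ 3 * q \<le> 100 * a"
      using mult_left_mono[OF s, of "x ^ 6 * p ^ 3 * q"] p q x by (simp add: a_def)
    have "b \<le> x ^ 6 * p ^ 3 * q"
      unfolding b_def using p q x by (intro mult_right_mono power_increasing) auto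
    then have b: "b \<le> 100 * a" using x6 by linarith
    \<comment> \<open>Above density \<open>1 / x\<^sup>2\<close> the term \<open>c\<close> is at
      most \<open>x ^ 6 * p ^ 3 * q\<close>. Below it \<open>q\<close> is at least 1/2, and the
      disjoint pairs in \<open>L2\<close> reach \<open>c\<close>.\<close>
    show ?thesis
    proof (cases "1 \<le> x\<^sup>2 * p")
      case True
      have "c * 1 \<le> c * (x\<^sup>2 * p)" using True pos(3) by (intro mult_left_mono) auto
      also have "\<dots> = x ^ 6 * p ^ 3 * q" by (simp add: c_def eval_nat_numeral)
      finally have "c \<le> 100 * a" using x6 by linarith
      then show ?thesis using b aL Lpos by argo
    next
      case False
      have "2 * p \<le> x\<^sup>2 * p"
      proof (rule mult_right_mono)
        have "2 * 1 \<le> x * x" using x by (intro mult_mono) auto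
        then show "2 \<le> x\<^sup>2" by (simp add: power2_eq_square)
      qed (use p in auto)
      then have "1 / 2 \<le> q" using False by (simp add: q_def)
      then have "1 / 2 * (1 / 100) \<le> q * (1 - 2 * p\<^sup>2)\<^sup>2"
        using s s2 q by (intro mult_mono) auto
      then have "c * (1 / 200) \<le> c * (q * (1 - 2 * p\<^sup>2)\<^sup>2)" using pos(3) by (intro mult_left_mono) auto
      also have "\<dots> = L2" by (simp add: c_def L2_def power2_eq_square)
      finally show ?thesis using b aL Lpos by argo
    qed
  next
    case False
    have pb: "0.6 \<le> p" "p \<le> 0.8"
    proof -
      have "0.9 \<le> sqrt 2 * p" "sqrt 2 * p \<le> 1.1" using False by (auto simp: abs_if split: if_splits)
      moreover have "sqrt 2 * p \<le> 1.415 * p" "1.414 * p \<le> sqrt 2 * p"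
        using sqrt_two_bounds p by (intro mult_right_mono; simp)+
      ultimately have "0.9 \<le> 1.415 * p" "1.414 * p \<le> 1.1" by (meson order_trans)+
      then show "0.6 \<le> p" "p \<le> 0.8" by simp_all
    qed
    have "x\<^sup>2 * ?s\<^sup>2 / 2 - 64 \<le> ?X\<^sup>2"
    proof -
      \<comment> \<open>Main part and correction may cancel here; this lower bound survives, since
        twice the difference of the sides is \<open>(u + 2 * v)\<^sup>2\<close>.\<close>
      have half: "u\<^sup>2 / 2 - v\<^sup>2 \<le> (u + v)\<^sup>2" for u v :: real
        using zero_le_power2[of "u + 2 * v"] by (simp add: power2_sum power_mult_distrib)
      have "x\<^sup>2 * ?s\<^sup>2 \<le> (x + 1)\<^sup>2 * (1 - 2 * p\<^sup>2)\<^sup>2"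
        by (rule mult_mono[OF _ s2]) (use x in \<open>auto intro: power_mono\<close>)
      then have "x\<^sup>2 * ?s\<^sup>2 / 2 \<le> ((x + 1) * (1 - 2 * p\<^sup>2))\<^sup>2 / 2" by (simp add: power_mult_distrib)
      moreover have "(8 * p\<^sup>2)\<^sup>2 \<le> 8\<^sup>2" using p2 by (intro power_mono) auto
      moreover have "?X = (x + 1) * (1 - 2 * p\<^sup>2) + 8 * p\<^sup>2" by (simp add: algebra_simps)
      ultimately show ?thesis using half[of "(x + 1) * (1 - 2 * p\<^sup>2)" "8 * p\<^sup>2"] by simp
    qed
    then have "x ^ 4 * p ^ 3 * q * (x\<^sup>2 * ?s\<^sup>2 / 2 - 64) \<le> L1"
      unfolding L1_def using p q x by (intro mult_left_mono) auto
    then have L1: "a / 2 - 64 * (x ^ 4 * p ^ 3 * q) \<le> L1" by (simp add: a_def eval_nat_numeral algebra_simps)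
    \<comment> \<open>The loss \<open>64 * (x ^ 4 * p ^ 3 * q)\<close> is thus at most
      \<open>8 / 1000 * b\<close>.\<close>
    have x4: "8000 * (x ^ 4 * p ^ 3 * q) \<le> b"
    proof -
      have "8000 * (x ^ 4 * p ^ 3 * q) \<le> x * (x ^ 4 * p ^ 3 * q)" using p q x by (intro mult_right_mono) auto
      also have "\<dots> = b" by (simp add: b_def eval_nat_numeral)
      finally show ?thesis .
    qed
    \<comment> \<open>As \<open>p\<close> is at least 0.6, the mean second derivative along adjacent
      arcs has order \<open>x\<close>. One factor \<open>q\<close> of \<open>L3\<close> is kept and
      the other is at least 0.2, which turns 0.08 into 16/1000.\<close>
    have L3: "16 * b \<le> 1000 * L3"
    proof -
      have "0.6\<^sup>2 \<le> p\<^sup>2" using pb by (intro power_mono) auto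
      then have "0.36 \<le> p\<^sup>2" by (simp add: power2_eq_square)
      then have "(x - 3) * 0.36 \<le> (x - 3) * p\<^sup>2" using x by (intro mult_left_mono) auto
      then have "x / 10 \<le> (x - 3) * p\<^sup>2 - 1" using x by simp
      then have "(x / 10)\<^sup>2 \<le> ((x - 3) * p\<^sup>2 - 1)\<^sup>2" using x by (intro power_mono) auto
      then have "x\<^sup>2 / 100 \<le> (1 - (x - 3) * p\<^sup>2)\<^sup>2" by (simp add: power_divide power2_commute)
      then have L3: "8 * p\<^sup>2 * q\<^sup>2 * x ^ 3 * (x\<^sup>2 / 100) \<le> L3"
        unfolding L3_def using p q x by (intro mult_left_mono) auto
      have "x ^ 5 * p\<^sup>2 * q * p \<le> x ^ 5 * p\<^sup>2 * q * 1"
        using p q x by (intro mult_left_mono) auto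
      then have "16 / 1000 * b \<le> 0.08 * (x ^ 5 * p\<^sup>2 * q) * 0.2" by (simp add: b_def eval_nat_numeral mult_ac)
      also have "\<dots> \<le> 0.08 * (x ^ 5 * p\<^sup>2 * q) * q"
        using p q x pb by (intro mult_left_mono) (auto simp: q_def)
      also have "\<dots> = 8 * p\<^sup>2 * q\<^sup>2 * x ^ 3 * (x\<^sup>2 / 100)"
        by (simp add: eval_nat_numeral)
      finally show ?thesis using L3 by linarith
    qed
    have c: "c \<le> b"
    proof -
      have "2 * 0.6 \<le> x * p" using x pb by (intro mult_mono) auto
      then have "c * 1 \<le> c * (x * p)" using pos(3) by (intro mult_left_mono) auto
      also have "\<dots> = b" by (simp add: c_def b_def eval_nat_numeral)
      finally show ?thesis by simp
    qed
    \<comment> \<open>Of the \<open>16 * b\<close> supplied by \<open>L3\<close>, half pays for this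
      loss and the rest covers \<open>b + c\<close>.\<close>
    have "500 * a - 8 * b \<le> 1000 * L1" using L1 x4 by simp
    then have "500 * a + 8 * b \<le> 1000 * L1 + 1000 * L3" using L3 by linarith
    then have "a + b + c \<le> 1000 * L1 + 1000 * L3" using c pos by linarith
    then show ?thesis using Lpos(2) by simp
  qed
  then show ?thesis unfolding goal by (rule order_trans[OF _ mult_left_mono[OF L]]) simp
qed

section \<open>Uniform bounds for the number of edges\<close>

lemma variance_num_edges_eq:
  assumes "0 < p" "p < 1"
  shows "variance_num_edges n p = cube_var p (all_arcs {1..n})
    (\<lambda>S. 1 / 2 * arc_cycle_poly {1..n} S + (- 1) * real (card (shortcut_paths S)))"
proof -
  let ?A = "all_arcs {1..n}"
  have exp: "measure_pmf.expectation (erdos_renyi n p) g = cube_exp p ?A g" for g :: "_ \<Rightarrow> real"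
    unfolding erdos_renyi_def using assms finite_all_arcs[of "{1..n}"]
    by (intro expectation_random_subset) auto
  have "variance_num_edges n p = cube_var p ?A (num_edges n)"
    unfolding variance_num_edges_def cube_var_def exp ..
  also have "\<dots> = cube_var p ?A (\<lambda>S. 1 / 2 * arc_cycle_poly {1..n} S + (- 1) * real (card (shortcut_paths S)))"
    by (rule cube_var_cong) (simp only: num_edges_eq arc_cycle_poly_eq[OF finite_atLeastAtMost])
  finally show ?thesis .
qed

theorem variance_num_edges_bounds:
  assumes p: "0 < p" "p < 1" and n: "n \<ge> 3200000"
  shows "var_order (real n) p / 16000 \<le> variance_num_edges n p"
    and "variance_num_edges n p \<le> 1000 * var_order (real n) p"
proof -
  let ?V = "{1..n}"
  let ?A = "all_arcs ?V"
  let ?Z = "\<lambda>S :: nat set set. real (card (shortcut_paths S))"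
  let ?F = "arc_cycle_poly ?V"
  let ?K = "\<lambda>S. 1 / 2 * ?F S + (- 1) * ?Z S"
  let ?T = "var_order (real n) p"
  have p': "0 \<le> p" "p \<le> 1" using p by auto
  have V: "finite ?V" "card ?V \<ge> 3" "card ?V \<ge> 2" "real (card ?V) = real n" using n by auto
  have T: "0 \<le> ?T" using p by (simp add: var_order_def)
  have n': "3 \<le> real n" "8000 \<le> real n" "0 < real n" using n by auto
  have F_le: "cube_var p ?A ?F \<le> 1200 * ?T"
    by (rule order_trans[OF cube_var_arc_cycle_poly_le[OF p' V(1,2), unfolded V(4)] arc_cycle_poly_upper_estimate[OF p n'(1)]])
  have F_ge: "?T \<le> 1000 * cube_var p ?A ?F"
    by (rule order_trans[OF arc_cycle_poly_lower_estimate[OF p n'(2)]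
        mult_left_mono[OF cube_var_arc_cycle_poly_ge[OF p' V(1,2), unfolded V(4)]]]) simp
  \<comment> \<open>From n = 3200000 on, \<open>200 / real n\<close> is at most 1/16000.\<close>
  have Z: "cube_var p ?A ?Z \<le> ?T / 16000"
  proof -
    have "cube_var p ?A ?Z \<le> 200 / real n * ?T"
      by (rule order_trans[OF cube_var_shortcut_paths_le[OF p' V(1,3), unfolded V(4)] shortcut_estimate[OF p n'(3)]])
    also have "\<dots> \<le> 1 / 16000 * ?T"
      using T n by (intro mult_right_mono) (auto simp: field_simps)
    finally show ?thesis by simp
  qed
  have "cube_var p ?A ?K \<le> 2 * cube_var p ?A (\<lambda>S. 1 / 2 * ?F S) + 2 * cube_var p ?A (\<lambda>S. (- 1) * ?Z S)"
    by (rule cube_var_add_le[OF p'])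
  also have "\<dots> = cube_var p ?A ?F / 2 + 2 * cube_var p ?A ?Z"
    unfolding cube_var_cmult by (simp add: power2_eq_square)
  finally show "variance_num_edges n p \<le> 1000 * ?T"
    unfolding variance_num_edges_eq[OF p] using F_le Z T by linarith
  \<comment> \<open>The polynomial is recovered from the edge and shortcut counts. Of
    \<open>?T / 1000\<close> at most \<open>8 * ?T / 16000\<close>, which is one half, goes to the
    shortcuts; so 8 times the variance of \<open>?K\<close> is at least
    \<open>?T / 2000\<close>.\<close>
  have "cube_var p ?A ?F = cube_var p ?A (\<lambda>S. 2 * ?K S + 2 * ?Z S)" by simp
  also have "\<dots> \<le> 2 * cube_var p ?A (\<lambda>S. 2 * ?K S) + 2 * cube_var p ?A (\<lambda>S. 2 * ?Z S)"
    by (rule cube_var_add_le[OF p'])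
  also have "\<dots> = 8 * cube_var p ?A ?K + 8 * cube_var p ?A ?Z"
    unfolding cube_var_cmult by simp
  finally show "?T / 16000 \<le> variance_num_edges n p"
    unfolding variance_num_edges_eq[OF p] using F_ge Z T by linarith
qed


section \<open>Asymptotics\<close>

lemma asymp_dominates_iff: "a \<ggreater> b \<longleftrightarrow> filterlim (\<lambda>n. \<bar>a n / b n\<bar>) at_top sequentially"
proof -
  have "liminf (\<lambda>n. ereal \<bar>a n / b n\<bar>) = \<infinity> \<longleftrightarrow> (\<lambda>n. ereal \<bar>a n / b n\<bar>) \<longlonglongrightarrow> \<infinity>"
  proof
    assume inf: "liminf (\<lambda>n. ereal \<bar>a n / b n\<bar>) = \<infinity>"
    then have "limsup (\<lambda>n. ereal \<bar>a n / b n\<bar>) = \<infinity>"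
      using Liminf_le_Limsup[of sequentially "\<lambda>n. ereal \<bar>a n / b n\<bar>"] by simp
    with inf show "(\<lambda>n. ereal \<bar>a n / b n\<bar>) \<longlonglongrightarrow> \<infinity>"
      by (intro Liminf_eq_Limsup) auto
  qed (auto intro: lim_imp_Liminf)
  then show ?thesis
    unfolding asymp_dominates_def by (simp add: tendsto_PInfty_eq_at_top)
qed

lemma asymp_boundedE:
  fixes a b :: "nat \<Rightarrow> real"
  assumes "a \<lesssim> b"
  obtains C where "eventually (\<lambda>n. \<bar>a n / b n\<bar> \<le> C) sequentially"
proof -
  obtain C where "limsup (\<lambda>n. ereal \<bar>a n / b n\<bar>) < ereal C"
    using assms ereal_dense2 unfolding asymp_bounded_def by blast
  then have "eventually (\<lambda>n. ereal \<bar>a n / b n\<bar> < ereal C) sequentially"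
    by (rule Limsup_lessD)
  then have "eventually (\<lambda>n. \<bar>a n / b n\<bar> \<le> C) sequentially"
    by (rule eventually_mono) simp
  then show thesis by (rule that)
qed

lemma asymp_orderI:
  assumes "0 < c" "eventually (\<lambda>n. 0 < b n \<and> c * b n \<le> a n \<and> a n \<le> C * b n) sequentially"
  shows "a \<simeq> b"
proof -
  have ev: "eventually (\<lambda>n. ereal c \<le> ereal \<bar>a n / b n\<bar> \<and> ereal \<bar>a n / b n\<bar> \<le> ereal C) sequentially"
    using assms(2)
  proof (rule eventually_mono)
    fix n assume n: "0 < b n \<and> c * b n \<le> a n \<and> a n \<le> C * b n"
    then have "0 < c * b n" using assms(1) by simp
    then have "0 \<le> a n" using n by linarith
    then show "ereal c \<le> ereal \<bar>a n / b n\<bar> \<and> ereal \<bar>a n / b n\<bar> \<le> ereal C"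
      using n by (simp add: field_simps)
  qed
  have "ereal c \<le> liminf (\<lambda>n. ereal \<bar>a n / b n\<bar>)"
    by (rule Liminf_bounded) (use ev in \<open>auto elim: eventually_mono\<close>)
  moreover have "limsup (\<lambda>n. ereal \<bar>a n / b n\<bar>) \<le> ereal C"
    by (rule Limsup_bounded) (use ev in \<open>auto elim: eventually_mono\<close>)
  ultimately show ?thesis
    unfolding asymp_order_def using assms(1)
    by (auto intro: Liminf_le_Limsup less_le_trans[of 0 "ereal c"] le_less_trans)
qed

section \<open>Size of the order in the different ranges of the density\<close>

lemma one_minus_sqrt_two_mult_square_le:
  assumes "0 < p" "p < 1"
  shows "(1 - sqrt 2 * p)\<^sup>2 \<le> 1"
proof -
  have "0 < sqrt 2 * p" "sqrt 2 * p \<le> 1.415 * 1"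
    using assms sqrt_two_bounds by (simp, intro mult_mono) auto
  then have "\<bar>1 - sqrt 2 * p\<bar> \<le> 1" by auto
  then show ?thesis by (simp add: abs_square_le_1)
qed

text \<open>For the necessity of the two conditions for divergence: the order stays bounded as long
  as \<open>x\<^sup>2 * p\<close> or \<open>x ^ 6 * (1 - p)\<close> does.\<close>

lemma var_order_le:
  assumes p: "0 < p" "p < 1" and x: "1 \<le> x"
  shows "var_order x p \<le> 2 * (x\<^sup>2 * p) ^ 3 + (x\<^sup>2 * p)\<^sup>2"
    and "var_order x p \<le> 3 * (x ^ 6 * (1 - p))"
proof -
  let ?q = "1 - p"
  note s = one_minus_sqrt_two_mult_square_le[OF p]
  have x5: "x ^ 5 \<le> x ^ 6" "x ^ 4 \<le> x ^ 6" using x by (auto intro: power_increasing)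
  have "x ^ 6 * p ^ 3 * ?q * (1 - sqrt 2 * p)\<^sup>2 \<le> x ^ 6 * p ^ 3 * 1 * 1"
    using p x s by (intro mult_mono mult_nonneg_nonneg order_refl) auto
  moreover have "x ^ 5 * p ^ 3 * ?q \<le> x ^ 6 * p ^ 3 * 1"
    using p x x5 by (intro mult_mono order_refl) auto
  moreover have "x ^ 4 * p\<^sup>2 * ?q \<le> x ^ 4 * p\<^sup>2 * 1"
    using p x by (intro mult_mono order_refl) auto
  moreover have "(x\<^sup>2 * p) ^ 3 = x ^ 6 * p ^ 3" "(x\<^sup>2 * p)\<^sup>2 = x ^ 4 * p\<^sup>2"
    by (simp_all add: power_mult_distrib flip: power_mult)
  ultimately show "var_order x p \<le> 2 * (x\<^sup>2 * p) ^ 3 + (x\<^sup>2 * p)\<^sup>2"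
    unfolding var_order_def by linarith
  have p3: "p ^ 3 \<le> 1" "p\<^sup>2 \<le> 1" using p by (auto simp: power_le_one)
  have "x ^ 6 * p ^ 3 * ?q * (1 - sqrt 2 * p)\<^sup>2 \<le> x ^ 6 * 1 * ?q * 1"
    using p x s p3 by (intro mult_mono mult_nonneg_nonneg order_refl) auto
  moreover have "x ^ 5 * p ^ 3 * ?q \<le> x ^ 6 * 1 * ?q"
    using p x x5 p3 by (intro mult_mono order_refl) auto
  moreover have "x ^ 4 * p\<^sup>2 * ?q \<le> x ^ 6 * 1 * ?q"
    using p x x5 p3 by (intro mult_mono order_refl) auto
  ultimately show "var_order x p \<le> 3 * (x ^ 6 * (1 - p))"
    unfolding var_order_def by linarith
qed

text \<open>For their sufficiency. Each range of \<open>p\<close> relies on another summand: near 1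
  the first, whose square factor is at least 0.04; between 0.5 and 0.9, where that factor vanishes
  at 1 / sqrt 2, the second; below 0.5 the third.\<close>

lemma var_order_ge:
  assumes p: "0 < p" "p < 1" and x: "1 \<le> x"
    and M: "0 \<le> M" "M \<le> x" "M \<le> x\<^sup>2 * p" "M \<le> x ^ 6 * (1 - p)" and "1 \<le> M"
  shows "M / 100 \<le> var_order x p"
proof -
  let ?q = "1 - p"
  have pos: "0 \<le> x ^ 6 * p ^ 3 * ?q * (1 - sqrt 2 * p)\<^sup>2" "0 \<le> x ^ 5 * p ^ 3 * ?q" "0 \<le> x ^ 4 * p\<^sup>2 * ?q"
    using p x by auto
  consider "0.9 \<le> p" | "0.5 \<le> p" "p \<le> 0.9" | "p \<le> 0.5" by linarith
  then show ?thesis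
  proof cases
    case 1
    have "1.414 * 0.9 \<le> sqrt 2 * p" using 1 sqrt_two_bounds by (intro mult_mono) auto
    then have "0.2\<^sup>2 \<le> (sqrt 2 * p - 1)\<^sup>2" by (intro power_mono) auto
    then have s: "0.04 \<le> (1 - sqrt 2 * p)\<^sup>2"
      unfolding power2_commute[of "sqrt 2 * p" 1] by (simp add: power2_eq_square)
    have "0.9 ^ 3 \<le> p ^ 3" using 1 by (intro power_mono) auto
    then have p3: "0.7 \<le> p ^ 3" by (simp add: power3_eq_cube)
    have "M * 0.7 * 0.04 \<le> x ^ 6 * ?q * p ^ 3 * (1 - sqrt 2 * p)\<^sup>2"
      using M(4) p3 s p x M(1) by (intro mult_mono mult_nonneg_nonneg) auto
    also have "\<dots> = x ^ 6 * p ^ 3 * ?q * (1 - sqrt 2 * p)\<^sup>2" by simp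
    finally have "M / 100 \<le> x ^ 6 * p ^ 3 * ?q * (1 - sqrt 2 * p)\<^sup>2" using M(1) by simp
    then show ?thesis using pos unfolding var_order_def by linarith
  next
    case 2
    have "0.5 ^ 3 \<le> p ^ 3" using 2 by (intro power_mono) auto
    then have p3: "0.1 \<le> p ^ 3" by (simp add: power3_eq_cube)
    have "x ^ 1 \<le> x ^ 5" using x by (intro power_increasing) auto
    then have "M \<le> x ^ 5" using M(2) by simp
    then have "M * 0.1 * 0.1 \<le> x ^ 5 * p ^ 3 * ?q"
      using p3 2 x M(1) by (intro mult_mono mult_nonneg_nonneg) auto
    then have "M / 100 \<le> x ^ 5 * p ^ 3 * ?q" by simp
    then show ?thesis using pos unfolding var_order_def by linarith
  next
    case 3
    have "M * 1 \<le> (x\<^sup>2 * p) * (x\<^sup>2 * p)" using M assms(8) by (intro mult_mono) auto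
    then have "M * 0.5 \<le> ((x\<^sup>2 * p) * (x\<^sup>2 * p)) * ?q" using 3 M(1) by (intro mult_mono) auto
    also have "\<dots> = x ^ 4 * p\<^sup>2 * ?q" by (simp add: eval_nat_numeral)
    finally have "M / 100 \<le> x ^ 4 * p\<^sup>2 * ?q" using M(1) by simp
    then show ?thesis using pos unfolding var_order_def by linarith
  qed
qed

lemma var_order_pos:
  assumes "0 < p" "p < 1" "0 < x"
  shows "0 < var_order x p"
  unfolding var_order_def using assms by (intro add_nonneg_pos) auto

text \<open>The factor \<open>x\<^sup>2 * p\<close> turns the third summand into the first one
  without its square, which is at least 1/25 for \<open>p\<close> up to 1/2. For larger
  \<open>p\<close> the factor \<open>x * p\<close>, at least 1, turns it into the second.\<close>

lemma var_order_dense: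
  assumes p: "0 < p" "p < 1" and x: "2 \<le> x" and xp: "1 \<le> x\<^sup>2 * p"
  shows "x ^ 4 * p\<^sup>2 * (1 - p) \<le>
    100 * (x ^ 6 * p ^ 3 * (1 - p) * (1 - sqrt 2 * p)\<^sup>2 + x ^ 5 * p ^ 3 * (1 - p))"
proof -
  let ?c = "x ^ 4 * p\<^sup>2 * (1 - p)"
  have c: "0 \<le> ?c" using p x by auto
  have pos: "0 \<le> x ^ 6 * p ^ 3 * (1 - p) * (1 - sqrt 2 * p)\<^sup>2" "0 \<le> x ^ 5 * p ^ 3 * (1 - p)"
    using p x by auto
  show ?thesis
  proof (cases "p \<le> 1 / 2")
    case True
    have "sqrt 2 * p \<le> 1.415 * (1 / 2)" using True p sqrt_two_bounds by (intro mult_mono) auto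
    then have "(1 / 5)\<^sup>2 \<le> (1 - sqrt 2 * p)\<^sup>2" by (intro power_mono) auto
    then have s: "1 / 25 \<le> (1 - sqrt 2 * p)\<^sup>2" by (simp add: power2_eq_square)
    have "?c * 1 \<le> ?c * (x\<^sup>2 * p)" by (rule mult_left_mono[OF xp c])
    also have "\<dots> = x ^ 6 * p ^ 3 * (1 - p)" by (simp add: eval_nat_numeral)
    finally have "?c \<le> x ^ 6 * p ^ 3 * (1 - p)" by simp
    from mult_mono[OF this s] have "?c * (1 / 25) \<le> x ^ 6 * p ^ 3 * (1 - p) * (1 - sqrt 2 * p)\<^sup>2"
      using p x by auto
    then show ?thesis using pos by simp
  next
    case False
    have "2 * (1 / 2) \<le> x * p" using False x by (intro mult_mono) auto
    then have "?c * 1 \<le> ?c * (x * p)" using c by (intro mult_left_mono) auto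
    also have "\<dots> = x ^ 5 * p ^ 3 * (1 - p)" by (simp add: eval_nat_numeral)
    finally show ?thesis using pos by simp
  qed
qed

theorem theorem3p3:
  fixes p :: "nat \<Rightarrow> real"
  assumes "\<And>n. n \<ge> 1 \<Longrightarrow> 0 < p n \<and> p n < 1"
  shows
    "(\<lambda>n. variance_num_edges n (p n)) \<simeq>
       (\<lambda>n. real n ^ 6 * p n ^ 3 * (1 - p n) * (1 - sqrt 2 * p n)\<^sup>2
          + real n ^ 5 * p n ^ 3 * (1 - p n)
          + real n ^ 4 * p n ^ 2 * (1 - p n)) \<and>
    (p \<ggreater> (\<lambda>n. 1 / real n ^ 2) \<longrightarrow>
       (\<lambda>n. real n ^ 6 * p n ^ 3 * (1 - p n) * (1 - sqrt 2 * p n)\<^sup>2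
          + real n ^ 5 * p n ^ 3 * (1 - p n)
          + real n ^ 4 * p n ^ 2 * (1 - p n)) \<simeq>
       (\<lambda>n. real n ^ 6 * p n ^ 3 * (1 - p n) * (1 - sqrt 2 * p n)\<^sup>2
          + real n ^ 5 * p n ^ 3 * (1 - p n))) \<and>
    (p \<lesssim> (\<lambda>n. 1 / real n ^ 2) \<longrightarrow>
       (\<lambda>n. real n ^ 6 * p n ^ 3 * (1 - p n) * (1 - sqrt 2 * p n)\<^sup>2
          + real n ^ 5 * p n ^ 3 * (1 - p n)
          + real n ^ 4 * p n ^ 2 * (1 - p n)) \<simeq>
       (\<lambda>n. real n ^ 4 * p n ^ 2)) \<and>
    (filterlim (\<lambda>n. variance_num_edges n (p n)) at_top sequentially \<longleftrightarrow>
       p \<ggreater> (\<lambda>n. 1 / real n ^ 2) \<and> (\<lambda>n. 1 - p n) \<ggreater> (\<lambda>n. 1 / real n ^ 6))"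
proof -
  let ?T = "\<lambda>n. var_order (real n) (p n)"
  let ?V = "\<lambda>n. variance_num_edges n (p n)"
  let ?T2 = "\<lambda>n. real n ^ 6 * p n ^ 3 * (1 - p n) * (1 - sqrt 2 * p n)\<^sup>2 + real n ^ 5 * p n ^ 3 * (1 - p n)"
  have p: "0 < p n" "p n < 1" if "n \<ge> 1" for n using assms that by auto
  \<comment> \<open>\<open>p n\<close> is constrained only from \<open>n = 1\<close> on; the first
    conjunct carries this into the eventual statements.\<close>
  have large: "eventually (\<lambda>n. n \<ge> 1 \<and> n \<ge> N) sequentially" for N :: nat
    by (intro eventually_conj eventually_ge_at_top)
  have abs2: "\<bar>p n / (1 / real n ^ 2)\<bar> = (real n)\<^sup>2 * p n" if "n \<ge> 1" for n
    using p[OF that] by (simp add: abs_mult)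
  have abs6: "\<bar>(1 - p n) / (1 / real n ^ 6)\<bar> = real n ^ 6 * (1 - p n)" if "n \<ge> 1" for n
    using p[OF that] by (simp add: abs_mult)
  have ev_abs2: "eventually (\<lambda>n. \<bar>p n / (1 / real n ^ 2)\<bar> = (real n)\<^sup>2 * p n) sequentially"
    using large[of 1] by (rule eventually_mono) (simp only: abs2)
  have ev_abs6: "eventually (\<lambda>n. \<bar>(1 - p n) / (1 / real n ^ 6)\<bar> = real n ^ 6 * (1 - p n)) sequentially"
    using large[of 1] by (rule eventually_mono) (simp only: abs6)
  have dom2: "p \<ggreater> (\<lambda>n. 1 / real n ^ 2) \<longleftrightarrow> (\<forall>M. eventually (\<lambda>n. M \<le> (real n)\<^sup>2 * p n) sequentially)"
    unfolding asymp_dominates_iff filterlim_cong[OF refl refl ev_abs2] filterlim_at_top ..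
  have dom6: "(\<lambda>n. 1 - p n) \<ggreater> (\<lambda>n. 1 / real n ^ 6)
      \<longleftrightarrow> (\<forall>M. eventually (\<lambda>n. M \<le> real n ^ 6 * (1 - p n)) sequentially)"
    unfolding asymp_dominates_iff filterlim_cong[OF refl refl ev_abs6] filterlim_at_top ..
  have bounds: "eventually (\<lambda>n. ?T n / 16000 \<le> ?V n \<and> ?V n \<le> 1000 * ?T n) sequentially"
    using large[of 3200000] by (rule eventually_mono) (use p variance_num_edges_bounds in auto)
  have "?V \<simeq> ?T"
    by (rule asymp_orderI[of "1 / 16000" _ _ 1000], simp,
        rule eventually_elim2[OF bounds large[of 1]]) (use p var_order_pos in auto)
  moreover have "?T \<simeq> ?T2" if "p \<ggreater> (\<lambda>n. 1 / real n ^ 2)"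
  proof (rule asymp_orderI[of 1 _ _ 101])
    have "eventually (\<lambda>n. 1 \<le> (real n)\<^sup>2 * p n) sequentially" using that dom2 by blast
    then show "eventually (\<lambda>n. 0 < ?T2 n \<and> 1 * ?T2 n \<le> ?T n \<and> ?T n \<le> 101 * ?T2 n) sequentially"
      using large[of 2]
    proof (rule eventually_elim2)
      fix n assume n: "1 \<le> (real n)\<^sup>2 * p n" "n \<ge> 1 \<and> n \<ge> 2"
      have pn: "0 < p n" "p n < 1" using p n by auto
      have "real n ^ 4 * (p n)\<^sup>2 * (1 - p n) \<le> 100 * ?T2 n"
        using var_order_dense[OF pn _ n(1)] n(2) by simp
      moreover have "0 < ?T2 n" using pn n(2) by (intro add_nonneg_pos) auto
      moreover have "0 \<le> real n ^ 4 * (p n)\<^sup>2 * (1 - p n)" using pn by simp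
      moreover have "0 < t \<and> 1 * t \<le> t + c \<and> t + c \<le> 101 * t" if "c \<le> 100 * t" "0 < t" "0 \<le> c"
        for t c :: real using that by simp
      ultimately show "0 < ?T2 n \<and> 1 * ?T2 n \<le> ?T n \<and> ?T n \<le> 101 * ?T2 n"
        unfolding var_order_def by blast
    qed
  qed simp
  moreover have "?T \<simeq> (\<lambda>n. real n ^ 4 * p n ^ 2)" if bdd: "p \<lesssim> (\<lambda>n. 1 / real n ^ 2)"
  proof -
    obtain C where C: "eventually (\<lambda>n. \<bar>p n / (1 / real n ^ 2)\<bar> \<le> C) sequentially"
      using bdd by (rule asymp_boundedE)
    \<comment> \<open>For \<open>n\<close> beyond \<open>2 * C\<close> the bound on
      \<open>(real n)\<^sup>2 * p n\<close> gives \<open>p n \<le> 1 / 2\<close>, so dropping the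
      factor \<open>1 - p n\<close> costs at most 2.\<close>
    obtain N :: nat where N: "2 * C \<le> real N" using real_arch_simple by blast
    show ?thesis
    proof (rule asymp_orderI[of "1 / 2" _ _ "2 * C + 1"])
      show "eventually (\<lambda>n. 0 < real n ^ 4 * p n ^ 2 \<and> 1 / 2 * (real n ^ 4 * p n ^ 2) \<le> ?T n
          \<and> ?T n \<le> (2 * C + 1) * (real n ^ 4 * p n ^ 2)) sequentially"
        using C large[of N]
      proof (rule eventually_elim2)
        fix n assume n: "\<bar>p n / (1 / real n ^ 2)\<bar> \<le> C" "n \<ge> 1 \<and> n \<ge> N"
        let ?x = "real n"
        have pn: "0 < p n" "p n < 1" and x: "1 \<le> ?x" using p n by auto
        have xp: "?x\<^sup>2 * p n \<le> C" using n abs2 by simp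
        have "?x * (2 * p n) \<le> ?x * 1"
        proof -
          have "?x * (2 * p n) \<le> 2 * (?x\<^sup>2 * p n)"
            using x pn by (simp add: power2_eq_square mult_left_mono)
          also have "\<dots> \<le> ?x" using xp N n(2) by simp
          finally show ?thesis by simp
        qed
        then have half: "p n \<le> 1 / 2" using x by simp
        let ?c = "?x ^ 4 * p n ^ 2"
        have c: "0 < ?c" using pn x by simp
        have "?c * (1 / 2) \<le> ?c * (1 - p n)" using c half by (intro mult_left_mono) auto
        then have "1 / 2 * ?c \<le> ?c * (1 - p n)" by simp
        moreover have "0 \<le> ?T2 n" using pn by simp
        ultimately have lower: "1 / 2 * ?c \<le> ?T n" unfolding var_order_def by (rule add_increasing[rotated])
        have "?T n \<le> 2 * (?x\<^sup>2 * p n) ^ 3 + (?x\<^sup>2 * p n)\<^sup>2"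
          by (rule var_order_le(1)[OF pn x])
        \<comment> \<open>With y = n^2 p the bound is (2 y + 1) y^2, and y^2 is the target
          order.\<close>
        also have "\<dots> = (2 * (?x\<^sup>2 * p n) + 1) * ?c"
          by (simp add: eval_nat_numeral algebra_simps)
        also have "\<dots> \<le> (2 * C + 1) * ?c"
          using xp c by (intro mult_right_mono) auto
        finally show "0 < ?c \<and> 1 / 2 * ?c \<le> ?T n \<and> ?T n \<le> (2 * C + 1) * ?c"
          using c lower by simp
      qed
    qed simp
  qed
  moreover have "filterlim ?V at_top sequentially \<longleftrightarrow>
      p \<ggreater> (\<lambda>n. 1 / real n ^ 2) \<and> (\<lambda>n. 1 - p n) \<ggreater> (\<lambda>n. 1 / real n ^ 6)"
  proof
    assume V: "filterlim ?V at_top sequentially"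
    have T: "eventually (\<lambda>n. M \<le> ?T n) sequentially" for M
    proof -
      have "eventually (\<lambda>n. 1000 * M \<le> ?V n) sequentially" using V by (simp add: filterlim_at_top)
      then show ?thesis using bounds by (rule eventually_elim2) linarith
    qed
    have "eventually (\<lambda>n. M \<le> (real n)\<^sup>2 * p n) sequentially" for M
    proof -
      define K where "K = max M 1"
      \<comment> \<open>If \<open>(real n)\<^sup>2 * p n\<close> were at most \<open>K\<close>, the
        order would be at most \<open>2 * K ^ 3 + K\<^sup>2\<close>; the additional 1 makes this
        contradictory.\<close>
      have "eventually (\<lambda>n. 2 * K ^ 3 + K\<^sup>2 + 1 \<le> ?T n) sequentially" by (rule T)
      then show ?thesis using large[of 1]
      proof (rule eventually_elim2)
        fix n assume n: "2 * K ^ 3 + K\<^sup>2 + 1 \<le> ?T n" "n \<ge> 1 \<and> n \<ge> 1"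
        let ?y = "(real n)\<^sup>2 * p n"
        have "2 * K ^ 3 + K\<^sup>2 + 1 \<le> 2 * ?y ^ 3 + ?y\<^sup>2"
          using n var_order_le(1)[of "p n" "real n"] p[of n] by auto
        moreover have "2 * ?y ^ 3 + ?y\<^sup>2 \<le> 2 * K ^ 3 + K\<^sup>2" if "?y \<le> K"
          using that p[of n] n(2) by (intro add_mono mult_left_mono power_mono) auto
        ultimately have "K \<le> ?y" by linarith
        then show "M \<le> ?y" by (simp add: K_def)
      qed
    qed
    moreover have "eventually (\<lambda>n. M \<le> real n ^ 6 * (1 - p n)) sequentially" for M
      using T[of "3 * M"] large[of 1]
    proof (rule eventually_elim2)
      fix n assume n: "3 * M \<le> ?T n" "n \<ge> 1 \<and> n \<ge> 1"
      then have "?T n \<le> 3 * (real n ^ 6 * (1 - p n))" using p[of n] by (intro var_order_le(2)) auto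
      with n(1) show "M \<le> real n ^ 6 * (1 - p n)" by linarith
    qed
    ultimately show "p \<ggreater> (\<lambda>n. 1 / real n ^ 2) \<and> (\<lambda>n. 1 - p n) \<ggreater> (\<lambda>n. 1 / real n ^ 6)"
      unfolding dom2 dom6 by blast
  next
    assume "p \<ggreater> (\<lambda>n. 1 / real n ^ 2) \<and> (\<lambda>n. 1 - p n) \<ggreater> (\<lambda>n. 1 / real n ^ 6)"
    then have ev2: "eventually (\<lambda>n. M \<le> (real n)\<^sup>2 * p n) sequentially"
      and ev6: "eventually (\<lambda>n. M \<le> real n ^ 6 * (1 - p n)) sequentially" for M
      unfolding dom2 dom6 by blast+
    show "filterlim ?V at_top sequentially"
      unfolding filterlim_at_top
    proof
      fix M :: real
      \<comment> \<open>1600000 is 16000 from the variance bound times 100 from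
        \<open>var_order_ge\<close>, which also asks for a value of at least 1.\<close>
      define K where "K = max 1 (1600000 * M)"
      obtain N :: nat where N: "K \<le> real N" using real_arch_simple by blast
      show "eventually (\<lambda>n. M \<le> ?V n) sequentially"
        using ev2[of K] ev6[of K] large[of N] bounds
      proof eventually_elim
        case (elim n)
        then have "K / 100 \<le> ?T n"
          using p[of n] N by (intro var_order_ge) (auto simp: K_def)
        moreover have "1600000 * M \<le> K" by (simp add: K_def)
        ultimately show "M \<le> ?V n" using elim by linarith
      qed
    qed
  qed
  ultimately show ?thesis unfolding var_order_def by blast
qed

end
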